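(* Let $D\subset\mathbb{C}^n$ be an open invariant set, let $f\in\mathcal{S}(\Omega_D)$ and fix any $m\in\{1,\dots,n\}$. Then, for every $x\in\Omega_{D_{\llbracket m\rrbracket}}$, $$f(x)=\sum_{K\in\mathcal{P}(m)}(-1)^{|K^c|}(\overline{x})_{K^c}\,\mathcal{S}^{\llbracket m\rrbracket}_K(f)(x),$$ where $K^c=\{1,\dots,m\}\setminus K$ and the products are ordinary pointwise products in $\mathbb{H}$. Moreover: 1. if $m<n$, then $\mathcal{S}^{\llbracket m\rrbracket}_K(f)\in\mathcal{S}_{c,\{1,\dots,m\}}(\Omega_{D_{\llbracket m\rrbracket}})\cap\mathcal{S}_{m+1}(\Omega_{D_{\llbracket m\rrbracket}})$ for any $K\in\mathcal{P}(m)$, while $\mathcal{S}^{\llbracket n\rrbracket}_K(f)\in\mathcal{S}_{c,\{1,\dots,n\}}(\Omega_{D_{\llbracket n\rrbracket}})$ for any $K\in\mathcal{P}(n)$; 2. if $f\in\mathcal{SR}(\Omega_D)$, then $\Delta_h\mathcal{S}^{\llbracket m\rrbracket}_K(f)=0$ on $\Omega_D$ for all $h\le m$ and all $K\in\mathcal{P}(m)$.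
   Context: Sets and products. $\mathbb{H}$ denotes the quaternions, $\mathbb{S}_\mathbb{H}=\{J\in\mathbb{H}: J^2=-1\}$, $\mathcal{P}(m)$ is the power set of $\llbracket m\rrbracket:=\{1,\dots,m\}$. For $K=\{k_1<\dots<k_p\}$ and quaternions $q_k$, $q_K:=q_{k_1}\cdots q_{k_p}$ (increasing order), $q_\emptyset:=1$; thus $(\overline x)_K=\overline{x_{k_1}}\cdots\overline{x_{k_p}}$. For $z\in\mathbb{C}^n$ write $z_h=\alpha_h+i\beta_h$ with $\alpha_h,\beta_h\in\mathbb{R}$, and let $\overline z^h$ be $z$ with $z_h$ replaced by $\overline{z_h}$. Stem and slice functions. $D\subset\mathbb{C}^n$ is invariant if $z\in D\iff\overline z^h\in D$ for all $h$. Let $\{e_K\}_{K\in\mathcal{P}(n)}$ be a basis of $\mathbb{R}^{2^n}$, $e_\emptyset=1$, $e_h:=e_{\{h\}}$. A stem function on $D$ is a continuous $F=\sum_{K\in\mathcal{P}(n)}e_KF_K:D\to\mathbb{H}\otimes\mathbb{R}^{2^n}$ ($F_K$ $\mathbb{H}$-valued) with $F_K(\overline z^h)=(-1)^{|K\cap\{h\}|}F_K(z)$ for all $K,h$. The circularization of $D$ is $\Omega_D=\{(\alpha_1+J_1\beta_1,\dots,\alpha_n+J_n\beta_n): (\alpha_1+i\beta_1,\dots,\alpha_n+i\beta_n)\in D,\ J_1,\dots,J_n\in\mathbb{S}_\mathbb{H}\}$. $F$ induces the slice function $f=\mathcal{I}(F):\Omega_D\to\mathbb{H}$, $f(x)=\sum_{K}J_KF_K(z)$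 for $x=(\alpha_h+J_h\beta_h)_h$, $z=(\alpha_h+i\beta_h)_h$; the stem function $F$ is determined by $f$. $\mathcal{S}(\Omega_D)$ is the set of slice functions on $\Omega_D$. Product: $(F\otimes G)(z)=\sum_{H,K}(-1)^{|H\cap K|}e_{K\Delta H}F_K(z)G_H(z)$ ($\Delta$ = symmetric difference) and $\mathcal{I}(F)\odot\mathcal{I}(G):=\mathcal{I}(F\otimes G)$. The coordinate function $x_j$ is the slice function induced by $Z_j(z)=\alpha_j+e_j\beta_j$; $x_K$ is the ordered product of the $x_k$, $k\in K$. Regularity. $\mathcal{J}_h(q\otimes e_K)=(-1)^{|K\cap\{h\}|}q\otimes e_{K\Delta\{h\}}$ and $\overline\partial_h=\frac12(\partial/\partial\alpha_h+\mathcal{J}_h\,\partial/\partial\beta_h)$. A $C^1$ stem function $F$ is holomorphic if $\overline\partial_hF=0$ for every $h=1,\dots,n$; $f=\mathcal{I}(F)$ is slice regular if $F$ is holomorphic. $\mathcal{SR}(\Omega_D)$ is the set of slice regular functions. Partial properties. For $y\in\Omega_D$ let $f^y_h(x)=f(y_1,\dots,y_{h-1},x,y_{h+1},\dots,y_n)$, defined for those $x\in\mathbb{H}$ with $(y_1,\dots,y_{h-1},x,y_{h+1},\dots,y_n)\in\Omega_D$. A function $f\in\mathcal{S}(\Omega_D)$ is slice w.r.t. $x_h$ if for every $y\in\Omega_D$ the function $f^y_h$ is slice in the sense above with $n=1$; it is circular w.r.t. $x_h$ if each $f^y_h$ is constant on every sphere $\{\alpha+J\beta:J\in\mathbb{S}_\mathbb{H}\}$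 contained in its domain. The corresponding subsets of $\mathcal{S}(\Omega_D)$ are $\mathcal{S}_h(\Omega_D)$, $\mathcal{S}_{c,h}(\Omega_D)$, and $\mathcal{S}_{c,H}(\Omega_D)=\bigcap_{h\in H}\mathcal{S}_{c,h}(\Omega_D)$. Spherical derivatives and components. For $H\in\mathcal{P}(n)$ let $H^c=\{1,\dots,n\}\setminus H$, $D_H=\{z\in D:\beta_h\ne0\ \forall h\in H\}$, $\Omega_{D_H}$ its circularization, and for $f=\mathcal{I}(F)\in\mathcal{S}(\Omega_D)$ let $f'_{s,H}=\mathcal{I}(F'_H)\in\mathcal{S}(\Omega_{D_H})$, where $F'_H(z)=\big(\prod_{h\in H}\beta_h\big)^{-1}\sum_{K\subset H^c}e_KF_{K\cup H}(z)$. For $K\subset\llbracket m\rrbracket$ define $\mathcal{S}^{\llbracket m\rrbracket}_K(f):=(x_K\odot f)'_{s,\llbracket m\rrbracket}$ on $\Omega_{D_{\llbracket m\rrbracket}}$. When $f$ is slice regular, $\mathcal{S}^{\llbracket m\rrbracket}_K(f)$ extends continuously (in a unique way) to $\Omega_D$ and the extension is denoted by the same symbol. $\Delta_h$ is the Laplacian of $\mathbb{R}^4$ in the four real coordinates of the quaternionic variable $x_h$. *)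

theory Defs
  imports "HOL-Analysis.Analysis"
begin

section \<open>Quaternions\<close>

codatatype quat = Quat (qRe: real) (qIm1: real) (qIm2: real) (qIm3: real)

lemma quat_eqI [intro?]:
  "qRe x = qRe y \<Longrightarrow> qIm1 x = qIm1 y \<Longrightarrow> qIm2 x = qIm2 y \<Longrightarrow> qIm3 x = qIm3 y \<Longrightarrow> x = y"
  by (rule quat.expand) simp

lemma quat_eq_iff:
  "x = y \<longleftrightarrow> qRe x = qRe y \<and> qIm1 x = qIm1 y \<and> qIm2 x = qIm2 y \<and> qIm3 x = qIm3 y"
  by (auto intro: quat.expand)

primcorec quat_i :: quat where
  "qRe quat_i = 0" | "qIm1 quat_i = 1" | "qIm2 quat_i = 0" | "qIm3 quat_i = 0"

primcorec quat_j :: quat where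
  "qRe quat_j = 0" | "qIm1 quat_j = 0" | "qIm2 quat_j = 1" | "qIm3 quat_j = 0"

primcorec quat_k :: quat where
  "qRe quat_k = 0" | "qIm1 quat_k = 0" | "qIm2 quat_k = 0" | "qIm3 quat_k = 1"

primcorec qcnj :: "quat \<Rightarrow> quat" where
  "qRe (qcnj x) = qRe x" | "qIm1 (qcnj x) = - qIm1 x"
| "qIm2 (qcnj x) = - qIm2 x" | "qIm3 (qcnj x) = - qIm3 x"

instantiation quat :: ring_1
begin

primcorec zero_quat where
  "qRe 0 = 0" | "qIm1 0 = 0" | "qIm2 0 = 0" | "qIm3 0 = 0"

primcorec one_quat where
  "qRe 1 = 1" | "qIm1 1 = 0" | "qIm2 1 = 0" | "qIm3 1 = 0"

primcorec plus_quat where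
  "qRe (x + y) = qRe x + qRe y" | "qIm1 (x + y) = qIm1 x + qIm1 y"
| "qIm2 (x + y) = qIm2 x + qIm2 y" | "qIm3 (x + y) = qIm3 x + qIm3 y"

primcorec uminus_quat where
  "qRe (- x) = - qRe x" | "qIm1 (- x) = - qIm1 x"
| "qIm2 (- x) = - qIm2 x" | "qIm3 (- x) = - qIm3 x"

primcorec minus_quat where
  "qRe (x - y) = qRe x - qRe y" | "qIm1 (x - y) = qIm1 x - qIm1 y"
| "qIm2 (x - y) = qIm2 x - qIm2 y" | "qIm3 (x - y) = qIm3 x - qIm3 y"

primcorec times_quat where
  "qRe (x * y) = qRe x * qRe y - qIm1 x * qIm1 y - qIm2 x * qIm2 y - qIm3 x * qIm3 y"
| "qIm1 (x * y) = qRe x * qIm1 y + qIm1 x * qRe y + qIm2 x * qIm3 y - qIm3 x * qIm2 y"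
| "qIm2 (x * y) = qRe x * qIm2 y - qIm1 x * qIm3 y + qIm2 x * qRe y + qIm3 x * qIm1 y"
| "qIm3 (x * y) = qRe x * qIm3 y + qIm1 x * qIm2 y - qIm2 x * qIm1 y + qIm3 x * qRe y"

instance
  by standard (simp_all add: quat_eq_iff algebra_simps)

end

instantiation quat :: real_algebra_1
begin

primcorec scaleR_quat where
  "qRe (scaleR r x) = r * qRe x" | "qIm1 (scaleR r x) = r * qIm1 x"
| "qIm2 (scaleR r x) = r * qIm2 x" | "qIm3 (scaleR r x) = r * qIm3 x"

instance
  by standard (simp_all add: quat_eq_iff algebra_simps)

end

instantiation quat :: real_inner
begin

definition inner_quat_def:
  "inner x y = qRe x * qRe y + qIm1 x * qIm1 y + qIm2 x * qIm2 y + qIm3 x * qIm3 y"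

definition norm_quat_def: "norm (x::quat) = sqrt (inner x x)"

definition sgn_quat_def: "sgn (x::quat) = x /\<^sub>R norm x"

definition dist_quat_def: "dist (x::quat) y = norm (x - y)"

definition uniformity_quat_def:
  "(uniformity :: (quat \<times> quat) filter) = (INF e\<in>{0 <..}. principal {(x, y). dist x y < e})"

definition open_quat_def:
  "open (U :: quat set) \<longleftrightarrow> (\<forall>x\<in>U. eventually (\<lambda>(x', y). x' = x \<longrightarrow> y \<in> U) uniformity)"

instance
proof
  fix x :: quat
  show "0 \<le> inner x x"
    by (simp add: inner_quat_def)
  show "inner x x = 0 \<longleftrightarrow> x = 0"
    by (simp add: inner_quat_def quat_eq_iff add_nonneg_eq_0_iff)
qed (rule norm_quat_def sgn_quat_def dist_quat_def uniformity_quat_def open_quat_def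
      | simp add: inner_quat_def algebra_simps)+

end

instantiation quat :: real_normed_div_algebra
begin

definition inverse_quat_def: "inverse x = qcnj x /\<^sub>R inner x x"

definition divide_quat_def: "divide x y = x * inverse (y::quat)"

instance
proof
  fix x y :: quat
  show "norm (x * y) = norm x * norm y"
  proof -
    have "inner (x * y) (x * y) = inner x x * inner y y"
      unfolding inner_quat_def times_quat.simps by algebra
    then show ?thesis
      by (simp add: norm_quat_def real_sqrt_mult)
  qed
  have *: "x * qcnj x = inner x x *\<^sub>R 1" "qcnj x * x = inner x x *\<^sub>R 1"
    by (simp_all add: quat_eq_iff inner_quat_def)
  show "x \<noteq> 0 \<Longrightarrow> inverse x * x = 1"
    by (simp add: inverse_quat_def *)
  show "x \<noteq> 0 \<Longrightarrow> x * inverse x = 1"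
    by (simp add: inverse_quat_def *)
  show "inverse (0::quat) = 0"
    by (simp add: inverse_quat_def)
  show "x div y = x * inverse y"
    by (rule divide_quat_def)
qed

end

instantiation quat :: euclidean_space
begin

definition Basis_quat_def: "Basis = {1, quat_i, quat_j, quat_k}"

instance
proof
  fix u v x :: quat
  show "(Basis :: quat set) \<noteq> {}" "finite (Basis :: quat set)"
    by (simp_all add: Basis_quat_def)
  show "inner u v = (if u = v then 1 else 0)" if "u \<in> Basis" "v \<in> Basis"
    using that unfolding Basis_quat_def
    by (elim insertE emptyE) (simp_all add: inner_quat_def quat_eq_iff)
  show "(\<forall>u\<in>Basis. inner x u = 0) \<longleftrightarrow> x = 0"
    by (simp add: Basis_quat_def inner_quat_def quat_eq_iff [of x 0])
qed

end

definition imag_units :: "quat set"  (\<open>\<S>\<^sub>\<bbbH>\<close>) where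
  "\<S>\<^sub>\<bbbH> = {J. J\<^sup>2 = - 1}"

definition oprod :: "(nat \<Rightarrow> quat) \<Rightarrow> nat set \<Rightarrow> quat" where
  "oprod q K = prod_list (map q (sorted_list_of_set K))"


section \<open>Stem functions and slice functions\<close>

text \<open>
  Points of \<open>\<complex>\<^sup>n\<close> and \<open>\<bbbH>\<^sup>n\<close> are extensional functions on \<open>{1..n}\<close>; the topology is the
  product topology on functions, restricted to these sets. Explicit index sets are used
  instead of an index type because the order of the indices matters and dimension \<open>n\<close> and
  dimension 1 occur together. A function \<open>D \<rightarrow> \<bbbH> \<otimes> \<real>\<^bsup>2^n\<^esup>\<close> is represented by its components,
  \<open>F z K\<close> being the coefficient of \<open>e\<^sub>K\<close> at \<open>z\<close>; only \<open>z \<in> D\<close> and \<open>K \<subseteq> {1..n}\<close> are relevant.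
\<close>

type_synonym stem = "(nat \<Rightarrow> complex) \<Rightarrow> nat set \<Rightarrow> quat"

definition invariant :: "nat \<Rightarrow> (nat \<Rightarrow> complex) set \<Rightarrow> bool" where
  "invariant n D \<longleftrightarrow> D \<subseteq> {1..n} \<rightarrow>\<^sub>E UNIV \<and>
     (\<forall>z \<in> {1..n} \<rightarrow>\<^sub>E UNIV. \<forall>h\<in>{1..n}. z \<in> D \<longleftrightarrow> z(h := cnj (z h)) \<in> D)"

definition slice_point :: "nat \<Rightarrow> (nat \<Rightarrow> quat) \<Rightarrow> (nat \<Rightarrow> complex) \<Rightarrow> nat \<Rightarrow> quat" where
  "slice_point n J z = (\<lambda>h\<in>{1..n}. of_real (Re (z h)) + J h * of_real (Im (z h)))"

definition circularization :: "nat \<Rightarrow> (nat \<Rightarrow> complex) set \<Rightarrow> (nat \<Rightarrow> quat) set"  (\<open>\<Omega>\<close>) where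
  "\<Omega> n D = {slice_point n J z | J z. z \<in> D \<and> J \<in> {1..n} \<rightarrow> \<S>\<^sub>\<bbbH>}"

definition stem_functions :: "nat \<Rightarrow> (nat \<Rightarrow> complex) set \<Rightarrow> stem set" where
  "stem_functions n D = {F. \<forall>K\<in>Pow {1..n}. continuous_on D (\<lambda>z. F z K) \<and>
     (\<forall>z\<in>D. \<forall>h\<in>{1..n}. F (z(h := cnj (z h))) K = (-1) ^ card (K \<inter> {h}) * F z K)}"

text \<open>
  For a stem function \<open>F\<close> the value below does not depend on the representation of \<open>x\<close>, so
  the definite description is proper for every \<open>x \<in> \<Omega> n D\<close>.
\<close>

definition induced :: "nat \<Rightarrow> (nat \<Rightarrow> complex) set \<Rightarrow> stem \<Rightarrow> (nat \<Rightarrow> quat) \<Rightarrow> quat" where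
  "induced n D F x = (THE q. \<exists>z\<in>D. \<exists>J \<in> {1..n} \<rightarrow> \<S>\<^sub>\<bbbH>. x = slice_point n J z \<and>
     q = (\<Sum>K\<in>Pow {1..n}. oprod J K * F z K))"

text \<open>
  Functions on \<open>\<Omega> n D\<close> are total functions whose values outside \<open>\<Omega> n D\<close> are irrelevant.
\<close>

definition slice_functions :: "nat \<Rightarrow> (nat \<Rightarrow> complex) set \<Rightarrow> ((nat \<Rightarrow> quat) \<Rightarrow> quat) set" where
  "slice_functions n D = {f. \<exists>F\<in>stem_functions n D. \<forall>x\<in>\<Omega> n D. f x = induced n D F x}"

text \<open>
  The stem function of a slice function; its components with \<open>K \<subseteq> {1..n}\<close> are uniquely
  determined on \<open>D\<close>.
\<close>

definition stem_of :: "nat \<Rightarrow> (nat \<Rightarrow> complex) set \<Rightarrow> ((nat \<Rightarrow> quat) \<Rightarrow> quat) \<Rightarrow> stem" where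
  "stem_of n D f = (SOME F. F \<in> stem_functions n D \<and> (\<forall>x\<in>\<Omega> n D. f x = induced n D F x))"

definition stem_prod :: "nat \<Rightarrow> stem \<Rightarrow> stem \<Rightarrow> stem" where
  "stem_prod n F G z L = (\<Sum>H\<in>Pow {1..n}. \<Sum>K\<in>Pow {1..n}.
     if sym_diff K H = L then (-1) ^ card (H \<inter> K) * F z K * G z H else 0)"

definition slice_prod :: "nat \<Rightarrow> (nat \<Rightarrow> complex) set \<Rightarrow>
    ((nat \<Rightarrow> quat) \<Rightarrow> quat) \<Rightarrow> ((nat \<Rightarrow> quat) \<Rightarrow> quat) \<Rightarrow> (nat \<Rightarrow> quat) \<Rightarrow> quat" where
  "slice_prod n D f g = induced n D (stem_prod n (stem_of n D f) (stem_of n D g))"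

definition coord_stem :: "nat \<Rightarrow> stem" where
  "coord_stem j z K = (if K = {} then of_real (Re (z j))
     else if K = {j} then of_real (Im (z j)) else 0)"

definition coord :: "nat \<Rightarrow> (nat \<Rightarrow> complex) set \<Rightarrow> nat \<Rightarrow> (nat \<Rightarrow> quat) \<Rightarrow> quat" where
  "coord n D j = induced n D (coord_stem j)"

definition coord_prod :: "nat \<Rightarrow> (nat \<Rightarrow> complex) set \<Rightarrow> nat set \<Rightarrow> (nat \<Rightarrow> quat) \<Rightarrow> quat" where
  "coord_prod n D K =
     foldr (\<lambda>k g. slice_prod n D (coord n D k) g) (sorted_list_of_set K) (\<lambda>_. 1)"


section \<open>Slice regularity\<close>

text \<open>The directions \<open>w = 1\<close> and \<open>w = \<i>\<close> give \<open>\<partial>/\<partial>\<alpha>\<^sub>h\<close> and \<open>\<partial>/\<partial>\<beta>\<^sub>h\<close>.\<close>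

definition stem_partial :: "nat \<Rightarrow> complex \<Rightarrow> stem \<Rightarrow> stem" where
  "stem_partial h w F z K = vector_derivative (\<lambda>t. F (z(h := z h + t *\<^sub>R w)) K) (at 0)"

definition C1_stem :: "nat \<Rightarrow> (nat \<Rightarrow> complex) set \<Rightarrow> stem \<Rightarrow> bool" where
  "C1_stem n D F \<longleftrightarrow> (\<forall>K\<in>Pow {1..n}. \<forall>h\<in>{1..n}. \<forall>w\<in>{1, \<i>}.
     (\<forall>z\<in>D. (\<lambda>t::real. F (z(h := z h + t *\<^sub>R w)) K) differentiable (at 0)) \<and>
     continuous_on D (\<lambda>z. stem_partial h w F z K))"

text \<open>
  The coefficient of \<open>e\<^sub>K\<close> in \<open>\<J>\<^sub>h q\<close> comes from the term \<open>e\<^sub>L\<close> of \<open>q\<close> with \<open>L = K \<Delta> {h}\<close>.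
\<close>

definition Jop :: "nat \<Rightarrow> (nat set \<Rightarrow> quat) \<Rightarrow> nat set \<Rightarrow> quat" where
  "Jop h q K = (-1) ^ card (sym_diff K {h} \<inter> {h}) * q (sym_diff K {h})"

definition stem_dbar :: "nat \<Rightarrow> stem \<Rightarrow> stem" where
  "stem_dbar h F z K =
     (1/2) *\<^sub>R (stem_partial h 1 F z K + Jop h (stem_partial h \<i> F z) K)"

definition holomorphic_stem :: "nat \<Rightarrow> (nat \<Rightarrow> complex) set \<Rightarrow> stem \<Rightarrow> bool" where
  "holomorphic_stem n D F \<longleftrightarrow> F \<in> stem_functions n D \<and> C1_stem n D F \<and>
     (\<forall>h\<in>{1..n}. \<forall>z\<in>D. \<forall>K\<in>Pow {1..n}. stem_dbar h F z K = 0)"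

definition slice_regular :: "nat \<Rightarrow> (nat \<Rightarrow> complex) set \<Rightarrow> ((nat \<Rightarrow> quat) \<Rightarrow> quat) set" where
  "slice_regular n D = {f. \<exists>F. holomorphic_stem n D F \<and> (\<forall>x\<in>\<Omega> n D. f x = induced n D F x)}"


section \<open>Partial slice properties\<close>

text \<open>A quaternion is identified with a point of \<open>{1} \<rightarrow>\<^sub>E UNIV\<close>.\<close>

definition slice_wrt :: "nat \<Rightarrow> (nat \<Rightarrow> complex) set \<Rightarrow> nat \<Rightarrow> ((nat \<Rightarrow> quat) \<Rightarrow> quat) set" where
  "slice_wrt n D h = {f \<in> slice_functions n D. \<forall>y\<in>\<Omega> n D. \<exists>E. invariant 1 E \<and>
     \<Omega> 1 E = {v \<in> {1..1} \<rightarrow>\<^sub>E UNIV. y(h := v 1) \<in> \<Omega> n D} \<and>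
     (\<lambda>v. f (y(h := v 1))) \<in> slice_functions 1 E}"

definition circular_wrt :: "nat \<Rightarrow> (nat \<Rightarrow> complex) set \<Rightarrow> nat \<Rightarrow> ((nat \<Rightarrow> quat) \<Rightarrow> quat) set" where
  "circular_wrt n D h = {f \<in> slice_functions n D. \<forall>y\<in>\<Omega> n D. \<forall>\<alpha> \<beta>.
     let S = {of_real \<alpha> + J * of_real \<beta> | J. J \<in> \<S>\<^sub>\<bbbH>} in
     (\<forall>v\<in>S. y(h := v) \<in> \<Omega> n D) \<longrightarrow> (\<lambda>v. f (y(h := v))) constant_on S}"

definition circular_wrt_set ::
    "nat \<Rightarrow> (nat \<Rightarrow> complex) set \<Rightarrow> nat set \<Rightarrow> ((nat \<Rightarrow> quat) \<Rightarrow> quat) set" where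
  "circular_wrt_set n D H = {f \<in> slice_functions n D. \<forall>h\<in>H. f \<in> circular_wrt n D h}"


section \<open>Spherical derivatives and components\<close>

definition nonreal_part :: "(nat \<Rightarrow> complex) set \<Rightarrow> nat set \<Rightarrow> (nat \<Rightarrow> complex) set" where
  "nonreal_part D H = {z \<in> D. \<forall>h\<in>H. Im (z h) \<noteq> 0}"

definition spherical_stem :: "nat set \<Rightarrow> stem \<Rightarrow> stem" where
  "spherical_stem H F z K =
     (if K \<inter> H = {} then inverse (\<Prod>h\<in>H. Im (z h)) *\<^sub>R F z (K \<union> H) else 0)"

definition spherical_derivative :: "nat \<Rightarrow> (nat \<Rightarrow> complex) set \<Rightarrow> nat set \<Rightarrow>
    ((nat \<Rightarrow> quat) \<Rightarrow> quat) \<Rightarrow> (nat \<Rightarrow> quat) \<Rightarrow> quat" where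
  "spherical_derivative n D H f =
     induced n (nonreal_part D H) (spherical_stem H (stem_of n D f))"

definition spherical_component :: "nat \<Rightarrow> (nat \<Rightarrow> complex) set \<Rightarrow> nat \<Rightarrow> nat set \<Rightarrow>
    ((nat \<Rightarrow> quat) \<Rightarrow> quat) \<Rightarrow> (nat \<Rightarrow> quat) \<Rightarrow> quat" where
  "spherical_component n D m K f =
     spherical_derivative n D {1..m} (slice_prod n D (coord_prod n D K) f)"

definition continuous_extension :: "'a::topological_space set \<Rightarrow> 'a set \<Rightarrow>
    ('a \<Rightarrow> 'b::topological_space) \<Rightarrow> ('a \<Rightarrow> 'b) \<Rightarrow> bool" where
  "continuous_extension A B f g \<longleftrightarrow> continuous_on B g \<and> (\<forall>x\<in>A. g x = f x)"


section \<open>Laplacian in one quaternionic variable\<close>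

definition has_second_derivative :: "(real \<Rightarrow> 'a::real_normed_vector) \<Rightarrow> 'a \<Rightarrow> real \<Rightarrow> bool" where
  "has_second_derivative \<phi> d t \<longleftrightarrow>
     (\<exists>\<phi>'. (\<forall>\<^sub>F s in nhds t. (\<phi> has_vector_derivative \<phi>' s) (at s)) \<and>
           (\<phi>' has_vector_derivative d) (at t))"

definition has_laplacian :: "nat \<Rightarrow> ((nat \<Rightarrow> quat) \<Rightarrow> quat) \<Rightarrow> quat \<Rightarrow> (nat \<Rightarrow> quat) \<Rightarrow> bool" where
  "has_laplacian h g L x \<longleftrightarrow> (\<exists>d.
     (\<forall>b\<in>Basis. has_second_derivative (\<lambda>t. g (x(h := x h + t *\<^sub>R b))) (d b) 0) \<and>
     L = (\<Sum>b\<in>Basis. d b))"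

end

theory Submission
  imports Defs "HOL-Complex_Analysis.Complex_Analysis"
begin

text \<open>
Every point of \<open>\<Omega> n D\<close> has canonical slice coordinates: its profile, a point of \<open>D\<close> whose
imaginary parts are nonnegative, and one imaginary unit per variable. Parity of a stem function
makes the sum \<open>\<Sum>K. J\<^sub>K F\<^sub>K\<close> independent of the chosen coordinates, and the sums for all
choices of units determine \<open>F\<close>. All assertions thereby become statements about stem functions
at profiles (\<open>induced_canonical\<close>, \<open>stem_unique\<close>).

Multiplying a stem function \<open>F\<close> by the coordinates \<open>x\<^sub>k\<close>, \<open>k \<in> K\<close>, has an explicit
effect on components (\<open>monomial_mult\<close>). In one variable, for \<open>x = \<alpha> + J \<beta>\<close>, the representation
formula is the identity \<open>(\<alpha> F\<^sub>1 + \<beta> F\<^sub>0) / \<beta> - (\<alpha> - J \<beta>) (F\<^sub>1 / \<beta>) = F\<^sub>0 + J F\<^sub>1\<close>; it is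
iterated over the variables from the outside inwards (\<open>spherical_inversion\<close>), which respects the
order of the noncommuting factors. A spherical component is induced by a stem
function whose components with an index in \<open>{1..m}\<close> vanish. So the units of the first \<open>m\<close>
variables do not enter its values, which is circularity, and the unit of variable \<open>m + 1\<close> is
always the leftmost factor, which is sliceness in that variable.

Harmonicity has an algebraic reason. A function of a quaternion \<open>\<alpha> + J \<beta>\<close> of the form
\<open>N \<alpha> \<beta>\<close> has four-dimensional Laplacian \<open>N\<^sub>\<alpha>\<^sub>\<alpha> + N\<^sub>\<beta>\<^sub>\<beta> + (2 / \<beta>) N\<^sub>\<beta>\<close>, and for
\<open>N = v / \<beta>\<close> this is \<open>(v\<^sub>\<alpha>\<^sub>\<alpha> + v\<^sub>\<beta>\<^sub>\<beta>) / \<beta>\<close>, which vanishes when \<open>v\<close> is the imaginary part of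
a holomorphic function. The Cauchy-Riemann equations of a holomorphic stem function say exactly
that the components \<open>F\<^sub>T\<close> and \<open>F\<^sub>T\<^sub>\<union>\<^sub>h\<close>, coordinate by coordinate, are the real and imaginary
parts of a holomorphic function of \<open>z\<^sub>h\<close>.

The analytic work is to carry this across the real points of all the variables. Division by
\<open>\<beta>\<^sub>k\<close> is the divided difference of a holomorphic function between \<open>z\<^sub>k\<close> and its conjugate.
Cauchy's integral shows that it extends continuously, jointly in all variables
(\<open>continuous_conj_quotient\<close>), and the extension stays holomorphic in each other variable as a
locally uniform limit (\<open>separately_holomorphic_limit\<close>). The variables can therefore be divided
out one after another (\<open>iterated_spherical_quotient\<close>), leaving any prescribed variable \<open>h\<close> to
the end. In that last variable one holomorphic function of \<open>z\<^sub>h\<close> remains, so the Laplacian can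
be computed also where some other \<open>\<beta>\<^sub>k\<close> vanishes (\<open>harmonic_extension\<close>). All these extensions
agree, because points with \<open>\<beta>\<^sub>k \<noteq> 0\<close> for \<open>k \<le> m\<close> are dense (\<open>agree_from_nonreal_part\<close>).
\<close>

section \<open>Slice coordinates of a quaternion\<close>

lemma of_real_quat_sel [simp]:
  "qRe (of_real r) = r" "qIm1 (of_real r) = 0" "qIm2 (of_real r) = 0" "qIm3 (of_real r) = 0"
  by (simp_all add: of_real_def)

lemma imag_units_iff:
  "J \<in> \<S>\<^sub>\<bbbH> \<longleftrightarrow> qRe J = 0 \<and> (qIm1 J)\<^sup>2 + (qIm2 J)\<^sup>2 + (qIm3 J)\<^sup>2 = 1"
proof
  assume "J \<in> \<S>\<^sub>\<bbbH>"
  then have e: "J * J = -1"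
    by (simp add: imag_units_def power2_eq_square)
  have q: "qRe J * qRe J - qIm1 J * qIm1 J - qIm2 J * qIm2 J - qIm3 J * qIm3 J = -1"
    "qRe J = 0 \<or> qIm1 J = 0" "qRe J = 0 \<or> qIm2 J = 0" "qRe J = 0 \<or> qIm3 J = 0"
    using e by (auto simp add: quat_eq_iff)
  show "qRe J = 0 \<and> (qIm1 J)\<^sup>2 + (qIm2 J)\<^sup>2 + (qIm3 J)\<^sup>2 = 1"
  proof (cases "qRe J = 0")
    case True
    with q show ?thesis by (simp add: power2_eq_square)
  next
    case False
    with q(2,3,4) have "qIm1 J = 0" "qIm2 J = 0" "qIm3 J = 0"
      by auto
    with q(1) have "qRe J * qRe J = -1" by simp
    then show ?thesis
      using zero_le_square[of "qRe J"] by linarith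
  qed
next
  assume "qRe J = 0 \<and> (qIm1 J)\<^sup>2 + (qIm2 J)\<^sup>2 + (qIm3 J)\<^sup>2 = 1"
  then show "J \<in> \<S>\<^sub>\<bbbH>"
    by (simp add: imag_units_def power2_eq_square quat_eq_iff algebra_simps)
qed

lemma imag_units_uminus: "J \<in> \<S>\<^sub>\<bbbH> \<Longrightarrow> - J \<in> \<S>\<^sub>\<bbbH>"
  by (simp add: imag_units_iff)

lemma norm_quat: "norm q = sqrt ((qRe q)\<^sup>2 + (qIm1 q)\<^sup>2 + (qIm2 q)\<^sup>2 + (qIm3 q)\<^sup>2)"
  by (simp add: norm_quat_def inner_quat_def power2_eq_square)

lemma norm_imag_unit: "J \<in> \<S>\<^sub>\<bbbH> \<Longrightarrow> norm J = 1"
  by (simp add: imag_units_iff norm_quat)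

lemma imag_unit_nonzero: "J \<in> \<S>\<^sub>\<bbbH> \<Longrightarrow> J \<noteq> 0"
  using norm_imag_unit by force

definition im_norm :: "quat \<Rightarrow> real" where
  "im_norm q = sqrt ((qIm1 q)\<^sup>2 + (qIm2 q)\<^sup>2 + (qIm3 q)\<^sup>2)"

text \<open>
A real quaternion is \<open>\<alpha> + J * 0\<close> for every imaginary unit \<open>J\<close>; the value \<open>quat_i\<close> there is an
arbitrary choice, harmless because the components of stem functions that involve the unit
vanish there.
\<close>

definition im_unit :: "quat \<Rightarrow> quat" where
  "im_unit q = (if im_norm q = 0 then quat_i else (q - of_real (qRe q)) /\<^sub>R im_norm q)"

text \<open>
The point of the closed upper half plane that corresponds to a quaternion in each complex slice.
\<close>

definition profile :: "quat \<Rightarrow> complex" where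
  "profile q = Complex (qRe q) (im_norm q)"

lemma im_norm_nonneg: "0 \<le> im_norm q"
  by (simp add: im_norm_def)

lemma im_norm_sq: "(im_norm q)\<^sup>2 = (qIm1 q)\<^sup>2 + (qIm2 q)\<^sup>2 + (qIm3 q)\<^sup>2"
  by (simp add: im_norm_def)

lemma im_norm_0_iff: "im_norm q = 0 \<longleftrightarrow> qIm1 q = 0 \<and> qIm2 q = 0 \<and> qIm3 q = 0"
proof -
  have "im_norm q = 0 \<longleftrightarrow> (qIm1 q)\<^sup>2 + (qIm2 q)\<^sup>2 + (qIm3 q)\<^sup>2 = 0"
    by (simp add: im_norm_def)
  also have "\<dots> \<longleftrightarrow> qIm1 q = 0 \<and> qIm2 q = 0 \<and> qIm3 q = 0"
    by (simp add: add_nonneg_eq_0_iff)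
  finally show ?thesis .
qed

lemma im_unit_in: "im_unit q \<in> \<S>\<^sub>\<bbbH>"
proof (cases "im_norm q = 0")
  case True
  then show ?thesis by (simp add: im_unit_def imag_units_iff)
next
  case False
  then have "(qIm1 q / im_norm q)\<^sup>2 + (qIm2 q / im_norm q)\<^sup>2 + (qIm3 q / im_norm q)\<^sup>2 = 1"
    by (simp add: power_divide add_divide_distrib[symmetric] im_norm_sq[symmetric])
  then show ?thesis using False
    by (simp add: im_unit_def imag_units_iff divide_inverse mult.commute)
qed

lemma quat_decompose: "of_real (Re (profile q)) + im_unit q * of_real (Im (profile q)) = q"
  by (auto simp: profile_def im_unit_def quat_eq_iff im_norm_0_iff field_simps)

lemma im_norm_slice: "J \<in> \<S>\<^sub>\<bbbH> \<Longrightarrow> im_norm (of_real a + J * of_real b) = \<bar>b\<bar>"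
  unfolding im_norm_def imag_units_iff
  by (simp add: power_mult_distrib distrib_right[symmetric])

lemma profile_slice: "J \<in> \<S>\<^sub>\<bbbH> \<Longrightarrow> profile (of_real a + J * of_real b) = Complex a \<bar>b\<bar>"
  by (simp add: profile_def im_norm_slice imag_units_iff)

lemma im_unit_slice:
  assumes "J \<in> \<S>\<^sub>\<bbbH>" "b \<noteq> 0"
  shows "im_unit (of_real a + J * of_real b) = (if b > 0 then J else - J)"
proof -
  have "im_unit (of_real a + J * of_real b) = (J * of_real b) /\<^sub>R \<bar>b\<bar>"
    using assms by (simp add: im_unit_def im_norm_slice imag_units_iff)
  also have "\<dots> = (if b > 0 then J else - J)"
    using assms(2) by (simp add: quat_eq_iff)
  finally show ?thesis .
qed

lemma Im_profile_nonneg: "0 \<le> Im (profile q)"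
  by (simp add: profile_def im_norm_nonneg)

section \<open>Parity and canonical coordinates of points\<close>

definition profiles :: "nat \<Rightarrow> (nat \<Rightarrow> quat) \<Rightarrow> nat \<Rightarrow> complex" where
  "profiles n x = (\<lambda>h\<in>{1..n}. profile (x h))"

lemma profiles_extensional: "profiles n x \<in> {1..n} \<rightarrow>\<^sub>E UNIV"
  by (simp add: profiles_def)

text \<open>
Together with \<open>im_unit_in\<close> this makes the profile and the units of the coordinates a canonical
representation of a point of the circularization.
\<close>

lemma slice_point_profiles:
  "x \<in> {1..n} \<rightarrow>\<^sub>E UNIV \<Longrightarrow> slice_point n (\<lambda>h. im_unit (x h)) (profiles n x) = x"
  by (rule ext) (auto simp: slice_point_def profiles_def quat_decompose PiE_def extensional_def)

lemma invariantD: "invariant n D \<Longrightarrow> D \<subseteq> {1..n} \<rightarrow>\<^sub>E UNIV"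
  by (simp add: invariant_def)

lemma invariant_conj:
  assumes "invariant n D" "z \<in> D" "h \<in> {1..n}"
  shows "z(h := cnj (z h)) \<in> D"
proof -
  have "z \<in> {1..n} \<rightarrow>\<^sub>E UNIV" using assms invariantD by blast
  then show ?thesis using assms unfolding invariant_def by blast
qed

definition conj_on :: "nat set \<Rightarrow> (nat \<Rightarrow> complex) \<Rightarrow> nat \<Rightarrow> complex" where
  "conj_on A z = (\<lambda>h. if h \<in> A then cnj (z h) else z h)"

lemma conj_on_insert:
  "h \<notin> A \<Longrightarrow> conj_on (insert h A) z = (conj_on A z)(h := cnj (conj_on A z h))"
  by (rule ext) (simp add: conj_on_def)

lemma invariant_conj_on:
  assumes "invariant n D" "z \<in> D" "A \<subseteq> {1..n}"
  shows "conj_on A z \<in> D"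
proof -
  have "finite A" using assms(3) finite_subset by blast
  then show ?thesis using assms(3)
  proof (induction A)
    case empty
    then show ?case using assms(2) by (simp add: conj_on_def)
  next
    case (insert h A)
    then show ?case
      unfolding conj_on_insert[OF insert.hyps(2)] by (intro invariant_conj[OF assms(1)]) auto
  qed
qed

lemma stem_parity:
  "F \<in> stem_functions n D \<Longrightarrow> K \<subseteq> {1..n} \<Longrightarrow> z \<in> D \<Longrightarrow> h \<in> {1..n} \<Longrightarrow>
    F (z(h := cnj (z h))) K = (-1) ^ card (K \<inter> {h}) * F z K"
  by (simp add: stem_functions_def)

lemma stem_continuous:
  "F \<in> stem_functions n D \<Longrightarrow> K \<subseteq> {1..n} \<Longrightarrow> continuous_on D (\<lambda>z. F z K)"
  by (simp add: stem_functions_def)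

lemma stem_parity_conj_on:
  assumes "invariant n D" "F \<in> stem_functions n D" "K \<subseteq> {1..n}" "z \<in> D" "A \<subseteq> {1..n}"
  shows "F (conj_on A z) K = (-1) ^ card (K \<inter> A) * F z K"
proof -
  have "finite A" using assms(5) finite_subset by blast
  then show ?thesis using assms(5)
  proof (induction A)
    case empty
    then show ?case by (simp add: conj_on_def)
  next
    case (insert h A)
    have c: "card (K \<inter> insert h A) = card (K \<inter> {h}) + card (K \<inter> A)"
    proof -
      have "K \<inter> insert h A = (K \<inter> {h}) \<union> (K \<inter> A)" by auto
      moreover have "card ((K \<inter> {h}) \<union> (K \<inter> A)) = card (K \<inter> {h}) + card (K \<inter> A)"
        using insert by (intro card_Un_disjoint) auto
      ultimately show ?thesis by simp
    qed
    have "conj_on A z \<in> D" "h \<in> {1..n}"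
      using insert.prems invariant_conj_on[OF assms(1,4), of A] by auto
    note stem_parity[OF assms(2,3) this]
    then show ?case
      unfolding conj_on_insert[OF insert.hyps(2)] c power_add mult.assoc
      using insert.IH insert.prems by (metis insert_subset)
  qed
qed

text \<open>
At such a point conjugation in the variable \<open>h\<close> does nothing, while parity makes it a sign change.
\<close>

lemma stem_zero_of_real:
  assumes "F \<in> stem_functions n D" "K \<subseteq> {1..n}" "z \<in> D" "h \<in> K" "Im (z h) = 0"
  shows "F z K = 0"
proof -
  have "cnj (z h) = z h" using assms(5) by (simp add: complex_eq_iff)
  then have "z(h := cnj (z h)) = z" by simp
  with stem_parity[OF assms(1,2,3), of h] assms(2,4) have "F z K = - F z K"
    by auto
  then show ?thesis
    by (simp add: quat_eq_iff)
qed

section \<open>Ordered products and values of slice functions\<close>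

lemma oprod_empty [simp]: "oprod q {} = 1"
  by (simp add: oprod_def)

lemma oprod_insert_less:
  assumes "finite K" "\<And>k. k \<in> K \<Longrightarrow> h < k"
  shows "oprod q (insert h K) = q h * oprod q K"
proof -
  have "h \<notin> K" using assms(2) by blast
  then have "sorted_list_of_set (insert h K) = h # sorted_list_of_set K"
    using assms by (subst sorted_list_of_set_insert) (auto intro!: insort_is_Cons less_imp_le)
  then show ?thesis by (simp add: oprod_def)
qed

lemma oprod_union_less:
  assumes "finite A" "finite B" "\<And>a b. a \<in> A \<Longrightarrow> b \<in> B \<Longrightarrow> a < b"
  shows "oprod q (A \<union> B) = oprod q A * oprod q B"
  using assms
proof (induction A rule: finite_linorder_min_induct)
  case empty
  then show ?case by simp
next
  case (insert a A)
  then show ?case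
    by (simp add: oprod_insert_less mult.assoc)
       (subst oprod_insert_less, auto simp: mult.assoc)
qed

lemma oprod_insert_greater:
  assumes "finite K" "\<And>k. k \<in> K \<Longrightarrow> k < h"
  shows "oprod q (insert h K) = oprod q K * q h"
  using oprod_union_less[of K "{h}" q] oprod_insert_less[of "{}" h q] assms by simp

lemma oprod_cong: "(\<And>k. k \<in> K \<Longrightarrow> p k = q k) \<Longrightarrow> finite K \<Longrightarrow> oprod p K = oprod q K"
  unfolding oprod_def by (intro arg_cong[where f=prod_list] map_cong) auto

lemma norm_oprod_units: "finite K \<Longrightarrow> (\<And>k. k \<in> K \<Longrightarrow> q k \<in> \<S>\<^sub>\<bbbH>) \<Longrightarrow> norm (oprod q K) = 1"
proof (induction K rule: finite_linorder_min_induct)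
  case (insert b A)
  then show ?case by (simp add: oprod_insert_less norm_mult norm_imag_unit)
qed simp

lemma oprod_signs:
  assumes "finite K" "\<And>k. k \<in> K \<Longrightarrow> p k = (if k \<in> A then - q k else q k)"
  shows "oprod p K = (-1) ^ card (K \<inter> A) * oprod q K"
  using assms
proof (induction K rule: finite_linorder_min_induct)
  case (insert b K)
  have "b \<notin> K" using insert by blast
  then have "card (insert b K \<inter> A) = (if b \<in> A then Suc (card (K \<inter> A)) else card (K \<inter> A))"
    using insert(1) by auto
  moreover have "(-1) ^ k * (q b * r) = q b * ((-1) ^ k * r)" for k and r :: quat
    by (cases "even k") auto
  ultimately show ?case using insert
    by (auto simp: oprod_insert_less mult.assoc)
qed simp

text \<open>
The value of a slice function in terms of the components \<open>a\<close> of its stem function at one point.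
\<close>

definition slice_value :: "nat \<Rightarrow> (nat \<Rightarrow> quat) \<Rightarrow> (nat set \<Rightarrow> quat) \<Rightarrow> quat" where
  "slice_value n J a = (\<Sum>K\<in>Pow {1..n}. oprod J K * a K)"

lemma circularizationE:
  assumes "x \<in> \<Omega> n D"
  obtains J z where "x = slice_point n J z" "z \<in> D" "J \<in> {1..n} \<rightarrow> \<S>\<^sub>\<bbbH>"
  using assms unfolding circularization_def by blast

lemma circularization_extensional: "x \<in> \<Omega> n D \<Longrightarrow> x \<in> {1..n} \<rightarrow>\<^sub>E UNIV"
  by (auto simp: circularization_def slice_point_def)

lemma profiles_slice_point:
  assumes "J \<in> {1..n} \<rightarrow> \<S>\<^sub>\<bbbH>" "z \<in> {1..n} \<rightarrow>\<^sub>E UNIV"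
  shows "profiles n (slice_point n J z) = conj_on {h\<in>{1..n}. Im (z h) < 0} z"
proof
  fix h
  show "profiles n (slice_point n J z) h = conj_on {h\<in>{1..n}. Im (z h) < 0} z h"
  proof (cases "h \<in> {1..n}")
    case True
    then have "J h \<in> \<S>\<^sub>\<bbbH>" using assms(1) by blast
    then show ?thesis using True
      by (simp add: profiles_def slice_point_def conj_on_def profile_slice complex_eq_iff)
  next
    case False
    then show ?thesis using assms(2) unfolding PiE_def extensional_def
      by (auto simp: profiles_def conj_on_def)
  qed
qed

text \<open>
Membership needs to be tested on one representation only, because an invariant set contains with
\<open>z\<close> all its partial conjugates.
\<close>

lemma circularization_iff:
  assumes "invariant n D"
  shows "x \<in> \<Omega> n D \<longleftrightarrow> x \<in> {1..n} \<rightarrow>\<^sub>E UNIV \<and> profiles n x \<in> D"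
proof
  assume x: "x \<in> \<Omega> n D"
  then obtain J z where "x = slice_point n J z" "z \<in> D" "J \<in> {1..n} \<rightarrow> \<S>\<^sub>\<bbbH>"
    by (rule circularizationE)
  moreover have "z \<in> {1..n} \<rightarrow>\<^sub>E UNIV"
    using invariantD[OF assms] \<open>z \<in> D\<close> by blast
  ultimately show "x \<in> {1..n} \<rightarrow>\<^sub>E UNIV \<and> profiles n x \<in> D"
    using circularization_extensional[OF x]
    by (auto simp: profiles_slice_point intro!: invariant_conj_on[OF assms])
next
  assume "x \<in> {1..n} \<rightarrow>\<^sub>E UNIV \<and> profiles n x \<in> D"
  then show "x \<in> \<Omega> n D"
    unfolding circularization_def
    by (intro CollectI exI[of _ "\<lambda>h. im_unit (x h)"] exI[of _ "profiles n x"])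
       (simp add: slice_point_profiles im_unit_in)
qed

text \<open>
The summands agree one by one. Passing to the canonical representation conjugates the variables with
\<open>\<beta>\<^sub>h < 0\<close> and reverses their units; both operations contribute the same sign to the summand of
\<open>K\<close>. If \<open>\<beta>\<^sub>h = 0\<close> for some \<open>h \<in> K\<close>, the units are unrelated but the summand is zero.
\<close>

lemma slice_value_canonical:
  assumes "invariant n D" "F \<in> stem_functions n D" "z \<in> D" "J \<in> {1..n} \<rightarrow> \<S>\<^sub>\<bbbH>"
    and x: "x = slice_point n J z"
  shows "slice_value n J (F z) = slice_value n (\<lambda>h. im_unit (x h)) (F (profiles n x))"
  unfolding slice_value_def
proof (rule sum.cong)
  fix K assume "K \<in> Pow {1..n}"
  then have K: "K \<subseteq> {1..n}" by simp
  then have fK: "finite K" using finite_subset by blast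
  have ze: "z \<in> {1..n} \<rightarrow>\<^sub>E UNIV" using assms invariantD by blast
  define A where "A = {h\<in>{1..n}. Im (z h) < 0}"
  have prof: "profiles n x = conj_on A z"
    using profiles_slice_point[OF assms(4) ze] x by (simp add: A_def)
  have FF: "F (profiles n x) K = (-1) ^ card (K \<inter> A) * F z K"
    unfolding prof by (rule stem_parity_conj_on[OF assms(1,2) K assms(3)]) (auto simp: A_def)
  show "oprod J K * F z K = oprod (\<lambda>h. im_unit (x h)) K * F (profiles n x) K"
  proof (cases "\<exists>h\<in>K. Im (z h) = 0")
    case True
    then have "F z K = 0" using stem_zero_of_real[OF assms(2) K assms(3)] by blast
    then show ?thesis using FF by simp
  next
    case False
    have "oprod (\<lambda>h. im_unit (x h)) K = (-1) ^ card (K \<inter> A) * oprod J K"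
    proof (rule oprod_signs[OF fK])
      fix k assume "k \<in> K"
      then have "Im (z k) \<noteq> 0" "k \<in> {1..n}" "J k \<in> \<S>\<^sub>\<bbbH>" using False K assms(4) by auto
      then show "im_unit (x k) = (if k \<in> A then - J k else J k)"
        by (auto simp: x slice_point_def im_unit_slice A_def)
    qed
    moreover have "(-1) ^ k * r * ((-1) ^ k * s) = r * s" for k and r s :: quat
      by (cases "even k") auto
    ultimately show ?thesis by (simp add: FF)
  qed
qed simp

text \<open>
This is the independence of representation that makes the definite description in \<open>induced\<close>
proper.
\<close>

lemma induced_slice_point:
  assumes "invariant n D" "F \<in> stem_functions n D" "z \<in> D" "J \<in> {1..n} \<rightarrow> \<S>\<^sub>\<bbbH>"
  shows "induced n D F (slice_point n J z) = slice_value n J (F z)"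
  unfolding induced_def
proof (rule the_equality)
  show "\<exists>z'\<in>D. \<exists>J'\<in>{1..n} \<rightarrow> \<S>\<^sub>\<bbbH>. slice_point n J z = slice_point n J' z' \<and>
      slice_value n J (F z) = (\<Sum>K\<in>Pow {1..n}. oprod J' K * F z' K)"
    using assms(3,4) unfolding slice_value_def by blast
next
  fix q
  assume "\<exists>z'\<in>D. \<exists>J'\<in>{1..n} \<rightarrow> \<S>\<^sub>\<bbbH>. slice_point n J z = slice_point n J' z' \<and>
      q = (\<Sum>K\<in>Pow {1..n}. oprod J' K * F z' K)"
  then obtain z' J' where "z' \<in> D" "J' \<in> {1..n} \<rightarrow> \<S>\<^sub>\<bbbH>" "slice_point n J z = slice_point n J' z'"
    "q = slice_value n J' (F z')" unfolding slice_value_def by blast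
  then show "q = slice_value n J (F z)"
    using slice_value_canonical[OF assms(1,2)] assms(3,4) by metis
qed

lemma induced_canonical:
  assumes "invariant n D" "F \<in> stem_functions n D" "x \<in> \<Omega> n D"
  shows "induced n D F x = slice_value n (\<lambda>h. im_unit (x h)) (F (profiles n x))"
proof -
  have "x \<in> {1..n} \<rightarrow>\<^sub>E UNIV" "profiles n x \<in> D"
    using assms circularization_iff by blast+
  then show ?thesis
    using induced_slice_point[OF assms(1,2), of "profiles n x" "\<lambda>h. im_unit (x h)"] im_unit_in
    by (simp add: slice_point_profiles)
qed

text \<open>
The largest index \<open>b\<close> stands rightmost in every ordered product. With \<open>L\<close> as its unit, the sum
therefore consists of the terms \<open>J\<^sub>K (a\<^sub>K + L a\<^sub>K\<^sub>\<union>\<^sub>b)\<close> for the sets \<open>K\<close> without \<open>b\<close>. By induction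
\<open>a\<^sub>K + L a\<^sub>K\<^sub>\<union>\<^sub>b = 0\<close> for every unit \<open>L\<close>, and comparing \<open>L\<close> with \<open>- L\<close> separates the two
components.
\<close>

lemma slice_value_zero_imp:
  assumes "finite N" "\<And>J. J \<in> N \<rightarrow> \<S>\<^sub>\<bbbH> \<Longrightarrow> (\<Sum>K\<in>Pow N. oprod J K * a K) = 0" "K \<subseteq> N"
  shows "a K = 0"
  using assms
proof (induction N arbitrary: a K rule: finite_linorder_max_induct)
  case empty
  have "(\<Sum>K\<in>Pow {}. oprod (\<lambda>_. quat_i) K * a K) = 0" using empty(1) by blast
  then show ?case using empty by simp
next
  case (insert b N)
  have bN: "b \<notin> N" using insert by blast
  have key: "a K + L * a (insert b K) = 0" if "K \<subseteq> N" "L \<in> \<S>\<^sub>\<bbbH>" for K L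
  proof (rule insert.IH[where a="\<lambda>K. a K + L * a (insert b K)"])
    fix J assume J: "J \<in> N \<rightarrow> \<S>\<^sub>\<bbbH>"
    have "(\<Sum>K\<in>Pow N. oprod J K * (a K + L * a (insert b K)))
      = (\<Sum>K\<in>Pow N. oprod (J(b:=L)) K * a K) + (\<Sum>K\<in>Pow N. oprod (J(b:=L)) (insert b K) * a (insert b K))"
      unfolding sum.distrib[symmetric]
    proof (rule sum.cong)
      fix K assume "K \<in> Pow N"
      then have *: "K \<subseteq> N" "finite K" using insert(1) finite_subset by auto
      have "oprod (J(b:=L)) K = oprod J K"
        by (rule oprod_cong) (use * bN in auto)
      moreover have "oprod (J(b:=L)) (insert b K) = oprod (J(b:=L)) K * L"
        using oprod_insert_greater[of K b "J(b:=L)"] * insert(2) by auto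
      ultimately show "oprod J K * (a K + L * a (insert b K)) =
         oprod (J(b := L)) K * a K + oprod (J(b := L)) (insert b K) * a (insert b K)"
        by (simp add: algebra_simps)
    qed simp
    also have "\<dots> = (\<Sum>K\<in>Pow (insert b N). oprod (J(b:=L)) K * a K)"
    proof -
      have "inj_on (insert b) (Pow N)" using bN by (auto simp: inj_on_def)
      moreover have "Pow N \<inter> insert b ` Pow N = {}" using bN by auto
      ultimately show ?thesis using insert(1)
        by (simp add: Pow_insert sum.union_disjoint sum.reindex)
    qed
    also have "\<dots> = 0"
      by (rule insert.prems(1)) (use J that in auto)
    finally show "(\<Sum>K\<in>Pow N. oprod J K * (a K + L * a (insert b K))) = 0" .
  qed (use that in auto)
  have i: "quat_i \<in> \<S>\<^sub>\<bbbH>" by (simp add: imag_units_iff)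
  \<comment> \<open>the instances of \<open>key\<close> for \<open>quat_i\<close> and \<open>- quat_i\<close> are added\<close>
  have both: "a K = 0 \<and> a (insert b K) = 0" if "K \<subseteq> N" for K
  proof -
    have p: "a K + quat_i * a (insert b K) = 0" using key[OF that i] .
    moreover have q: "a K - quat_i * a (insert b K) = 0"
      using key[OF that imag_units_uminus[OF i]] by simp
    ultimately have "a K + a K = 0"
      by (simp add: eq_neg_iff_add_eq_0[symmetric])
    then have "a K = 0"
      by (simp add: quat_eq_iff)
    moreover from this p have "quat_i * a (insert b K) = 0" by simp
    ultimately show ?thesis using imag_unit_nonzero[OF i] by simp
  qed
  show ?case
  proof (cases "b \<in> K")
    case True
    then have "insert b (K - {b}) = K" by auto
    with both[of "K - {b}"] insert.prems(2) show ?thesis by (metis Diff_subset_conv insert_is_Un)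
  next
    case False
    with both[of K] insert.prems(2) show ?thesis by blast
  qed
qed

lemma stem_unique:
  assumes "invariant n D" "F \<in> stem_functions n D" "G \<in> stem_functions n D"
    and eq: "\<And>x. x \<in> \<Omega> n D \<Longrightarrow> induced n D F x = induced n D G x"
    and "z \<in> D" "K \<subseteq> {1..n}"
  shows "F z K = G z K"
proof -
  have "F z K - G z K = 0"
  proof (rule slice_value_zero_imp[where a="\<lambda>K. F z K - G z K" and N="{1..n}"])
    fix J assume J: "J \<in> {1..n} \<rightarrow> \<S>\<^sub>\<bbbH>"
    then have "slice_point n J z \<in> \<Omega> n D"
      using assms(5) unfolding circularization_def by blast
    from eq[OF this] have "slice_value n J (F z) = slice_value n J (G z)"
      using assms J by (simp add: induced_slice_point)
    then show "(\<Sum>K\<in>Pow {1..n}. oprod J K * (F z K - G z K)) = 0"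
      by (simp add: slice_value_def right_diff_distrib sum_subtractf)
  qed (use assms in auto)
  then show ?thesis by simp
qed

lemma stem_of_spec:
  assumes "f \<in> slice_functions n D"
  shows "stem_of n D f \<in> stem_functions n D"
    "x \<in> \<Omega> n D \<Longrightarrow> f x = induced n D (stem_of n D f) x"
proof -
  have "\<exists>F. F \<in> stem_functions n D \<and> (\<forall>x\<in>\<Omega> n D. f x = induced n D F x)"
    using assms unfolding slice_functions_def by blast
  from someI_ex[OF this]
  show "stem_of n D f \<in> stem_functions n D"
    "x \<in> \<Omega> n D \<Longrightarrow> f x = induced n D (stem_of n D f) x"
    unfolding stem_of_def by blast+
qed

text \<open>
The choice in \<open>stem_of\<close> can be replaced by any known stem function.
\<close>

lemma stem_of_eq:
  assumes "invariant n D" "F \<in> stem_functions n D" "\<And>x. x \<in> \<Omega> n D \<Longrightarrow> f x = induced n D F x"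
    "z \<in> D" "K \<subseteq> {1..n}"
  shows "stem_of n D f z K = F z K"
proof -
  have f: "f \<in> slice_functions n D" using assms unfolding slice_functions_def by blast
  show ?thesis
    by (rule stem_unique[OF assms(1) stem_of_spec(1)[OF f] assms(2)])
       (use stem_of_spec(2)[OF f] assms in auto)
qed

lemma induced_cong:
  assumes "\<And>z K. z \<in> D \<Longrightarrow> K \<subseteq> {1..n} \<Longrightarrow> F z K = G z K"
  shows "induced n D F = induced n D G"
proof -
  have "(\<Sum>K\<in>Pow {1..n}. oprod J K * F z K) = (\<Sum>K\<in>Pow {1..n}. oprod J K * G z K)"
    if "z \<in> D" for J z
    using assms that by (intro sum.cong) auto
  then show ?thesis unfolding induced_def by (intro ext arg_cong[where f=The]) auto
qed

section \<open>Multiplication by coordinate monomials\<close>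

lemma sum_Pow_insert:
  assumes "finite M" "b \<notin> M"
  shows "(\<Sum>K\<in>Pow (insert b M). g K) = (\<Sum>K\<in>Pow M. g K) + (\<Sum>K\<in>Pow M. g (insert b K))"
proof -
  have "inj_on (insert b) (Pow M)" using assms by (auto simp: inj_on_def)
  moreover have "Pow M \<inter> insert b ` Pow M = {}" using assms by auto
  ultimately show ?thesis using assms
    by (simp add: Pow_insert sum.union_disjoint sum.reindex)
qed

lemma sum_Pow_Un_disjoint:
  assumes "finite A" "finite B" "A \<inter> B = {}"
  shows "(\<Sum>L\<in>Pow (A \<union> B). g L) = (\<Sum>S\<in>Pow A. \<Sum>T\<in>Pow B. g (S \<union> T))"
  using assms(1,3)
proof (induction A arbitrary: g)
  case (insert a A)
  have "(\<Sum>L\<in>Pow (insert a (A \<union> B)). g L) = (\<Sum>L\<in>Pow (A \<union> B). g L) + (\<Sum>L\<in>Pow (A \<union> B). g (insert a L))"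
    using insert assms(2) by (intro sum_Pow_insert) auto
  also have "\<dots> = (\<Sum>S\<in>Pow A. \<Sum>T\<in>Pow B. g (S \<union> T)) + (\<Sum>S\<in>Pow A. \<Sum>T\<in>Pow B. g (insert a S \<union> T))"
    using insert by simp
  also have "\<dots> = (\<Sum>S\<in>Pow (insert a A). \<Sum>T\<in>Pow B. g (S \<union> T))"
    using insert by (subst sum_Pow_insert) auto
  finally show ?case by simp
qed simp

text \<open>
For fixed \<open>A\<close> only \<open>H = sym_diff L A\<close> contributes to the coefficient of \<open>e\<^sub>L\<close>.
\<close>

lemma stem_prod_eq:
  assumes "L \<subseteq> {1..n}"
  shows "stem_prod n F G z L =
    (\<Sum>A\<in>Pow {1..n}. (-1) ^ card (A - L) * F z A * G z (sym_diff L A))"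
proof -
  have "stem_prod n F G z L = (\<Sum>A\<in>Pow {1..n}. \<Sum>H\<in>Pow {1..n}.
     if sym_diff A H = L then (-1) ^ card (H \<inter> A) * F z A * G z H else 0)"
    unfolding stem_prod_def by (rule sum.swap)
  also have "\<dots> = (\<Sum>A\<in>Pow {1..n}. (-1) ^ card (A - L) * F z A * G z (sym_diff L A))"
  proof (rule sum.cong)
    fix A assume A: "A \<in> Pow {1..n}"
    have eq: "sym_diff A H = L \<longleftrightarrow> H = sym_diff L A" for H by blast
    have "sym_diff L A \<in> Pow {1..n}" "sym_diff L A \<inter> A = A - L" using A assms by auto
    then show "(\<Sum>H\<in>Pow {1..n}. if sym_diff A H = L then (-1) ^ card (H \<inter> A) * F z A * G z H else 0)
      = (-1) ^ card (A - L) * F z A * G z (sym_diff L A)"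
      unfolding eq by simp
  qed simp
  finally show ?thesis .
qed

text \<open>
The product of the coordinate stem function \<open>\<alpha>\<^sub>k + e\<^sub>k \<beta>\<^sub>k\<close> with \<open>F\<close>; the minus sign is that
of the square of \<open>e\<^sub>k\<close>.
\<close>

definition var_mult :: "nat \<Rightarrow> stem \<Rightarrow> stem" where
  "var_mult k F z L = Re (z k) *\<^sub>R F z L +
     (if k \<in> L then Im (z k) *\<^sub>R F z (L - {k}) else - (Im (z k) *\<^sub>R F z (insert k L)))"

text \<open>
The product of all \<open>\<alpha>\<^sub>k + e\<^sub>k \<beta>\<^sub>k\<close>, \<open>k \<in> K\<close>, with \<open>F\<close>, multiplied out: \<open>A\<close> is the set of
factors from which \<open>e\<^sub>k \<beta>\<^sub>k\<close> is taken, and each \<open>k \<in> A - L\<close> contributes a square of \<open>e\<^sub>k\<close>.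
\<close>

definition monomial_mult :: "nat set \<Rightarrow> stem \<Rightarrow> stem" where
  "monomial_mult K F z L = (\<Sum>A\<in>Pow K.
     ((-1) ^ card (A - L) * (\<Prod>k\<in>K-A. Re (z k)) * (\<Prod>k\<in>A. Im (z k))) *\<^sub>R F z (sym_diff L A))"

definition unit_stem :: stem where
  "unit_stem z K = (if K = {} then 1 else 0)"

lemma monomial_mult_empty [simp]: "monomial_mult {} F = F"
  by (simp add: monomial_mult_def fun_eq_iff)

text \<open>
Since the closed formula satisfies this recursion, properties preserved by multiplication with one
coordinate pass to monomials.
\<close>

lemma monomial_mult_insert:
  assumes "finite K" "k \<notin> K"
  shows "monomial_mult (insert k K) F = var_mult k (monomial_mult K F)"
proof (intro ext)
  fix z L
  let ?s = "\<lambda>A. ((-1) ^ card (A - L) * (\<Prod>k\<in>insert k K-A. Re (z k)) * (\<Prod>k\<in>A. Im (z k)))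
      *\<^sub>R F z (sym_diff L A)"
  have "monomial_mult (insert k K) F z L = (\<Sum>A\<in>Pow K. ?s A)
    + (\<Sum>A\<in>Pow K. ?s (insert k A))"
    unfolding monomial_mult_def by (rule sum_Pow_insert[OF assms])
  moreover have "(\<Sum>A\<in>Pow K. ?s A)
    = Re (z k) *\<^sub>R monomial_mult K F z L"
    unfolding monomial_mult_def scaleR_sum_right
  proof (rule sum.cong)
    fix A assume "A \<in> Pow K"
    then have "insert k K - A = insert k (K - A)" "k \<notin> K - A" "finite (K - A)" using assms by auto
    then show "?s A
      = Re (z k) *\<^sub>R ((-1) ^ card (A - L) * (\<Prod>k\<in>K-A. Re (z k)) * (\<Prod>k\<in>A. Im (z k))) *\<^sub>R F z (sym_diff L A)"
      by (simp add: mult_ac)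
  qed simp
  moreover have "(\<Sum>A\<in>Pow K. ?s (insert k A))
    = (if k \<in> L then Im (z k) *\<^sub>R monomial_mult K F z (L - {k})
       else - (Im (z k) *\<^sub>R monomial_mult K F z (insert k L)))"
  proof -
    define L' where "L' = (if k \<in> L then L - {k} else insert k L)"
    define s where "s = (if k \<in> L then 1 else -1 :: real)"
    have "(\<Sum>A\<in>Pow K. ?s (insert k A))
      = (s * Im (z k)) *\<^sub>R monomial_mult K F z L'"
      unfolding monomial_mult_def scaleR_sum_right
    proof (rule sum.cong)
      fix A assume A: "A \<in> Pow K"
      then have kA: "k \<notin> A" "finite A" using assms finite_subset by auto
      have 1: "insert k K - insert k A = K - A" using assms A by auto
      have 2: "sym_diff L (insert k A) = sym_diff L' A" using kA by (auto simp: L'_def)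
      have 3: "A - L' = A - L" using kA by (auto simp: L'_def)
      have 4: "(-1) ^ card (insert k A - L) = s * (-1::real) ^ card (A - L)"
        using kA by (auto simp: s_def insert_Diff_if)
      show "?s (insert k A)
        = (s * Im (z k)) *\<^sub>R ((-1) ^ card (A - L') * (\<Prod>k\<in>K-A. Re (z k)) * (\<Prod>k\<in>A. Im (z k))) *\<^sub>R F z (sym_diff L' A)"
        unfolding 1 2 3 4 using kA by (simp add: mult_ac)
    qed simp
    then show ?thesis by (simp add: s_def L'_def)
  qed
  ultimately show "monomial_mult (insert k K) F z L = var_mult k (monomial_mult K F) z L"
    by (simp only: var_mult_def)
qed

lemma continuous_on_coordinate:
  fixes g :: "'b::topological_space \<Rightarrow> nat \<Rightarrow> 'a::topological_space"
  assumes "continuous_on S g"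
  shows "continuous_on S (\<lambda>x. g x k)"
  using continuous_on_compose2[OF continuous_on_product_coordinates assms, of k] by simp

lemma coordinate_continuous: "continuous_on S (\<lambda>z::nat \<Rightarrow> complex. z k)"
  by (rule continuous_on_coordinate[OF continuous_on_id])

lemma var_mult_stem:
  assumes F: "F \<in> stem_functions n D" and k: "k \<in> {1..n}"
  shows "var_mult k F \<in> stem_functions n D"
  unfolding stem_functions_def
proof (intro CollectI ballI conjI)
  fix L assume "L \<in> Pow {1..n}"
  then have L: "L \<subseteq> {1..n}" "L - {k} \<subseteq> {1..n}" "insert k L \<subseteq> {1..n}" using k by auto
  have c: "continuous_on D (\<lambda>z. Re (z k))" "continuous_on D (\<lambda>z. Im (z k))"
    by (intro continuous_intros coordinate_continuous)+
  show "continuous_on D (\<lambda>z. var_mult k F z L)"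
    unfolding var_mult_def
    by (cases "k \<in> L"; simp; intro continuous_intros c stem_continuous[OF F] L)
  fix z h assume z: "z \<in> D" and h: "h \<in> {1..n}"
  note p = stem_parity[OF F L(1) z h] stem_parity[OF F L(2) z h] stem_parity[OF F L(3) z h]
  have c': "(L - {k}) \<inter> {h} = (if h \<in> L \<and> h \<noteq> k then {h} else {})"
    "insert k L \<inter> {h} = (if h \<in> L \<or> h = k then {h} else {})"
    "L \<inter> {h} = (if h \<in> L then {h} else {})" by auto
  show "var_mult k F (z(h := cnj (z h))) L = (-1) ^ card (L \<inter> {h}) * var_mult k F z L"
    unfolding var_mult_def p c' by (auto simp: algebra_simps)
qed

lemma unit_stem_stem: "unit_stem \<in> stem_functions n D"
  by (auto simp: stem_functions_def unit_stem_def)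

lemma monomial_mult_stem:
  assumes "F \<in> stem_functions n D" "K \<subseteq> {1..n}"
  shows "monomial_mult K F \<in> stem_functions n D"
proof -
  have "finite K" using assms finite_subset by blast
  then show ?thesis using assms(2)
    by (induction K) (auto simp: monomial_mult_insert assms(1) intro!: var_mult_stem)
qed

lemma coord_stem_stem:
  assumes "j \<in> {1..n}"
  shows "coord_stem j \<in> stem_functions n D"
  unfolding stem_functions_def
proof (intro CollectI ballI conjI)
  fix K
  show "continuous_on D (\<lambda>z. coord_stem j z K)"
    unfolding coord_stem_def
    by (cases "K = {}"; cases "K = {j}"; simp; intro continuous_intros coordinate_continuous)
  fix z h assume "h \<in> {1..n}"
  show "coord_stem j (z(h := cnj (z h))) K = (-1) ^ card (K \<inter> {h}) * coord_stem j z K"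
    by (auto simp: coord_stem_def)
qed

lemma stem_prod_coord:
  assumes "L \<subseteq> {1..n}" "j \<in> {1..n}"
  shows "stem_prod n (coord_stem j) G z L = var_mult j G z L"
proof -
  have "stem_prod n (coord_stem j) G z L
    = (\<Sum>A\<in>{{}, {j}}. (-1) ^ card (A - L) * coord_stem j z A * G z (sym_diff L A))"
    unfolding stem_prod_eq[OF assms(1)]
    by (rule sum.mono_neutral_right) (use assms in \<open>auto simp: coord_stem_def\<close>)
  also have "\<dots> = var_mult j G z L"
  proof (cases "j \<in> L")
    case True
    then have "sym_diff L {j} = L - {j}" by auto
    with True show ?thesis by (simp add: coord_stem_def var_mult_def of_real_def)
  next
    case False
    then have "sym_diff L {j} = insert j L" "{j} - L = {j}" by auto
    with False show ?thesis by (simp add: coord_stem_def var_mult_def of_real_def)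
  qed
  finally show ?thesis .
qed

text \<open>
The ordered product of coordinates is built up from the unit and only then multiplied with \<open>f\<close>.
This is associativity for the case at hand: the component at \<open>A\<close> of the monomial itself is
\<open>\<Prod>k\<in>K-A. \<alpha>\<^sub>k\<close> times \<open>\<Prod>k\<in>A. \<beta>\<^sub>k\<close>, so the product with \<open>G\<close> is the same as multiplying \<open>G\<close>
by the coordinates one by one.
\<close>

lemma stem_prod_monomial:
  assumes "L \<subseteq> {1..n}" "K \<subseteq> {1..n}"
  shows "stem_prod n (monomial_mult K unit_stem) G z L = monomial_mult K G z L"
proof -
  have fK: "finite K" using assms finite_subset by blast
  have m: "monomial_mult K unit_stem z A =
    (if A \<subseteq> K then of_real ((\<Prod>k\<in>K-A. Re (z k)) * (\<Prod>k\<in>A. Im (z k))) else 0)" for A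
  proof -
    have eq: "sym_diff A B = {} \<longleftrightarrow> B = A" for B by blast
    have "monomial_mult K unit_stem z A = (\<Sum>B\<in>Pow K. if B = A then
       ((-1) ^ card (B - A) * (\<Prod>k\<in>K-B. Re (z k)) * (\<Prod>k\<in>B. Im (z k))) *\<^sub>R 1 else 0)"
      unfolding monomial_mult_def unit_stem_def eq by (rule sum.cong) auto
    then show ?thesis using fK by (simp add: of_real_def)
  qed
  have "stem_prod n (monomial_mult K unit_stem) G z L = (\<Sum>A\<in>Pow K.
     (-1) ^ card (A - L) * monomial_mult K unit_stem z A * G z (sym_diff L A))"
    unfolding stem_prod_eq[OF assms(1)]
    by (rule sum.mono_neutral_right) (use assms(2) in \<open>auto simp: m\<close>)
  also have "\<dots> = monomial_mult K G z L"
    unfolding monomial_mult_def[of K G]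
  proof (rule sum.cong)
    fix A assume A: "A \<in> Pow K"
    have s: "(-1::quat) ^ k = of_real ((-1) ^ k)" for k by simp
    show "(-1) ^ card (A - L) * monomial_mult K unit_stem z A * G z (sym_diff L A) =
      ((-1) ^ card (A - L) * (\<Prod>k\<in>K-A. Re (z k)) * (\<Prod>k\<in>A. Im (z k))) *\<^sub>R G z (sym_diff L A)"
      unfolding m s using A by (simp add: of_real_def flip: mult.assoc)
  qed simp
  finally show ?thesis .
qed

lemma slice_value_unit: "slice_value n J (unit_stem z) = 1"
proof -
  have "slice_value n J (unit_stem z) = (\<Sum>K\<in>Pow {1..n}. if K = {} then oprod J K else 0)"
    unfolding slice_value_def unit_stem_def by (rule sum.cong) auto
  then show ?thesis by simp
qed

lemma stem_prod_cong:
  assumes "\<And>K. K \<subseteq> {1..n} \<Longrightarrow> F z K = F' z K" "\<And>K. K \<subseteq> {1..n} \<Longrightarrow> G z K = G' z K"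
  shows "stem_prod n F G z L = stem_prod n F' G' z L"
  unfolding stem_prod_def by (intro sum.cong refl if_cong) (use assms in auto)

lemma coord_prod_induced:
  assumes inv: "invariant n D" and "finite K" "K \<subseteq> {1..n}" "x \<in> \<Omega> n D"
  shows "coord_prod n D K x = induced n D (monomial_mult K unit_stem) x"
  using assms(2,3,4)
proof (induction K arbitrary: x rule: finite_linorder_min_induct)
  case empty
  then show ?case
    by (simp add: coord_prod_def induced_canonical[OF inv unit_stem_stem] slice_value_unit)
next
  case (insert b K)
  have "b \<notin> K" using insert.hyps by blast
  then have "sorted_list_of_set (insert b K) = b # sorted_list_of_set K"
    using insert.hyps by (subst sorted_list_of_set_insert) (auto intro!: insort_is_Cons less_imp_le)
  then have "coord_prod n D (insert b K) = slice_prod n D (coord n D b) (coord_prod n D K)"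
    by (simp add: coord_prod_def)
  also have "\<dots> = induced n D (stem_prod n (coord_stem b) (monomial_mult K unit_stem))"
    unfolding slice_prod_def
  proof (rule induced_cong, rule stem_prod_cong)
    fix z L assume zL: "z \<in> D" "L \<subseteq> {1..n}"
    fix A assume A: "A \<subseteq> {1..n}"
    show "stem_of n D (coord n D b) z A = coord_stem b z A"
      by (rule stem_of_eq[OF inv coord_stem_stem]) (use insert.prems zL A in \<open>auto simp: coord_def\<close>)
    show "stem_of n D (coord_prod n D K) z A = monomial_mult K unit_stem z A"
      by (rule stem_of_eq[OF inv monomial_mult_stem[OF unit_stem_stem]])
         (use insert zL A in auto)
  qed
  also have "\<dots> = induced n D (monomial_mult (insert b K) unit_stem)"
    by (rule induced_cong)
       (use insert.prems in \<open>simp add: stem_prod_coord monomial_mult_insert[OF insert.hyps(1) \<open>b \<notin> K\<close>]\<close>)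
  finally show ?case by simp
qed

section \<open>Stem functions of spherical components\<close>

lemma nonreal_part_invariant: "invariant n D \<Longrightarrow> invariant n (nonreal_part D M)"
  by (auto simp: invariant_def nonreal_part_def)

lemma nonreal_part_subset: "nonreal_part D M \<subseteq> D"
  by (auto simp: nonreal_part_def)

lemma circularization_mono: "D \<subseteq> E \<Longrightarrow> \<Omega> n D \<subseteq> \<Omega> n E"
  by (auto simp: circularization_def)

lemma slice_prod_monomial:
  assumes inv: "invariant n D" and F: "F \<in> stem_functions n D"
    and f: "\<And>x. x \<in> \<Omega> n D \<Longrightarrow> f x = induced n D F x" and K: "K \<subseteq> {1..n}"
  shows "slice_prod n D (coord_prod n D K) f = induced n D (monomial_mult K F)"
  unfolding slice_prod_def
proof (rule induced_cong)
  have fK: "finite K" using K finite_subset by blast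
  fix z L assume zL: "z \<in> D" "L \<subseteq> {1..n}"
  have "stem_prod n (stem_of n D (coord_prod n D K)) (stem_of n D f) z L
    = stem_prod n (monomial_mult K unit_stem) F z L"
  proof (rule stem_prod_cong)
    fix A assume A: "A \<subseteq> {1..n}"
    show "stem_of n D (coord_prod n D K) z A = monomial_mult K unit_stem z A"
      by (rule stem_of_eq[OF inv monomial_mult_stem[OF unit_stem_stem K]])
         (use zL A coord_prod_induced[OF inv fK K] in auto)
    show "stem_of n D f z A = F z A"
      by (rule stem_of_eq[OF inv F f]) (use zL A in auto)
  qed
  then show "stem_prod n (stem_of n D (coord_prod n D K)) (stem_of n D f) z L = monomial_mult K F z L"
    using stem_prod_monomial[OF zL(2) K] by simp
qed

text \<open>
Replaces the nested choices of stem functions in the definition by an explicit stem function, for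
any stem function \<open>F\<close> of \<open>f\<close>.
\<close>

lemma spherical_component_induced:
  assumes inv: "invariant n D" and F: "F \<in> stem_functions n D"
    and f: "\<And>x. x \<in> \<Omega> n D \<Longrightarrow> f x = induced n D F x" and K: "K \<subseteq> {1..n}" and m: "m \<le> n"
  shows "spherical_component n D m K f
    = induced n (nonreal_part D {1..m}) (spherical_stem {1..m} (monomial_mult K F))"
  unfolding spherical_component_def spherical_derivative_def
proof (rule induced_cong)
  fix z L assume z: "z \<in> nonreal_part D {1..m}" and L: "L \<subseteq> {1..n}"
  have "L \<union> {1..m} \<subseteq> {1..n}" using L m by auto
  then have "stem_of n D (slice_prod n D (coord_prod n D K) f) z (L \<union> {1..m})
    = monomial_mult K F z (L \<union> {1..m})"
    using z nonreal_part_subset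
    by (intro stem_of_eq[OF inv monomial_mult_stem[OF F K]])
       (auto simp: slice_prod_monomial[OF inv F f K])
  then show "spherical_stem {1..m} (stem_of n D (slice_prod n D (coord_prod n D K) f)) z L
    = spherical_stem {1..m} (monomial_mult K F) z L"
    by (simp add: spherical_stem_def)
qed

text \<open>
For \<open>h \<in> M\<close> both the denominator and \<open>F\<^sub>K\<^sub>\<union>\<^sub>M\<close> change sign under conjugation in \<open>h\<close>, so the
quotient is even in that variable, as the parity for an index outside \<open>K\<close> requires.
\<close>

lemma spherical_stem_stem:
  assumes F: "F \<in> stem_functions n D" and M: "M \<subseteq> {1..n}"
  shows "spherical_stem M F \<in> stem_functions n (nonreal_part D M)"
  unfolding stem_functions_def
proof (intro CollectI ballI conjI)
  have fM: "finite M" using M finite_subset by blast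
  fix K assume "K \<in> Pow {1..n}"
  then have K: "K \<union> M \<subseteq> {1..n}" using M by auto
  have "continuous_on (nonreal_part D M) (\<lambda>z. F z (K \<union> M))"
    using stem_continuous[OF F K] nonreal_part_subset continuous_on_subset by blast
  then show "continuous_on (nonreal_part D M) (\<lambda>z. spherical_stem M F z K)"
    unfolding spherical_stem_def using fM
    by (cases "K \<inter> M = {}"; simp; intro continuous_intros coordinate_continuous)
       (auto simp: nonreal_part_def)
  fix z h assume z: "z \<in> nonreal_part D M" and h: "h \<in> {1..n}"
  then have zD: "z \<in> D" by (simp add: nonreal_part_def)
  show "spherical_stem M F (z(h := cnj (z h))) K = (-1) ^ card (K \<inter> {h}) * spherical_stem M F z K"
  proof (cases "K \<inter> M = {}")
    case True
    have p: "F (z(h := cnj (z h))) (K \<union> M) = (-1) ^ card ((K \<union> M) \<inter> {h}) * F z (K \<union> M)"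
      using stem_parity[OF F K zD h] .
    show ?thesis
    proof (cases "h \<in> M")
      case hM: True
      have "(\<Prod>k\<in>M. Im ((z(h := cnj (z h))) k)) = Im (cnj (z h)) * (\<Prod>k\<in>M-{h}. Im ((z(h := cnj (z h))) k))"
        using fM hM by (subst prod.remove) auto
      also have "(\<Prod>k\<in>M-{h}. Im ((z(h := cnj (z h))) k)) = (\<Prod>k\<in>M-{h}. Im (z k))"
        by (rule prod.cong) auto
      also have "Im (cnj (z h)) * (\<Prod>k\<in>M-{h}. Im (z k)) = - (\<Prod>k\<in>M. Im (z k))"
        using fM hM by (subst prod.remove[of M h]) auto
      finally have q: "(\<Prod>k\<in>M. Im ((z(h := cnj (z h))) k)) = - (\<Prod>k\<in>M. Im (z k))" .
      have "(K \<union> M) \<inter> {h} = {h}" "K \<inter> {h} = {}" using hM True by auto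
      then show ?thesis using True p q by (simp add: spherical_stem_def)
    next
      case False
      have "(\<Prod>k\<in>M. Im ((z(h := cnj (z h))) k)) = (\<Prod>k\<in>M. Im (z k))"
        by (rule prod.cong) (use False in auto)
      moreover have "(K \<union> M) \<inter> {h} = K \<inter> {h}" using False by auto
      ultimately show ?thesis using True p by (simp add: spherical_stem_def)
    qed
  qed (simp add: spherical_stem_def)
qed

section \<open>The representation formula\<close>

text \<open>
Induction on the smallest index \<open>b\<close>, whose factor stands leftmost in both ordered products. Splitting
off \<open>b\<close> from \<open>K\<close> leaves the two sums of the induction hypothesis, for the coefficients \<open>a\<close> and
\<open>\<lambda>B. a (insert b B)\<close>, with the factors \<open>\<beta>\<^sub>b\<close> and \<open>\<alpha>\<^sub>b - xb\<^sub>b = J\<^sub>b \<beta>\<^sub>b\<close>.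
\<close>

lemma spherical_inversion:
  fixes a :: "nat set \<Rightarrow> quat"
  assumes "finite M" "\<And>k. k \<in> M \<Longrightarrow> xb k = of_real (\<alpha> k) - J k * of_real (\<beta> k)"
  shows "(\<Sum>K\<in>Pow M. (-1) ^ card (M - K) *\<^sub>R (oprod xb (M - K) *
      (\<Sum>A\<in>Pow K. ((\<Prod>k\<in>K-A. \<alpha> k) * (\<Prod>k\<in>A. \<beta> k)) *\<^sub>R a (M - A))))
    = (\<Prod>k\<in>M. \<beta> k) *\<^sub>R (\<Sum>B\<in>Pow M. oprod J B * a B)"
  using assms
proof (induction M arbitrary: a rule: finite_linorder_min_induct)
  case empty
  then show ?case by simp
next
  case (insert b M)
  let ?c = "\<lambda>K A. (\<Prod>k\<in>K-A. \<alpha> k) * (\<Prod>k\<in>A. \<beta> k)"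
  have b: "b \<notin> M" using insert.hyps by blast
  have fM: "finite M" by fact
  define S where "S c = (\<Sum>K\<in>Pow M. (-1) ^ card (M - K) *\<^sub>R (oprod xb (M - K) *
      (\<Sum>A\<in>Pow K. ?c K A *\<^sub>R c (M - A))))" for c :: "nat set \<Rightarrow> quat"
  define P where "P c = (\<Sum>B\<in>Pow M. oprod J B * c B)" for c :: "nat set \<Rightarrow> quat"
  have IH: "S c = (\<Prod>k\<in>M. \<beta> k) *\<^sub>R P c" for c
    unfolding S_def P_def using insert.IH insert.prems by blast
  let ?a1 = "\<lambda>B. a (insert b B)"
  have t1: "(-1) ^ card (insert b M - K) *\<^sub>R (oprod xb (insert b M - K) *
      (\<Sum>A\<in>Pow K. ?c K A *\<^sub>R a (insert b M - A)))
    = - (xb b * ((-1) ^ card (M - K) *\<^sub>R (oprod xb (M - K) *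
      (\<Sum>A\<in>Pow K. ?c K A *\<^sub>R ?a1 (M - A)))))"
    if "K \<in> Pow M" for K
  proof -
    have "insert b M - K = insert b (M - K)" using that b by auto
    moreover have "insert b M - A = insert b (M - A)" if "A \<in> Pow K" for A
      using that \<open>K \<in> Pow M\<close> b by auto
    moreover have "card (insert b (M - K)) = Suc (card (M - K))" using b fM by simp
    moreover have "oprod xb (insert b (M - K)) = xb b * oprod xb (M - K)"
      using insert.hyps by (intro oprod_insert_less) auto
    ultimately show ?thesis by (simp add: mult.assoc)
  qed
  have t2: "(-1) ^ card (insert b M - insert b K) *\<^sub>R (oprod xb (insert b M - insert b K) *
      (\<Sum>A\<in>Pow (insert b K). ?c (insert b K) A *\<^sub>R a (insert b M - A)))
    = \<alpha> b *\<^sub>R ((-1) ^ card (M - K) *\<^sub>R (oprod xb (M - K) *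
      (\<Sum>A\<in>Pow K. ?c K A *\<^sub>R ?a1 (M - A))))
    + \<beta> b *\<^sub>R ((-1) ^ card (M - K) *\<^sub>R (oprod xb (M - K) *
      (\<Sum>A\<in>Pow K. ?c K A *\<^sub>R a (M - A))))"
    if "K \<in> Pow M" for K
  proof -
    have K: "K \<subseteq> M" "finite K" "b \<notin> K" using that fM b finite_subset by auto
    have 1: "insert b M - insert b K = M - K" using b by auto
    have "(\<Sum>A\<in>Pow (insert b K). ?c (insert b K) A *\<^sub>R a (insert b M - A))
      = (\<Sum>A\<in>Pow K. ?c (insert b K) A *\<^sub>R a (insert b M - A))
      + (\<Sum>A\<in>Pow K. ?c (insert b K) (insert b A) *\<^sub>R a (insert b M - insert b A))"
      by (rule sum_Pow_insert[OF K(2,3)])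
    also have "(\<Sum>A\<in>Pow K. ?c (insert b K) A *\<^sub>R a (insert b M - A))
      = \<alpha> b *\<^sub>R (\<Sum>A\<in>Pow K. ?c K A *\<^sub>R ?a1 (M - A))"
      unfolding scaleR_sum_right
    proof (rule sum.cong)
      fix A assume "A \<in> Pow K"
      then have "insert b K - A = insert b (K - A)" "insert b M - A = insert b (M - A)"
        "b \<notin> K - A" "finite (K - A)" using K by auto
      then show "?c (insert b K) A *\<^sub>R a (insert b M - A)
        = \<alpha> b *\<^sub>R ?c K A *\<^sub>R ?a1 (M - A)" by simp
    qed simp
    also have "(\<Sum>A\<in>Pow K. ?c (insert b K) (insert b A) *\<^sub>R a (insert b M - insert b A))
      = \<beta> b *\<^sub>R (\<Sum>A\<in>Pow K. ?c K A *\<^sub>R a (M - A))"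
      unfolding scaleR_sum_right
    proof (rule sum.cong)
      fix A assume "A \<in> Pow K"
      then have "insert b K - insert b A = K - A" "insert b M - insert b A = M - A"
        "b \<notin> A" "finite A" using K b finite_subset by auto
      then show "?c (insert b K) (insert b A) *\<^sub>R a (insert b M - insert b A)
        = \<beta> b *\<^sub>R ?c K A *\<^sub>R a (M - A)" by (simp add: mult_ac)
    qed simp
    finally show ?thesis unfolding 1 by (simp add: algebra_simps)
  qed
  have "(\<Sum>K\<in>Pow (insert b M). (-1) ^ card (insert b M - K) *\<^sub>R (oprod xb (insert b M - K) *
      (\<Sum>A\<in>Pow K. ?c K A *\<^sub>R a (insert b M - A))))
    = - (xb b * S ?a1) + (\<alpha> b *\<^sub>R S ?a1 + \<beta> b *\<^sub>R S a)"
    unfolding sum_Pow_insert[OF fM b] S_def sum_distrib_left[of "xb b"]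
      scaleR_sum_right[of "\<alpha> b" _ "Pow M"] scaleR_sum_right[of "\<beta> b" _ "Pow M"]
      sum_negf[symmetric] sum.distrib[symmetric]
    by (intro arg_cong2[where f="(+)"] sum.cong refl t1 t2)
  also have "\<dots> = ((\<Prod>k\<in>M. \<beta> k) * \<beta> b) *\<^sub>R (J b * P ?a1 + P a)"
  proof -
    have xb: "xb b = \<alpha> b *\<^sub>R 1 - \<beta> b *\<^sub>R J b"
      using insert.prems[of b] by (simp add: of_real_def)
    show ?thesis unfolding xb IH by (simp add: algebra_simps)
  qed
  also have "J b * P ?a1 + P a = (\<Sum>B\<in>Pow (insert b M). oprod J B * a B)"
  proof -
    have "oprod J (insert b B) = J b * oprod J B" if "B \<in> Pow M" for B
      using that insert.hyps finite_subset by (intro oprod_insert_less) auto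
    then show ?thesis
      unfolding sum_Pow_insert[OF fM b] P_def by (simp add: sum_distrib_left mult.assoc)
  qed
  finally show ?case using b fM by (simp add: mult.commute)
qed

lemma monomial_mult_superset:
  assumes "finite K" "K \<subseteq> L"
  shows "monomial_mult K F z L
    = (\<Sum>A\<in>Pow K. ((\<Prod>k\<in>K-A. Re (z k)) * (\<Prod>k\<in>A. Im (z k))) *\<^sub>R F z (L - A))"
  unfolding monomial_mult_def
proof (rule sum.cong)
  fix A assume "A \<in> Pow K"
  then have "A - L = {}" and 1: "sym_diff L A = L - A" using assms(2) by auto
  then have "card (A - L) = 0" by (metis card.empty)
  with 1 show "((-1) ^ card (A - L) * (\<Prod>k\<in>K-A. Re (z k)) * (\<Prod>k\<in>A. Im (z k))) *\<^sub>R F z (sym_diff L A)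
    = ((\<Prod>k\<in>K-A. Re (z k)) * (\<Prod>k\<in>A. Im (z k))) *\<^sub>R F z (L - A)" by simp
qed simp

lemma slice_value_spherical:
  assumes "m \<le> n"
  shows "slice_value n J (spherical_stem {1..m} G z) = (\<Sum>T\<in>Pow {m+1..n}. oprod J T *
     (inverse (\<Prod>h\<in>{1..m}. Im (z h)) *\<^sub>R G z (T \<union> {1..m})))"
proof -
  have "slice_value n J (spherical_stem {1..m} G z) =
    (\<Sum>T\<in>Pow {m+1..n}. oprod J T * spherical_stem {1..m} G z T)"
    unfolding slice_value_def
  proof (rule sum.mono_neutral_right)
    show "\<forall>i\<in>Pow {1..n} - Pow {m + 1..n}. oprod J i * spherical_stem {1..m} G z i = 0"
    proof
      fix T assume "T \<in> Pow {1..n} - Pow {m + 1..n}"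
      then obtain t where "t \<in> T" "t \<in> {1..n}" "t \<notin> {m+1..n}" by blast
      then have "T \<inter> {1..m} \<noteq> {}" by auto
      then show "oprod J T * spherical_stem {1..m} G z T = 0" by (simp add: spherical_stem_def)
    qed
  qed (use assms in auto)
  also have "\<dots> = (\<Sum>T\<in>Pow {m+1..n}. oprod J T *
     (inverse (\<Prod>h\<in>{1..m}. Im (z h)) *\<^sub>R G z (T \<union> {1..m})))"
  proof (rule sum.cong)
    fix T assume "T \<in> Pow {m+1..n}"
    then have "T \<inter> {1..m} = {}" by auto
    then show "oprod J T * spherical_stem {1..m} G z T = oprod J T *
     (inverse (\<Prod>h\<in>{1..m}. Im (z h)) *\<^sub>R G z (T \<union> {1..m}))"
      by (simp add: spherical_stem_def)
  qed simp
  finally show ?thesis .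
qed

lemma qcnj_decompose:
  "qcnj q = of_real (Re (profile q)) - im_unit q * of_real (Im (profile q))"
  by (auto simp: profile_def im_unit_def quat_eq_iff im_norm_0_iff field_simps)

text \<open>
For a fixed set \<open>T\<close> of indices above \<open>m\<close>, the claim is \<open>spherical_inversion\<close> with
coefficients \<open>J\<^sub>T F\<^sub>B\<^sub>\<union>\<^sub>T\<close>. The factor \<open>J\<^sub>T\<close> can be kept together with the component because
all indices in \<open>T\<close> come after those in \<open>{1..m}\<close>.
\<close>

lemma representation_formula:
  assumes inv: "invariant n D" and F: "F \<in> stem_functions n D"
    and f: "\<And>x. x \<in> \<Omega> n D \<Longrightarrow> f x = induced n D F x" and m: "m \<le> n"
    and x: "x \<in> \<Omega> n (nonreal_part D {1..m})"
  shows "f x = (\<Sum>K\<in>Pow {1..m}. (-1) ^ card ({1..m} - K)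
                     * oprod (\<lambda>k. qcnj (x k)) ({1..m} - K) * spherical_component n D m K f x)"
proof -
  let ?c = "\<lambda>z K A. (\<Prod>k\<in>K-A. Re (z k)) * (\<Prod>k\<in>A. Im (z k))"
  let ?M = "{1..m}" and ?N = "{m+1..n}" and ?J = "\<lambda>h. im_unit (x h)"
  define z where "z = profiles n x"
  define \<beta> where "\<beta> = (\<Prod>h\<in>?M. Im (z h))"
  have zM: "z \<in> nonreal_part D ?M" using x circularization_iff[OF nonreal_part_invariant[OF inv]] z_def by blast
  have \<beta>0: "\<beta> \<noteq> 0" using zM by (auto simp: \<beta>_def nonreal_part_def)
  have xD: "x \<in> \<Omega> n D" using x circularization_mono[OF nonreal_part_subset] by blast
  let ?xb = "\<lambda>k. qcnj (x k)"
  have xb: "?xb k = of_real (Re (z k)) - ?J k * of_real (Im (z k))" if "k \<in> ?M" for k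
    using that m by (simp add: z_def profiles_def qcnj_decompose)
  have S: "spherical_component n D m K f x = (\<Sum>T\<in>Pow ?N. oprod ?J T * (inverse \<beta> *\<^sub>R
      (\<Sum>A\<in>Pow K. ?c z K A *\<^sub>R F z (T \<union> (?M - A)))))"
    if K: "K \<in> Pow ?M" for K
  proof -
    have K': "K \<subseteq> {1..n}" "finite K" using K m finite_subset by auto
    have sc: "spherical_component n D m K f
        = induced n (nonreal_part D ?M) (spherical_stem ?M (monomial_mult K F))"
      by (rule spherical_component_induced[OF inv F f K'(1) m])
    have "spherical_component n D m K f x = slice_value n ?J (spherical_stem ?M (monomial_mult K F) z)"
      unfolding z_def sc
      by (rule induced_canonical[OF nonreal_part_invariant[OF inv] spherical_stem_stem x])
         (use monomial_mult_stem[OF F K'(1)] m in auto)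
    also have "\<dots> = (\<Sum>T\<in>Pow ?N. oprod ?J T * (inverse \<beta> *\<^sub>R
      (\<Sum>A\<in>Pow K. ?c z K A *\<^sub>R F z (T \<union> (?M - A)))))"
      unfolding slice_value_spherical[OF m] \<beta>_def[symmetric]
    proof (rule sum.cong)
      fix T assume T: "T \<in> Pow ?N"
      have "monomial_mult K F z (T \<union> ?M) = (\<Sum>A\<in>Pow K. ?c z K A *\<^sub>R F z (T \<union> ?M - A))"
        using K K' by (intro monomial_mult_superset) auto
      also have "\<dots> = (\<Sum>A\<in>Pow K. ?c z K A *\<^sub>R F z (T \<union> (?M - A)))"
      proof (rule sum.cong)
        fix A assume "A \<in> Pow K"
        then have "T \<inter> A = {}" using K T by fastforce
        then have "T \<union> ?M - A = T \<union> (?M - A)" by auto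
        then show "?c z K A *\<^sub>R F z (T \<union> ?M - A)
          = ?c z K A *\<^sub>R F z (T \<union> (?M - A))" by simp
      qed simp
      finally show "oprod ?J T * (inverse \<beta> *\<^sub>R monomial_mult K F z (T \<union> ?M)) = oprod ?J T * (inverse \<beta> *\<^sub>R
      (\<Sum>A\<in>Pow K. ?c z K A *\<^sub>R F z (T \<union> (?M - A))))" by simp
    qed simp
    finally show ?thesis .
  qed
  have sg: "(-1) ^ k * p * q = (-1) ^ k *\<^sub>R (p * q)" for k and p q :: quat
    by (cases "even k") auto
  have "(\<Sum>K\<in>Pow ?M. (-1) ^ card (?M - K) * oprod ?xb (?M - K) * spherical_component n D m K f x)
    = (\<Sum>K\<in>Pow ?M. \<Sum>T\<in>Pow ?N. inverse \<beta> *\<^sub>R ((-1) ^ card (?M - K) *\<^sub>R (oprod ?xb (?M - K) *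
        (\<Sum>A\<in>Pow K. ?c z K A *\<^sub>R (oprod ?J T * F z (T \<union> (?M - A)))))))"
  proof (rule sum.cong)
    fix K assume "K \<in> Pow ?M"
    show "(-1) ^ card (?M - K) * oprod ?xb (?M - K) * spherical_component n D m K f x
      = (\<Sum>T\<in>Pow ?N. inverse \<beta> *\<^sub>R ((-1) ^ card (?M - K) *\<^sub>R (oprod ?xb (?M - K) *
        (\<Sum>A\<in>Pow K. ?c z K A *\<^sub>R (oprod ?J T * F z (T \<union> (?M - A)))))))"
      unfolding S[OF \<open>K \<in> Pow ?M\<close>] sg sum_distrib_left scaleR_sum_right
      by (intro sum.cong refl) (simp add: mult_ac)
  qed simp
  also have "\<dots> = (\<Sum>T\<in>Pow ?N. inverse \<beta> *\<^sub>R (\<Sum>K\<in>Pow ?M. (-1) ^ card (?M - K) *\<^sub>R (oprod ?xb (?M - K) *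
        (\<Sum>A\<in>Pow K. ?c z K A *\<^sub>R (oprod ?J T * F z (T \<union> (?M - A)))))))"
    by (subst sum.swap) (simp only: scaleR_sum_right)
  also have "\<dots> = (\<Sum>T\<in>Pow ?N. inverse \<beta> *\<^sub>R (\<beta> *\<^sub>R (\<Sum>B\<in>Pow ?M. oprod ?J B * (oprod ?J T * F z (T \<union> B)))))"
    unfolding \<beta>_def
    by (intro sum.cong refl arg_cong2[where f=scaleR] spherical_inversion[where a="\<lambda>B. oprod ?J T * F z (T \<union> B)" for T])
       (use xb in auto)
  also have "\<dots> = (\<Sum>B\<in>Pow ?M. \<Sum>T\<in>Pow ?N. oprod ?J B * (oprod ?J T * F z (T \<union> B)))"
    using \<beta>0 by (subst sum.swap) simp
  also have "\<dots> = (\<Sum>B\<in>Pow ?M. \<Sum>T\<in>Pow ?N. oprod ?J (B \<union> T) * F z (B \<union> T))"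
  proof (intro sum.cong refl)
    fix B T assume "B \<in> Pow ?M" "T \<in> Pow ?N"
    then have BT: "B \<subseteq> ?M" "T \<subseteq> ?N" by auto
    then have fin: "finite B" "finite T" using finite_subset by blast+
    have "a < b" if "a \<in> B" "b \<in> T" for a b
    proof -
      have "a \<in> ?M" "b \<in> ?N" using that BT by auto
      then show ?thesis by simp
    qed
    with fin have "oprod ?J (B \<union> T) = oprod ?J B * oprod ?J T"
      by (rule oprod_union_less)
    then show "oprod ?J B * (oprod ?J T * F z (T \<union> B)) = oprod ?J (B \<union> T) * F z (B \<union> T)"
      by (simp add: mult.assoc Un_commute)
  qed
  also have "\<dots> = slice_value n ?J (F z)"
  proof -
    have "{1..n} = ?M \<union> ?N" using m by auto
    then show ?thesis unfolding slice_value_def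
      by (simp only:) (rule sum_Pow_Un_disjoint[symmetric], auto)
  qed
  also have "\<dots> = f x" using f[OF xD] induced_canonical[OF inv F xD] by (simp add: z_def)
  finally show ?thesis by simp
qed


section \<open>Circularity and sliceness of spherical components\<close>

lemma continuous_on_fun_upd:
  fixes g :: "'b::topological_space \<Rightarrow> nat \<Rightarrow> 'a::topological_space"
  assumes "continuous_on S g" "continuous_on S c"
  shows "continuous_on S (\<lambda>x. (g x)(h := c x))"
proof (rule continuous_on_coordinatewise_then_product)
  fix i
  show "continuous_on S (\<lambda>x. ((g x)(h := c x)) i)"
    using assms by (cases "i = h") (auto intro: continuous_on_coordinate)
qed

lemma profiles_upd: "h \<in> {1..n} \<Longrightarrow> profiles n (y(h := v)) = (profiles n y)(h := profile v)"
  by (auto simp: profiles_def fun_eq_iff)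

lemma induced_in_slice_functions:
  "F \<in> stem_functions n D \<Longrightarrow> induced n D F \<in> slice_functions n D"
  unfolding slice_functions_def by blast

text \<open>
On a sphere the profile is constant and only the unit of the variable \<open>h\<close> varies. It occurs
only in summands whose component is zero.
\<close>

lemma induced_circular_wrt:
  assumes inv: "invariant n D" and G: "G \<in> stem_functions n D" and h: "h \<in> {1..n}"
    and zero: "\<And>z T. z \<in> D \<Longrightarrow> T \<subseteq> {1..n} \<Longrightarrow> h \<in> T \<Longrightarrow> G z T = 0"
  shows "induced n D G \<in> circular_wrt n D h"
  unfolding circular_wrt_def Let_def
proof (intro CollectI conjI ballI allI impI induced_in_slice_functions[OF G])
  fix y \<alpha> \<beta>
  assume y: "y \<in> \<Omega> n D"
    and S: "\<forall>v\<in>{of_real \<alpha> + J * of_real \<beta> | J. J \<in> \<S>\<^sub>\<bbbH>}. y(h := v) \<in> \<Omega> n D"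
  let ?S = "{of_real \<alpha> + J * of_real \<beta> | J. J \<in> \<S>\<^sub>\<bbbH>}"
  define z where "z = (profiles n y)(h := Complex \<alpha> \<bar>\<beta>\<bar>)"
  have "induced n D G (y(h := v)) = slice_value n (\<lambda>k. im_unit (y k)) (G z)" if v: "v \<in> ?S" for v
  proof -
    obtain J where "J \<in> \<S>\<^sub>\<bbbH>" "v = of_real \<alpha> + J * of_real \<beta>" using v by blast
    then have "profile v = Complex \<alpha> \<bar>\<beta>\<bar>" by (simp add: profile_slice)
    then have p: "profiles n (y(h := v)) = z" by (simp add: profiles_upd[OF h] z_def)
    have yv: "y(h := v) \<in> \<Omega> n D" using S v by blast
    then have zD: "z \<in> D" using circularization_iff[OF inv] p by metis
    have "induced n D G (y(h := v)) = slice_value n (\<lambda>k. im_unit ((y(h := v)) k)) (G z)"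
      using induced_canonical[OF inv G yv] p by simp
    also have "\<dots> = slice_value n (\<lambda>k. im_unit (y k)) (G z)"
      unfolding slice_value_def
    proof (rule sum.cong)
      fix T assume T: "T \<in> Pow {1..n}"
      show "oprod (\<lambda>k. im_unit ((y(h := v)) k)) T * G z T = oprod (\<lambda>k. im_unit (y k)) T * G z T"
      proof (cases "h \<in> T")
        case True
        then show ?thesis using zero[OF zD] T by simp
      next
        case False
        then have "oprod (\<lambda>k. im_unit ((y(h := v)) k)) T = oprod (\<lambda>k. im_unit (y k)) T"
          using T finite_subset by (intro oprod_cong) auto
        then show ?thesis by simp
      qed
    qed simp
    finally show ?thesis .
  qed
  then show "(\<lambda>v. induced n D G (y(h := v))) constant_on ?S"
    unfolding constant_on_def by blast
qed

text \<open>
If no component involves an index below \<open>h\<close>, then in every ordered product the unit of the variable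
\<open>h\<close>, if present, is the leftmost factor. Collecting the summands without and with \<open>h\<close> gives the two
components of a stem function of the variable \<open>h\<close> alone, the other units being absorbed in
coefficients on the right. In the presence of smaller indices it would be enclosed between other units.
\<close>

lemma induced_slice_wrt:
  assumes inv: "invariant n D" and G: "G \<in> stem_functions n D" and h: "h \<in> {1..n}"
    and zero: "\<And>z T k. z \<in> D \<Longrightarrow> T \<subseteq> {1..n} \<Longrightarrow> k \<in> T \<Longrightarrow> k < h \<Longrightarrow> G z T = 0"
  shows "induced n D G \<in> slice_wrt n D h"
  unfolding slice_wrt_def
proof (intro CollectI conjI ballI induced_in_slice_functions[OF G])
  fix y assume y: "y \<in> \<Omega> n D"
  define z where "z = profiles n y"
  have zD: "z \<in> D" and ye: "y \<in> {1..n} \<rightarrow>\<^sub>E UNIV"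
    using y circularization_iff[OF inv] by (auto simp: z_def)
  define E where "E = {w \<in> {1..1::nat} \<rightarrow>\<^sub>E UNIV. z(h := w 1) \<in> D}"
  let ?J = "\<lambda>k. im_unit (y k)" and ?N = "{h+1..n}"
  let ?A = "\<lambda>w::nat \<Rightarrow> complex. \<Sum>T\<in>Pow ?N. oprod ?J T * G (z(h := w 1)) T"
    and ?B = "\<lambda>w::nat \<Rightarrow> complex. \<Sum>T\<in>Pow ?N. oprod ?J T * G (z(h := w 1)) (insert h T)"
  define F1 :: stem where "F1 w K = (if K = {} then ?A w else ?B w)" for w K
  \<comment> \<open>conjugation is an involution, so one direction suffices\<close>
  have upd: "z(h := c) \<in> D \<longleftrightarrow> z(h := cnj c) \<in> D" for c
  proof -
    have "z(h := c) \<in> D \<Longrightarrow> z(h := cnj c) \<in> D" for c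
      using invariant_conj[OF inv _ h, of "z(h := c)"] by simp
    from this[of c] this[of "cnj c"] show ?thesis by auto
  qed
  have invE: "invariant 1 E"
    unfolding invariant_def
  proof (intro conjI ballI)
    fix w :: "nat \<Rightarrow> complex" and k :: nat
    assume w: "w \<in> {1..1} \<rightarrow>\<^sub>E UNIV" and "k \<in> {1..1}"
    then have k: "k = 1" by simp
    have "w(k := cnj (w k)) \<in> {1..1} \<rightarrow>\<^sub>E UNIV" using w k by (auto simp: PiE_def extensional_def)
    then show "(w \<in> E) = (w(k := cnj (w k)) \<in> E)"
      using w upd[of "w 1"] unfolding E_def k by auto
  qed (auto simp: E_def)
  have OmE: "\<Omega> 1 E = {v \<in> {1..1} \<rightarrow>\<^sub>E UNIV. y(h := v 1) \<in> \<Omega> n D}"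
  proof (intro set_eqI)
    fix v :: "nat \<Rightarrow> quat"
    have "y(h := v 1) \<in> {1..n} \<rightarrow>\<^sub>E UNIV" using ye h by (auto simp: PiE_def extensional_def)
    then have "y(h := v 1) \<in> \<Omega> n D \<longleftrightarrow> z(h := profile (v 1)) \<in> D"
      using circularization_iff[OF inv] by (simp add: profiles_upd[OF h] z_def)
    moreover have "profiles 1 v 1 = profile (v 1)" by (simp add: profiles_def)
    ultimately show "v \<in> \<Omega> 1 E \<longleftrightarrow> v \<in> {v \<in> {1..1} \<rightarrow>\<^sub>E UNIV. y(h := v 1) \<in> \<Omega> n D}"
      using circularization_iff[OF invE, of v] profiles_extensional[of 1 v] by (auto simp: E_def)
  qed
  have TN: "T \<subseteq> {1..n}" "insert h T \<subseteq> {1..n}" "h \<notin> T" "finite T" if "T \<in> Pow ?N" for T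
    using that h finite_subset[of T ?N] by auto
  have F1: "F1 \<in> stem_functions 1 E"
    unfolding stem_functions_def
  proof (intro CollectI ballI conjI)
    fix K assume K: "K \<in> Pow {1..1::nat}"
    have c: "continuous_on E (\<lambda>w. G (z(h := w 1)) L)" if "L \<subseteq> {1..n}" for L
    proof (rule continuous_on_compose2[OF stem_continuous[OF G that]])
      show "continuous_on E (\<lambda>w. z(h := w 1))"
        by (intro continuous_on_fun_upd continuous_on_const coordinate_continuous)
    qed (auto simp: E_def)
    have "continuous_on E ?A"
      "continuous_on E ?B"
      by (intro continuous_on_sum continuous_on_mult continuous_on_const c TN; assumption)+
    then show "continuous_on E (\<lambda>w. F1 w K)"
      by (cases "K = {}") (simp_all only: F1_def if_True if_False simp_thms)
    fix w k assume w: "w \<in> E" and "k \<in> {1..1::nat}"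
    then have k: "k = 1" by simp
    have wD: "z(h := w 1) \<in> D" using w by (simp add: E_def)
    have p: "G (z(h := cnj (w 1))) L = (-1) ^ card (L \<inter> {h}) * G (z(h := w 1)) L" if "L \<subseteq> {1..n}" for L
      using stem_parity[OF G that wD h] by simp
    have p1: "G (z(h := cnj (w 1))) T = G (z(h := w 1)) T"
      "G (z(h := cnj (w 1))) (insert h T) = - G (z(h := w 1)) (insert h T)" if "T \<in> Pow ?N" for T
      using p[OF TN(1)[OF that]] p[OF TN(2)[OF that]] TN(3)[OF that] by simp_all
    have s1: "(\<Sum>T\<in>Pow ?N. oprod ?J T * G (z(h := cnj (w 1))) T) = ?A w"
      "(\<Sum>T\<in>Pow ?N. oprod ?J T * G (z(h := cnj (w 1))) (insert h T)) = - ?B w"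
      unfolding sum_negf[symmetric]
      by (rule sum.cong[OF refl], simp only: p1 mult_minus_right)+
    show "F1 (w(k := cnj (w k))) K = (-1) ^ card (K \<inter> {k}) * F1 w K"
    proof (cases "K = {}")
      case True
      then show ?thesis using s1(1) by (simp add: F1_def k)
    next
      case False
      then have "K = {1}" using K by auto
      then show ?thesis using s1(2) by (simp add: F1_def k)
    qed
  qed
  have "induced n D G (y(h := v 1)) = induced 1 E F1 v" if v: "v \<in> \<Omega> 1 E" for v
  proof -
    have yv: "y(h := v 1) \<in> \<Omega> n D" using v OmE by blast
    define z' where "z' = z(h := profile (v 1))"
    let ?J' = "\<lambda>k. im_unit ((y(h := v 1)) k)"
    have z'D: "z' \<in> D" using yv circularization_iff[OF inv] by (simp add: profiles_upd[OF h] z_def z'_def)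
    have "induced n D G (y(h := v 1)) = slice_value n ?J' (G z')"
      using induced_canonical[OF inv G yv] by (simp add: profiles_upd[OF h] z_def z'_def)
    also have "\<dots> = (\<Sum>T\<in>Pow (insert h ?N). oprod ?J' T * G z' T)"
      unfolding slice_value_def
    proof (rule sum.mono_neutral_right)
      show "Pow (insert h ?N) \<subseteq> Pow {1..n}" using h by (intro Pow_mono) auto
      show "\<forall>T\<in>Pow {1..n} - Pow (insert h ?N). oprod ?J' T * G z' T = 0"
      proof
        fix T assume T: "T \<in> Pow {1..n} - Pow (insert h ?N)"
        then obtain t where "t \<in> T" "t \<notin> insert h ?N" "t \<in> {1..n}" by blast
        then have "t \<in> T" "t < h" by auto
        then show "oprod ?J' T * G z' T = 0" using zero[OF z'D, of T t] T by simp
      qed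
    qed simp
    also have "\<dots> = (\<Sum>T\<in>Pow ?N. oprod ?J' T * G z' T) + (\<Sum>T\<in>Pow ?N. oprod ?J' (insert h T) * G z' (insert h T))"
      by (rule sum_Pow_insert) auto
    also have "\<dots> = F1 (profiles 1 v) {} + im_unit (v 1) * F1 (profiles 1 v) {1}"
    proof -
      have e: "oprod ?J' T = oprod ?J T" "oprod ?J' (insert h T) = im_unit (v 1) * oprod ?J T" if "T \<in> Pow ?N" for T
      proof -
        show 1: "oprod ?J' T = oprod ?J T" using TN[OF that] by (intro oprod_cong) auto
        have "oprod ?J' (insert h T) = ?J' h * oprod ?J' T"
          using TN(4)[OF that] that by (intro oprod_insert_less) auto
        with 1 show "oprod ?J' (insert h T) = im_unit (v 1) * oprod ?J T" by simp
      qed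
      have "profiles 1 v 1 = profile (v 1)" by (simp add: profiles_def)
      moreover have "(\<Sum>T\<in>Pow ?N. oprod ?J' T * G z' T) = (\<Sum>T\<in>Pow ?N. oprod ?J T * G z' T)"
        "(\<Sum>T\<in>Pow ?N. oprod ?J' (insert h T) * G z' (insert h T))
          = im_unit (v 1) * (\<Sum>T\<in>Pow ?N. oprod ?J T * G z' (insert h T))"
        unfolding sum_distrib_left by (rule sum.cong[OF refl], simp only: e mult.assoc)+
      ultimately show ?thesis by (simp add: F1_def z'_def)
    qed
    also have "\<dots> = slice_value 1 (\<lambda>k. im_unit (v k)) (F1 (profiles 1 v))"
    proof -
      have "Pow {1..1::nat} = {{}, {1}}" by auto
      moreover have "oprod q {1} = q 1" for q using oprod_insert_less[of "{}" 1 q] by simp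
      ultimately show ?thesis by (simp add: slice_value_def)
    qed
    also have "\<dots> = induced 1 E F1 v" using induced_canonical[OF invE F1 v] by simp
    finally show ?thesis .
  qed
  then have "(\<lambda>v. induced n D G (y(h := v 1))) \<in> slice_functions 1 E"
    unfolding slice_functions_def using F1 by blast
  with invE OmE show "\<exists>E. invariant 1 E \<and> \<Omega> 1 E = {v \<in> {1..1} \<rightarrow>\<^sub>E UNIV. y(h := v 1) \<in> \<Omega> n D}
     \<and> (\<lambda>v. induced n D G (y(h := v 1))) \<in> slice_functions 1 E"
    by blast
qed

section \<open>Divided differences in one of several complex variables\<close>

lemma continuous_within_nhd:
  fixes f :: "'a::t2_space \<Rightarrow> 'b::topological_space"
  assumes "open V" "x \<in> V" "x \<in> S" "continuous_on (S \<inter> V) f"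
  shows "continuous (at x within S) f"
proof -
  have "continuous (at x within S \<inter> V) f"
    using assms by (simp add: continuous_on_eq_continuous_within)
  moreover have "at x within S \<inter> V = at x within S"
    by (rule at_within_nhd[OF assms(2,1)]) auto
  ultimately show ?thesis by simp
qed

lemma continuous_on_locally:
  fixes f :: "'a::t2_space \<Rightarrow> 'b::topological_space"
  assumes "\<And>x. x \<in> S \<Longrightarrow> \<exists>V. open V \<and> x \<in> V \<and> continuous_on (S \<inter> V) f"
  shows "continuous_on S f"
  unfolding continuous_on_eq_continuous_within
  using assms continuous_within_nhd by metis

definition open_domain :: "nat \<Rightarrow> (nat \<Rightarrow> complex) set \<Rightarrow> bool" where
  "open_domain n D \<longleftrightarrow> openin (top_of_set ({1..n} \<rightarrow>\<^sub>E UNIV)) D"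

lemma open_domainE:
  assumes "open_domain n D"
  obtains U where "open U" "D = U \<inter> ({1..n} \<rightarrow>\<^sub>E UNIV)"
  using assms unfolding open_domain_def openin_open by blast

lemma fun_upd_extensional: "h \<in> {1..n} \<Longrightarrow> z \<in> {1..n} \<rightarrow>\<^sub>E UNIV \<Longrightarrow> z(h := w) \<in> {1..n} \<rightarrow>\<^sub>E UNIV"
  by (auto simp: PiE_def extensional_def)

lemma open_domain_vimage:
  fixes g :: "'b::topological_space \<Rightarrow> nat \<Rightarrow> complex"
  assumes "open_domain n D" "continuous_on UNIV g" "\<And>x. g x \<in> {1..n} \<rightarrow>\<^sub>E UNIV"
  shows "open {x. g x \<in> D}"
proof -
  obtain U where U: "open U" "D = U \<inter> ({1..n} \<rightarrow>\<^sub>E UNIV)" using assms(1) by (rule open_domainE)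
  have "{x. g x \<in> D} = g -` U" using U(2) assms(3) by auto
  then show ?thesis using open_vimage[OF U(1) assms(2)] by simp
qed

lemma open_slice:
  assumes "open_domain n D" "z \<in> {1..n} \<rightarrow>\<^sub>E UNIV" "h \<in> {1..n}"
  shows "open {w. z(h := w) \<in> D}"
  by (rule open_domain_vimage[OF assms(1)])
     (intro continuous_on_fun_upd continuous_intros, rule fun_upd_extensional[OF assms(3,2)])

lemma domain_extensional: "open_domain n D \<Longrightarrow> z \<in> D \<Longrightarrow> z \<in> {1..n} \<rightarrow>\<^sub>E UNIV"
  by (erule open_domainE) auto

text \<open>
Transfers identities that are evident for \<open>\<beta>\<^sub>k \<noteq> 0\<close> to points with \<open>\<beta>\<^sub>k = 0\<close>, which are limits of
points moved in the direction \<open>\<i>\<close>.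
\<close>

lemma agree_from_nonreal_coordinate:
  fixes a b :: "(nat \<Rightarrow> complex) \<Rightarrow> 'b::t2_space"
  assumes D: "open_domain n D" and k: "k \<in> {1..n}"
    and cont: "continuous_on D a" "continuous_on D b"
    and eq: "\<And>z. z \<in> D \<Longrightarrow> Im (z k) \<noteq> 0 \<Longrightarrow> a z = b z" and z: "z \<in> D"
  shows "a z = b z"
proof (cases "Im (z k) = 0")
  case True
  define p where "p s = z(k := z k + \<i> * of_real s)" for s :: real
  have cp: "continuous_on UNIV p"
    unfolding p_def by (intro continuous_on_fun_upd continuous_intros)
  have p0: "p 0 = z" by (simp add: p_def)
  have ze: "z \<in> {1..n} \<rightarrow>\<^sub>E UNIV" using domain_extensional[OF D z] .
  have "open {s. p s \<in> D}"
    by (rule open_domain_vimage[OF D cp]) (simp only: p_def fun_upd_extensional[OF k ze])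
  then have ev: "\<forall>\<^sub>F s in at_right 0. p s \<in> D"
    unfolding eventually_at_topological using z p0 by (intro exI[of _ "{s. p s \<in> D}"]) auto
  have "(p \<longlongrightarrow> p 0) (at 0 within UNIV)" using cp unfolding continuous_on_def by blast
  then have lim: "(p \<longlongrightarrow> z) (at_right 0)" unfolding p0 by (rule tendsto_within_subset[OF _ subset_UNIV])
  have la: "((\<lambda>s. a (p s)) \<longlongrightarrow> a z) (at_right 0)" and lb: "((\<lambda>s. b (p s)) \<longlongrightarrow> b z) (at_right 0)"
    using continuous_on_tendsto_compose[OF cont(1) lim z ev]
      continuous_on_tendsto_compose[OF cont(2) lim z ev] by auto
  have "\<forall>\<^sub>F s in at_right (0::real). s > 0" by (simp add: eventually_at_right_less)
  with ev have "\<forall>\<^sub>F s in at_right 0. a (p s) = b (p s)"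
    by eventually_elim (rule eq, auto simp: p_def True)
  then have "((\<lambda>s. b (p s)) \<longlongrightarrow> a z) (at_right 0)" using la by (rule Lim_transform_eventually[rotated])
  then show ?thesis using lb tendsto_unique trivial_limit_at_right_real by blast
qed (use eq z in auto)

text \<open>
A formula uniform in \<open>w1\<close> and \<open>w2\<close>, also where they coincide; it follows from Cauchy's formula by
partial fractions, or from the formula for the derivative.
\<close>

lemma Cauchy_divided_difference:
  assumes hol: "f holomorphic_on S" and S: "open S" "cball c r \<subseteq> S"
    and w: "w1 \<in> ball c r" "w2 \<in> ball c r"
  shows "contour_integral (circlepath c r) (\<lambda>\<zeta>. f \<zeta> / ((\<zeta> - w1) * (\<zeta> - w2)))
    = 2 * of_real pi * \<i> * (if w1 = w2 then deriv f w1 else (f w1 - f w2) / (w1 - w2))"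
proof -
  have fc: "continuous_on (cball c r) f"
    by (rule holomorphic_on_imp_continuous_on[OF holomorphic_on_subset[OF hol S(2)]])
  have fh: "f holomorphic_on ball c r"
    by (rule holomorphic_on_subset[OF holomorphic_on_subset[OF hol S(2)] ball_subset_cball])
  show ?thesis
  proof (cases "w1 = w2")
    case True
    then show ?thesis
      using Cauchy_contour_integral_circlepath_2[OF fc fh w(1)] by (simp add: power2_eq_square)
  next
    case False
    let ?v = "(2 * of_real pi * \<i> * f w1 - 2 * of_real pi * \<i> * f w2) / (w1 - w2)"
    have r: "r > 0" using w by (metis dist_le_zero_iff dist_self dual_order.strict_trans1 mem_ball not_le zero_le_dist)
    have c1: "((\<lambda>u. f u/(u-w)) has_contour_integral (2 * of_real pi * \<i> * f w)) (circlepath c r)"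
      if "w \<in> ball c r" for w
      by (rule Cauchy_integral_circlepath[OF fc fh]) (use that in \<open>simp add: dist_norm norm_minus_commute\<close>)
    have "((\<lambda>\<zeta>. (f \<zeta>/(\<zeta>-w1) - f \<zeta>/(\<zeta>-w2)) / (w1 - w2)) has_contour_integral
       (?v)) (circlepath c r)"
      by (intro has_contour_integral_div has_contour_integral_diff c1 w)
    then have "((\<lambda>\<zeta>. f \<zeta> / ((\<zeta> - w1) * (\<zeta> - w2))) has_contour_integral
       (?v)) (circlepath c r)"
    proof (rule has_contour_integral_eq)
      fix \<zeta> assume "\<zeta> \<in> path_image (circlepath c r)"
      then have "dist c \<zeta> = r" using r by (simp add: sphere_def)
      then have "\<zeta> \<noteq> w1" "\<zeta> \<noteq> w2" using w by auto
      then show "(f \<zeta>/(\<zeta>-w1) - f \<zeta>/(\<zeta>-w2)) / (w1 - w2) = f \<zeta> / ((\<zeta> - w1) * (\<zeta> - w2))"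
        using False by (simp add: divide_simps) (simp add: algebra_simps)
    qed
    then have "contour_integral (circlepath c r) (\<lambda>\<zeta>. f \<zeta> / ((\<zeta> - w1) * (\<zeta> - w2)))
      = ?v"
      by (rule contour_integral_unique)
    with False show ?thesis by (simp add: diff_divide_distrib right_diff_distrib)
  qed
qed

text \<open>
The divided difference in the variable \<open>k\<close> between a point and its conjugate, completed by the
derivative at real points.
\<close>

definition conj_quotient :: "nat \<Rightarrow> ((nat \<Rightarrow> complex) \<Rightarrow> complex) \<Rightarrow> (nat \<Rightarrow> complex) \<Rightarrow> complex" where
  "conj_quotient k \<Phi> z = (if z k = cnj (z k) then deriv (\<lambda>w. \<Phi> (z(k := w))) (z k)
     else (\<Phi> z - \<Phi> (z(k := cnj (z k)))) / (z k - cnj (z k)))"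

text \<open>
Only points with real \<open>z\<^sub>k\<close> are critical. Near such a point the divided difference is a Cauchy
integral over a fixed circle around the real value, which encloses \<open>z\<^sub>k\<close> and its conjugate;
its integrand is jointly continuous in the point and the parameter of the circle.
\<close>

lemma continuous_conj_quotient:
  assumes inv: "invariant n D" and D: "open_domain n D" and k: "k \<in> {1..n}"
    and cont: "continuous_on D \<Phi>"
    and hol: "\<And>z. z \<in> D \<Longrightarrow> (\<lambda>w. \<Phi> (z(k := w))) holomorphic_on {w. z(k := w) \<in> D}"
  shows "continuous_on D (conj_quotient k \<Phi>)"
proof (rule continuous_on_locally)
  fix z0 assume z0: "z0 \<in> D"
  show "\<exists>V. open V \<and> z0 \<in> V \<and> continuous_on (D \<inter> V) (conj_quotient k \<Phi>)"
  proof (cases "z0 k = cnj (z0 k)")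
    case False
    define V where "V = {z::nat \<Rightarrow> complex. z k \<noteq> cnj (z k)}"
    have "open V"
      unfolding V_def
      by (rule open_Collect_neq[OF coordinate_continuous continuous_on_cnj[OF coordinate_continuous]])
    have mem: "z(k := cnj (z k)) \<in> D" if "z \<in> D \<inter> V" for z
      using invariant_conj[OF inv _ k] that by blast
    have "continuous_on (D \<inter> V) (\<lambda>z. (\<Phi> z - \<Phi> (z(k := cnj (z k)))) / (z k - cnj (z k)))"
    proof (intro continuous_on_divide continuous_on_diff continuous_on_cnj coordinate_continuous)
      show "continuous_on (D \<inter> V) \<Phi>" using cont continuous_on_subset by blast
      show "continuous_on (D \<inter> V) (\<lambda>z. \<Phi> (z(k := cnj (z k))))"
        by (rule continuous_on_compose2[OF cont continuous_on_fun_upd])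
           (use mem in \<open>auto intro!: continuous_on_id continuous_on_cnj coordinate_continuous\<close>)
      show "\<forall>z\<in>D \<inter> V. z k - cnj (z k) \<noteq> 0" by (simp add: V_def)
    qed
    moreover have "continuous_on (D \<inter> V) (conj_quotient k \<Phi>) \<longleftrightarrow>
      continuous_on (D \<inter> V) (\<lambda>z. (\<Phi> z - \<Phi> (z(k := cnj (z k)))) / (z k - cnj (z k)))"
      by (rule continuous_on_cong) (auto simp: V_def conj_quotient_def)
    ultimately show ?thesis using \<open>open V\<close> False by (auto simp: V_def)
  next
    case True
    obtain U where U: "open U" "D = U \<inter> ({1..n} \<rightarrow>\<^sub>E UNIV)" using D by (rule open_domainE)
    define c where "c = z0 k"
    have cc: "cnj c = c" using True by (simp add: c_def)
    have "open ((\<lambda>p. (fst p)(k := snd p)) -` U)"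
      by (rule open_vimage[OF U(1)]) (intro continuous_on_fun_upd continuous_intros)
    moreover have "(z0, c) \<in> (\<lambda>p. (fst p)(k := snd p)) -` U" using z0 U(2) by (simp add: c_def)
    ultimately obtain A B where "open A" "open B" "(z0, c) \<in> A \<times> B"
      "A \<times> B \<subseteq> (\<lambda>p. (fst p)(k := snd p)) -` U"
      by (rule open_prod_elim)
    then have AB: "open A" "open B" "z0 \<in> A" "c \<in> B" "A \<times> B \<subseteq> (\<lambda>p. (fst p)(k := snd p)) -` U"
      by simp_all
    obtain r where r: "r > 0" "cball c r \<subseteq> B" using AB(2,4) open_contains_cball by blast
    define V where "V = A \<inter> {z. z k \<in> ball c r}"
    have "open {z::nat \<Rightarrow> complex. z k \<in> ball c r}"
      unfolding mem_ball
      by (rule open_Collect_less[OF continuous_on_dist[OF continuous_on_const coordinate_continuous]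
            continuous_on_const])
    then have "open V" "z0 \<in> V" using AB r by (auto simp: V_def c_def)
    have inD: "z(k := \<zeta>) \<in> D" if "z \<in> D \<inter> V" "\<zeta> \<in> cball c r" for z \<zeta>
    proof -
      have "(z, \<zeta>) \<in> A \<times> B" using that r by (auto simp: V_def)
      then have "z(k := \<zeta>) \<in> U" using AB(5) by auto
      moreover have "z(k := \<zeta>) \<in> {1..n} \<rightarrow>\<^sub>E UNIV"
        by (rule fun_upd_extensional[OF k]) (use that U(2) in simp)
      ultimately show ?thesis using U(2) by simp
    qed
    have in_balls: "z k \<in> ball c r" "cnj (z k) \<in> ball c r" if "z \<in> V" for z
    proof -
      show 1: "z k \<in> ball c r" using that by (simp add: V_def)
      have "dist c (cnj (z k)) = dist (cnj c) (cnj (z k))" by (simp add: cc)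
      also have "\<dots> = dist c (z k)"
        unfolding dist_norm complex_cnj_diff[symmetric] complex_mod_cnj ..
      finally show "cnj (z k) \<in> ball c r" using 1 by simp
    qed
    define G where "G z t = \<Phi> (z(k := circlepath c r t)) /
        ((circlepath c r t - z k) * (circlepath c r t - cnj (z k)))
        * vector_derivative (circlepath c r) (at t)" for z t
    have on: "circlepath c r t \<in> sphere c r" for t
      using r by (simp add: circlepath dist_norm norm_mult)
    have cq: "conj_quotient k \<Phi> z = 1 / (2 * of_real pi * \<i>) * integral (cbox 0 1) (G z)" if z: "z \<in> D \<inter> V" for z
    proof -
      have zD: "z \<in> D" using z by simp
      have sub: "cball c r \<subseteq> {w. z(k := w) \<in> D}" using inD[OF z] by auto
      have "contour_integral (circlepath c r) (\<lambda>\<zeta>. \<Phi> (z(k := \<zeta>)) / ((\<zeta> - z k) * (\<zeta> - cnj (z k))))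
        = 2 * of_real pi * \<i> * conj_quotient k \<Phi> z"
        using Cauchy_divided_difference[OF hol[OF zD] open_slice[OF D domain_extensional[OF D zD] k], of c r "z k" "cnj (z k)"]
          in_balls[of z] sub z unfolding conj_quotient_def by simp
      then have "integral (cbox 0 1) (G z) = 2 * of_real pi * \<i> * conj_quotient k \<Phi> z"
        by (simp only: contour_integral_integral G_def[abs_def] cbox_interval)
      then show ?thesis by simp
    qed
    let ?S = "(D \<inter> V) \<times> cbox 0 (1::real)"
    have "continuous_on ?S (\<lambda>(z, t). G z t)"
      unfolding G_def split_beta
    proof (intro continuous_on_mult continuous_on_divide continuous_on_diff continuous_on_cnj)
      have cp: "continuous_on S (\<lambda>p. circlepath c r (snd p))" for S :: "((nat \<Rightarrow> complex) \<times> real) set"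
        unfolding circlepath by (intro continuous_intros)
      have ck: "continuous_on S (\<lambda>p. (fst p :: nat \<Rightarrow> complex) k)" for S :: "((nat \<Rightarrow> complex) \<times> real) set"
        by (rule continuous_on_coordinate[OF continuous_on_fst[OF continuous_on_id]])
      show "continuous_on ?S (\<lambda>p. circlepath c r (snd p))" by (rule cp)
      show "continuous_on ?S (\<lambda>p. circlepath c r (snd p))" by (rule cp)
      show "continuous_on ?S (\<lambda>p. fst p k)" by (rule ck)
      show "continuous_on ?S (\<lambda>p. fst p k)" by (rule ck)
      show "continuous_on ?S (\<lambda>p. \<Phi> ((fst p)(k := circlepath c r (snd p))))"
      proof (rule continuous_on_compose2[OF cont])
        show "continuous_on ?S (\<lambda>p. (fst p)(k := circlepath c r (snd p)))"
          by (intro continuous_on_fun_upd cp continuous_intros)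
        show "(\<lambda>p. (fst p)(k := circlepath c r (snd p))) ` ?S \<subseteq> D"
        proof (rule image_subsetI)
          fix p assume "p \<in> ?S"
          then have "fst p \<in> D \<inter> V" by auto
          moreover have "circlepath c r (snd p) \<in> cball c r"
            using on[of "snd p"] by simp
          ultimately show "(fst p)(k := circlepath c r (snd p)) \<in> D" by (rule inD)
        qed
      qed
      show "\<forall>p\<in>?S. (circlepath c r (snd p) - fst p k) * (circlepath c r (snd p) - cnj (fst p k)) \<noteq> 0"
      proof
        fix p assume "p \<in> ?S"
        then have "fst p \<in> V" by auto
        with in_balls[of "fst p"] on[of "snd p"]
        show "(circlepath c r (snd p) - fst p k) * (circlepath c r (snd p) - cnj (fst p k)) \<noteq> 0"
          by auto
      qed
      show "continuous_on ?S (\<lambda>p. vector_derivative (circlepath c r) (at (snd p)))"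
        unfolding vector_derivative_circlepath by (intro continuous_intros)
    qed
    from integral_continuous_on_param[OF this]
    have "continuous_on (D \<inter> V) (\<lambda>z. 1 / (2 * of_real pi * \<i>) * integral (cbox 0 1) (G z))"
      by (intro continuous_intros)
    moreover have "continuous_on (D \<inter> V) (conj_quotient k \<Phi>) \<longleftrightarrow>
      continuous_on (D \<inter> V) (\<lambda>z. 1 / (2 * of_real pi * \<i>) * integral (cbox 0 1) (G z))"
      by (rule continuous_on_cong) (use cq in auto)
    ultimately show ?thesis using \<open>open V\<close> \<open>z0 \<in> V\<close> by blast
  qed
qed

text \<open>
If \<open>z\<^sub>k\<close> is real, the function of \<open>z\<^sub>h\<close> is approximated by those with \<open>z\<^sub>k\<close> replaced by
\<open>z\<^sub>k + \<i> s\<close>, \<open>s \<rightarrow> 0\<close>. Joint continuity is uniform on compact sets, so the convergence is locally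
uniform and Weierstrass' theorem applies.
\<close>

lemma separately_holomorphic_limit:
  assumes D: "open_domain n D" and k: "k \<in> {1..n}" and h: "h \<in> {1..n}" "h \<noteq> k"
    and cont: "continuous_on D \<Theta>"
    and hol: "\<And>z. z \<in> D \<Longrightarrow> Im (z k) \<noteq> 0 \<Longrightarrow> (\<lambda>w. \<Theta> (z(h := w))) holomorphic_on {w. z(h := w) \<in> D}"
    and z: "z \<in> D"
  shows "(\<lambda>w. \<Theta> (z(h := w))) holomorphic_on {w. z(h := w) \<in> D}"
proof (cases "Im (z k) = 0")
  case True
  have ze: "z \<in> {1..n} \<rightarrow>\<^sub>E UNIV" using domain_extensional[OF D z] .
  let ?E = "{w. z(h := w) \<in> D}"
  let ?p = "\<lambda>(w, c). (z(h := w))(k := c)"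
  have oE: "open ?E" by (rule open_slice[OF D ze h(1)])
  have cp: "continuous_on UNIV ?p"
    unfolding split_beta by (intro continuous_on_fun_upd continuous_intros)
  have op: "open {q. ?p q \<in> D}"
    by (rule open_domain_vimage[OF D cp])
       (use fun_upd_extensional[OF k fun_upd_extensional[OF h(1) ze]] in auto)
  show ?thesis
    unfolding holomorphic_on_open[OF oE]
  proof (intro ballI allI)
    fix w0 assume w0: "w0 \<in> ?E"
    have "(w0, z k) \<in> {q. ?p q \<in> D}"
    proof -
      have "(z(h := w0))(k := z k) = z(h := w0)" using h(2) by auto
      then show ?thesis using w0 by auto
    qed
    with op obtain A B where "open A" "open B" "(w0, z k) \<in> A \<times> B" "A \<times> B \<subseteq> {q. ?p q \<in> D}"
      by (rule open_prod_elim)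
    then have AB: "open A" "open B" "w0 \<in> A" "z k \<in> B" "A \<times> B \<subseteq> {q. ?p q \<in> D}"
      by simp_all
    obtain d where d: "d > 0" "cball w0 d \<subseteq> A" using AB(1,3) open_contains_cball by blast
    obtain e where e: "e > 0" "cball (z k) e \<subseteq> B" using AB(2,4) open_contains_cball by blast
    define C where "C = cball w0 d \<times> cball (z k) e"
    have CD: "?p q \<in> D" if "q \<in> C" for q
    proof -
      have "q \<in> A \<times> B" using that d e unfolding C_def by auto
      then show ?thesis using AB(5) by blast
    qed
    have "continuous_on C (\<lambda>q. \<Theta> (?p q))"
      by (rule continuous_on_compose2[OF cont continuous_on_subset[OF cp]]) (use CD in auto)
    moreover have "compact C" unfolding C_def by (intro compact_Times compact_cball)
    ultimately have uc: "uniformly_continuous_on C (\<lambda>q. \<Theta> (?p q))"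
      by (rule compact_uniformly_continuous)
    \<comment> \<open>the shifts are kept in \<open>(0, e]\<close>, so that all approximants are defined on the same ball\<close>
    define s where "s j = e / real (Suc j)" for j
    have s: "0 < s j" "s j \<le> e" for j
      using e by (auto simp: s_def field_simps)
    have slim: "s \<longlonglongrightarrow> 0" unfolding s_def using lim_const_over_n LIMSEQ_Suc by blast
    define f where "f j w = \<Theta> ((z(h := w))(k := z k + \<i> * of_real (s j)))" for j w
    have inC: "(w, z k + \<i> * of_real (s j)) \<in> C" if "w \<in> cball w0 d" for w j
      using that s[of j] by (simp add: C_def dist_norm norm_mult)
    have inC0: "(w, z k) \<in> C" if "w \<in> cball w0 d" for w
      using that e by (simp add: C_def)
    have zk: "(z(h := w))(k := z k) = z(h := w)" for w using h(2) by auto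
    have ul: "uniform_limit (cball w0 d) f (\<lambda>w. \<Theta> (z(h := w))) sequentially"
      unfolding uniform_limit_iff
    proof (intro allI impI)
      fix \<epsilon> :: real assume "\<epsilon> > 0"
      then obtain \<delta> where \<delta>: "\<delta> > 0"
        "\<And>q q'. q \<in> C \<Longrightarrow> q' \<in> C \<Longrightarrow> dist q' q < \<delta> \<Longrightarrow> dist (\<Theta> (?p q')) (\<Theta> (?p q)) < \<epsilon>"
        using uc unfolding uniformly_continuous_on_def by metis
      have "\<forall>\<^sub>F j in sequentially. s j < \<delta>" using order_tendstoD(2)[OF slim \<delta>(1)] .
      then show "\<forall>\<^sub>F j in sequentially. \<forall>w\<in>cball w0 d. dist (f j w) (\<Theta> (z(h := w))) < \<epsilon>"
      proof eventually_elim
        case (elim j)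
        show ?case
        proof
          fix w assume w: "w \<in> cball w0 d"
          have "dist (w, z k + \<i> * of_real (s j)) (w, z k) < \<delta>"
            using elim s(1)[of j] by (simp add: dist_Pair_Pair dist_norm norm_mult)
          from \<delta>(2)[OF inC0[OF w] inC[OF w] this]
          show "dist (f j w) (\<Theta> (z(h := w))) < \<epsilon>" by (simp add: f_def zk)
        qed
      qed
    qed
    have "(\<lambda>w. \<Theta> (z(h := w))) holomorphic_on ball w0 d"
    proof (rule holomorphic_uniform_sequence)
      fix j
      let ?z = "(z(h := w0))(k := z k + \<i> * of_real (s j))"
      have "?z \<in> D" using CD[OF inC[of w0 j]] d by simp
      moreover have "Im (?z k) \<noteq> 0" using True s(1)[of j] by simp
      ultimately have "(\<lambda>w. \<Theta> (?z(h := w))) holomorphic_on {w. ?z(h := w) \<in> D}" by (rule hol)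
      moreover have upd: "?z(h := w) = (z(h := w))(k := z k + \<i> * of_real (s j))" for w
        using h(2) by auto
      moreover have "ball w0 d \<subseteq> {w. ?z(h := w) \<in> D}"
      proof
        fix w assume "w \<in> ball w0 d"
        then show "w \<in> {w. ?z(h := w) \<in> D}" using CD[OF inC[of w j]] upd[of w] by simp
      qed
      ultimately show "f j holomorphic_on ball w0 d"
        unfolding f_def upd by (elim holomorphic_on_subset)
    next
      fix x assume "x \<in> ball w0 d"
      then obtain d' where "d' > 0" "cball x d' \<subseteq> ball w0 d"
        by (meson open_ball open_contains_cball)
      then show "\<exists>d'>0. cball x d' \<subseteq> ball w0 d \<and> uniform_limit (cball x d') f (\<lambda>w. \<Theta> (z(h := w))) sequentially"
        using uniform_limit_on_subset[OF ul] ball_subset_cball by blast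
    qed simp
    then show "\<exists>f'. ((\<lambda>w. \<Theta> (z(h := w))) has_field_derivative f') (at w0)"
      using d holomorphic_on_open[of "ball w0 d"] by auto
  qed
qed (use hol z in auto)


section \<open>Families of separately holomorphic pairs\<close>

text \<open>
One real coordinate of each component of a stem function; working with real coordinates
turns pairs of components into ordinary complex functions.
\<close>

type_synonym real_family = "(nat \<Rightarrow> complex) \<Rightarrow> nat set \<Rightarrow> real"

text \<open>
The complex structure depends on the variable: in direction \<open>h\<close> the component with index \<open>T\<close> is
paired with the one with index \<open>T \<union> {h}\<close>.
\<close>

definition pair_fun :: "nat \<Rightarrow> nat set \<Rightarrow> real_family \<Rightarrow> (nat \<Rightarrow> complex) \<Rightarrow> complex" where
  "pair_fun h T u z = Complex (u z T) (u z (insert h T))"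

definition holomorphic_pairs :: "nat \<Rightarrow> (nat \<Rightarrow> complex) set \<Rightarrow> nat set \<Rightarrow> real_family \<Rightarrow> bool" where
  "holomorphic_pairs n D H u \<longleftrightarrow> (\<forall>h\<in>{1..n}-H. \<forall>T. T \<subseteq> {1..n} - H \<longrightarrow> h \<notin> T \<longrightarrow>
     (\<forall>z\<in>D. (\<lambda>w. pair_fun h T u (z(h := w))) holomorphic_on {w. z(h := w) \<in> D}))"

text \<open>
The variables in \<open>H\<close> have already been divided out: only components with indices outside \<open>H\<close>
remain, they are even in the variables of \<open>H\<close>, and holomorphy is demanded in the other
variables.
\<close>

definition regular_family :: "nat \<Rightarrow> (nat \<Rightarrow> complex) set \<Rightarrow> nat set \<Rightarrow> real_family \<Rightarrow> bool" where
  "regular_family n D H u \<longleftrightarrow>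
     (\<forall>T. T \<subseteq> {1..n} - H \<longrightarrow> continuous_on D (\<lambda>z. u z T) \<and>
        (\<forall>z\<in>D. \<forall>h\<in>{1..n}. u (z(h := cnj (z h))) T = (-1) ^ card (T \<inter> {h}) * u z T)) \<and>
     holomorphic_pairs n D H u"

text \<open>
The spherical derivative in the variable \<open>k\<close>, with its limit as value at real points.
\<close>

definition spherical_quotient :: "nat \<Rightarrow> real_family \<Rightarrow> real_family" where
  "spherical_quotient k u z T = (if Im (z k) = 0 then Re (deriv (\<lambda>w. pair_fun k T u (z(k := w))) (z k))
     else u z (insert k T) / Im (z k))"

lemma regular_family_continuous:
  "regular_family n D H u \<Longrightarrow> T \<subseteq> {1..n} - H \<Longrightarrow> continuous_on D (\<lambda>z. u z T)"
  by (simp add: regular_family_def)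

lemma regular_family_parity:
  "regular_family n D H u \<Longrightarrow> T \<subseteq> {1..n} - H \<Longrightarrow> z \<in> D \<Longrightarrow> h \<in> {1..n} \<Longrightarrow>
    u (z(h := cnj (z h))) T = (-1) ^ card (T \<inter> {h}) * u z T"
  by (simp add: regular_family_def)

lemma regular_family_holomorphic:
  "regular_family n D H u \<Longrightarrow> h \<in> {1..n} - H \<Longrightarrow> T \<subseteq> {1..n} - H \<Longrightarrow> h \<notin> T \<Longrightarrow> z \<in> D \<Longrightarrow>
    (\<lambda>w. pair_fun h T u (z(h := w))) holomorphic_on {w. z(h := w) \<in> D}"
  by (simp add: regular_family_def holomorphic_pairs_def)

lemma continuous_on_Complex:
  "continuous_on S a \<Longrightarrow> continuous_on S b \<Longrightarrow> continuous_on S (\<lambda>z. Complex (a z) (b z))"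
  unfolding Complex_eq by (intro continuous_intros)

text \<open>
Parity makes the value of the pair at the conjugate point the conjugate of its value, so the
difference is twice the imaginary part.
\<close>

lemma spherical_quotient_eq_conj_quotient:
  assumes u: "regular_family n D H u" and k: "k \<in> {1..n} - H"
    and T: "T \<subseteq> {1..n} - H" "k \<notin> T" and z: "z \<in> D"
  shows "spherical_quotient k u z T = Re (conj_quotient k (pair_fun k T u) z)"
proof (cases "Im (z k) = 0")
  case True
  then have "z k = cnj (z k)" by (simp add: complex_eq_iff)
  with True show ?thesis by (simp add: spherical_quotient_def conj_quotient_def)
next
  case False
  then have ne: "z k \<noteq> cnj (z k)" by (simp add: complex_eq_iff)
  have kn: "k \<in> {1..n}" and T': "insert k T \<subseteq> {1..n} - H" using k T by auto
  have "pair_fun k T u (z(k := cnj (z k))) = Complex (u z T) (- u z (insert k T))"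
    using regular_family_parity[OF u T(1) z kn] regular_family_parity[OF u T' z kn] T(2)
    by (simp add: pair_fun_def)
  then have "pair_fun k T u z - pair_fun k T u (z(k := cnj (z k))) = \<i> * of_real (2 * u z (insert k T))"
    by (simp add: pair_fun_def complex_eq_iff)
  moreover have "z k - cnj (z k) = \<i> * of_real (2 * Im (z k))" by (simp add: complex_eq_iff)
  ultimately have "conj_quotient k (pair_fun k T u) z = of_real (u z (insert k T) / Im (z k))"
    using ne False by (simp add: conj_quotient_def)
  then show ?thesis using False by (simp add: spherical_quotient_def)
qed

text \<open>
Continuity is that of divided differences. Parity and holomorphy in another variable are evident
where \<open>\<beta>\<^sub>k \<noteq> 0\<close>, since there the quotient has a denominator that does not depend on that
variable; the limit lemmas carry them to \<open>\<beta>\<^sub>k = 0\<close>.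
\<close>

lemma spherical_quotient_regular:
  assumes inv: "invariant n D" and D: "open_domain n D"
    and u: "regular_family n D H u" and k: "k \<in> {1..n} - H"
  shows "regular_family n D (insert k H) (spherical_quotient k u)"
proof -
  have kn: "k \<in> {1..n}" using k by simp
  have cont: "continuous_on D (\<lambda>z. spherical_quotient k u z T)" if T: "T \<subseteq> {1..n} - insert k H" for T
  proof -
    have T': "T \<subseteq> {1..n} - H" "k \<notin> T" "insert k T \<subseteq> {1..n} - H" using T k by auto
    have "continuous_on D (conj_quotient k (pair_fun k T u))"
    proof (rule continuous_conj_quotient[OF inv D kn])
      show "continuous_on D (pair_fun k T u)"
        unfolding pair_fun_def[abs_def]
        by (intro continuous_on_Complex regular_family_continuous[OF u] T')
    qed (rule regular_family_holomorphic[OF u k T'(1,2)])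
    then have "continuous_on D (\<lambda>z. Re (conj_quotient k (pair_fun k T u) z))"
      by (intro continuous_intros)
    then show ?thesis
      by (rule continuous_on_eq) (use spherical_quotient_eq_conj_quotient[OF u k T'(1,2)] in simp)
  qed
  have par: "spherical_quotient k u (z(h := cnj (z h))) T = (-1) ^ card (T \<inter> {h}) * spherical_quotient k u z T"
    if T: "T \<subseteq> {1..n} - insert k H" and z: "z \<in> D" and h: "h \<in> {1..n}" for T z h
  proof (rule agree_from_nonreal_coordinate[OF D kn _ _ _ z])
    have T': "T \<subseteq> {1..n} - H" "k \<notin> T" "insert k T \<subseteq> {1..n} - H" using T k by auto
    show "continuous_on D (\<lambda>z. spherical_quotient k u (z(h := cnj (z h))) T)"
    proof (rule continuous_on_compose2[OF cont[OF T]])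
      show "continuous_on D (\<lambda>z. z(h := cnj (z h)))"
        by (intro continuous_on_fun_upd continuous_on_id continuous_on_cnj coordinate_continuous)
      show "(\<lambda>z. z(h := cnj (z h))) ` D \<subseteq> D" using invariant_conj[OF inv _ h] by blast
    qed
    show "continuous_on D (\<lambda>z. (-1) ^ card (T \<inter> {h}) * spherical_quotient k u z T)"
      by (intro continuous_intros cont[OF T])
    fix z assume z: "z \<in> D" "Im (z k) \<noteq> 0"
    have "Im ((z(h := cnj (z h))) k) = (if h = k then - Im (z k) else Im (z k))" by simp
    moreover have "u (z(h := cnj (z h))) (insert k T) = (-1) ^ card (insert k T \<inter> {h}) * u z (insert k T)"
      by (rule regular_family_parity[OF u T'(3) z(1) h])
    moreover have "insert k T \<inter> {h} = (if h = k then {k} else T \<inter> {h})" "h = k \<Longrightarrow> T \<inter> {h} = {}"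
      using T' by auto
    ultimately show "spherical_quotient k u (z(h := cnj (z h))) T = (-1) ^ card (T \<inter> {h}) * spherical_quotient k u z T"
      using z(2) by (cases "h = k") (simp_all add: spherical_quotient_def)
  qed
  have hol: "(\<lambda>w. pair_fun h T (spherical_quotient k u) (z(h := w))) holomorphic_on {w. z(h := w) \<in> D}"
    if h: "h \<in> {1..n} - insert k H" and T: "T \<subseteq> {1..n} - insert k H" "h \<notin> T" and z: "z \<in> D" for h T z
  proof (rule separately_holomorphic_limit[OF D kn _ _ _ _ z])
    show "h \<in> {1..n}" "h \<noteq> k" using h by auto
    have hT: "insert h T \<subseteq> {1..n} - insert k H" using h T by auto
    show "continuous_on D (pair_fun h T (spherical_quotient k u))"
      unfolding pair_fun_def[abs_def]
      by (intro continuous_on_Complex cont T hT)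
    fix z assume z: "z \<in> D" "Im (z k) \<noteq> 0"
    have "(\<lambda>w. pair_fun h (insert k T) u (z(h := w))) holomorphic_on {w. z(h := w) \<in> D}"
      by (rule regular_family_holomorphic[OF u _ _ _ z(1)]) (use h T k in auto)
    then have "(\<lambda>w. pair_fun h (insert k T) u (z(h := w)) / of_real (Im (z k))) holomorphic_on {w. z(h := w) \<in> D}"
      using z by (intro holomorphic_intros) auto
    moreover have "pair_fun h T (spherical_quotient k u) (z(h := w)) = pair_fun h (insert k T) u (z(h := w)) / of_real (Im (z k))" for w
      using h z by (simp add: pair_fun_def spherical_quotient_def complex_eq_iff insert_commute)
    ultimately show "(\<lambda>w. pair_fun h T (spherical_quotient k u) (z(h := w))) holomorphic_on {w. z(h := w) \<in> D}"
      by simp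
  qed
  show ?thesis
    unfolding regular_family_def holomorphic_pairs_def
    by (intro conjI allI impI ballI cont par hol)
qed

lemma iterated_spherical_quotient:
  assumes inv: "invariant n D" and D: "open_domain n D" and u: "regular_family n D {} u"
    and H: "finite H" "H \<subseteq> {1..n}"
  obtains v where "regular_family n D H v"
    "\<And>z T. z \<in> nonreal_part D H \<Longrightarrow> T \<subseteq> {1..n} - H \<Longrightarrow> v z T = u z (T \<union> H) / (\<Prod>h\<in>H. Im (z h))"
proof -
  have "\<exists>v. regular_family n D H v \<and> (\<forall>z\<in>nonreal_part D H. \<forall>T. T \<subseteq> {1..n} - H \<longrightarrow>
     v z T = u z (T \<union> H) / (\<Prod>h\<in>H. Im (z h)))"
    using H
  proof (induction H)
    case empty
    then show ?case using u by auto
  next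
    case (insert k H)
    then obtain v where v: "regular_family n D H v"
      "\<And>z T. z \<in> nonreal_part D H \<Longrightarrow> T \<subseteq> {1..n} - H \<Longrightarrow> v z T = u z (T \<union> H) / (\<Prod>h\<in>H. Im (z h))"
      by auto
    have "regular_family n D (insert k H) (spherical_quotient k v)"
      by (rule spherical_quotient_regular[OF inv D v(1)]) (use insert in auto)
    moreover have "spherical_quotient k v z T = u z (T \<union> insert k H) / (\<Prod>h\<in>insert k H. Im (z h))"
      if z: "z \<in> nonreal_part D (insert k H)" and T: "T \<subseteq> {1..n} - insert k H" for z T
    proof -
      have "z \<in> nonreal_part D H" "Im (z k) \<noteq> 0" using z by (auto simp: nonreal_part_def)
      moreover have "insert k T \<subseteq> {1..n} - H" using T insert by auto
      moreover have "insert k T \<union> H = T \<union> insert k H" by auto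
      ultimately show ?thesis using v(2)[of z "insert k T"] insert.hyps
        by (simp add: spherical_quotient_def mult.commute)
    qed
    ultimately show ?case by blast
  qed
  then obtain v where "regular_family n D H v"
    "\<forall>z\<in>nonreal_part D H. \<forall>T. T \<subseteq> {1..n} - H \<longrightarrow> v z T = u z (T \<union> H) / (\<Prod>h\<in>H. Im (z h))"
    by (elim exE conjE)
  then show ?thesis using that[of v] by auto
qed

text \<open>
The effect of \<open>var_mult\<close> on one real coordinate.
\<close>

definition real_var_mult :: "nat \<Rightarrow> real_family \<Rightarrow> real_family" where
  "real_var_mult k u z L = Re (z k) * u z L +
     (if k \<in> L then Im (z k) * u z (L - {k}) else - (Im (z k) * u z (insert k L)))"

text \<open>
In the variable \<open>k\<close> itself the pair is multiplied by \<open>w\<close>. In every other variable it is a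
combination of two pairs with real coefficients that do not depend on \<open>w\<close>.
\<close>

lemma real_var_mult_holomorphic_pairs:
  assumes u: "holomorphic_pairs n D {} u" and k: "k \<in> {1..n}"
  shows "holomorphic_pairs n D {} (real_var_mult k u)"
  unfolding holomorphic_pairs_def
proof (intro ballI allI impI)
  fix h T z assume h: "h \<in> {1..n} - {}" and T: "T \<subseteq> {1..n} - {}" "h \<notin> T" and z: "z \<in> D"
  have hol: "(\<lambda>w. pair_fun h T u (z(h := w))) holomorphic_on {w. z(h := w) \<in> D}"
    if "T \<subseteq> {1..n}" "h \<notin> T" for T
    using u h z that unfolding holomorphic_pairs_def by auto
  show "(\<lambda>w. pair_fun h T (real_var_mult k u) (z(h := w))) holomorphic_on {w. z(h := w) \<in> D}"
  proof (cases "h = k")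
    case True
    have eq: "pair_fun h T (real_var_mult k u) (z(h := w)) = w * pair_fun h T u (z(h := w))" for w
      using T True by (simp add: pair_fun_def real_var_mult_def complex_eq_iff algebra_simps)
    show ?thesis unfolding eq using T by (intro holomorphic_intros hol) auto
  next
    case False
    define T' where "T' = (if k \<in> T then T - {k} else insert k T)"
    define s where "s = (if k \<in> T then 1 else -1 :: real)"
    have T': "T' \<subseteq> {1..n}" "h \<notin> T'" using T k False by (auto simp: T'_def)
    have 1: "insert h T - {k} = insert h (T - {k})" using False by auto
    have eq: "pair_fun h T (real_var_mult k u) (z(h := w)) =
      of_real (Re (z k)) * pair_fun h T u (z(h := w)) + of_real (s * Im (z k)) * pair_fun h T' u (z(h := w))" for w
      using False
      by (cases "k \<in> T") (simp_all add: pair_fun_def real_var_mult_def complex_eq_iff T'_def s_def 1 insert_commute)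
    show ?thesis unfolding eq using T T' by (intro holomorphic_intros hol) auto
  qed
qed

section \<open>Holomorphic stem functions and the Cauchy-Riemann equations\<close>

text \<open>
Continuous partial derivatives give real differentiability, and the assumed form of the partial
derivatives makes the real derivative complex linear.
\<close>

lemma holomorphic_from_partials:
  fixes \<phi> :: "complex \<Rightarrow> complex"
  assumes E: "open E" and cont: "continuous_on E P"
    and re: "\<And>w. w \<in> E \<Longrightarrow> ((\<lambda>t::real. \<phi> (w + of_real t)) has_vector_derivative P w) (at 0)"
    and im: "\<And>w. w \<in> E \<Longrightarrow> ((\<lambda>t::real. \<phi> (w + \<i> * of_real t)) has_vector_derivative \<i> * P w) (at 0)"
  shows "\<phi> holomorphic_on E"
  unfolding holomorphic_on_open[OF E]
proof
  fix w0 assume w0: "w0 \<in> E"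
  have cC: "continuous_on UNIV (\<lambda>(x, y). Complex x y)"
    unfolding split_beta by (intro continuous_on_Complex continuous_intros)
  have "open ((\<lambda>(x, y). Complex x y) -` E)" by (rule open_vimage[OF E cC])
  moreover have "(Re w0, Im w0) \<in> (\<lambda>(x, y). Complex x y) -` E" using w0 by simp
  ultimately obtain A B where AB: "open A" "open B" "(Re w0, Im w0) \<in> A \<times> B"
    "A \<times> B \<subseteq> (\<lambda>(x, y). Complex x y) -` E" by (rule open_prod_elim)
  obtain e where e: "e > 0" "ball (Im w0) e \<subseteq> B" using AB(2,3) by (auto elim: openE)
  define Y where "Y = ball (Im w0) e"
  have inE: "Complex x y \<in> E" if "x \<in> A" "y \<in> Y" for x y
  proof -
    have "(x, y) \<in> A \<times> B" using that e(2) unfolding Y_def by blast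
    then have "(x, y) \<in> (\<lambda>(x, y). Complex x y) -` E" using AB(4) by blast
    then show ?thesis by simp
  qed
  have shift: "((\<lambda>s. f s) has_vector_derivative d) (at s0)"
    if "((\<lambda>t. f (s0 + t)) has_vector_derivative d) (at 0)" for f :: "real \<Rightarrow> complex" and d s0
  proof -
    have "((\<lambda>s. s - s0) has_vector_derivative 1) (at s0)"
      by (auto intro!: derivative_eq_intros)
    moreover have "((\<lambda>t. f (s0 + t)) has_vector_derivative d) (at (s0 - s0))" using that by simp
    ultimately have "(((\<lambda>t. f (s0 + t)) \<circ> (\<lambda>s. s - s0)) has_vector_derivative (1 *\<^sub>R d)) (at s0)"
      by (rule vector_diff_chain_at)
    then show ?thesis by (simp add: o_def)
  qed
  define f where "f x y = \<phi> (Complex x y)" for x y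
  define fy where "fy x y = blinfun_scaleR_left (\<i> * P (Complex x y))" for x y
  have "((\<lambda>(x, y). f x y) has_derivative (\<lambda>(tx, ty). tx *\<^sub>R P w0 + fy (Re w0) (Im w0) ty))
      (at (Re w0, Im w0) within A \<times> Y)"
  proof (rule has_derivative_partialsI)
    have "((\<lambda>x. f x (Im w0)) has_vector_derivative P w0) (at (Re w0))"
    proof (rule shift)
      have "f (Re w0 + t) (Im w0) = \<phi> (w0 + of_real t)" for t
        unfolding f_def by (rule arg_cong[where f=\<phi>]) (simp add: complex_eq_iff)
      then show "((\<lambda>t. f (Re w0 + t) (Im w0)) has_vector_derivative P w0) (at 0)"
        using re[OF w0] by simp
    qed
    then show "((\<lambda>x. f x (Im w0)) has_derivative (\<lambda>tx. tx *\<^sub>R P w0)) (at (Re w0) within A)"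
      unfolding has_vector_derivative_def by (rule has_derivative_at_withinI)
  next
    fix x y assume xy: "x \<in> A" "y \<in> Y"
    have "((\<lambda>y. f x y) has_vector_derivative \<i> * P (Complex x y)) (at y)"
    proof (rule shift)
      have "f x (y + t) = \<phi> (Complex x y + \<i> * of_real t)" for t
        unfolding f_def by (rule arg_cong[where f=\<phi>]) (simp add: complex_eq_iff)
      then show "((\<lambda>t. f x (y + t)) has_vector_derivative \<i> * P (Complex x y)) (at 0)"
        using im[OF inE[OF xy]] by simp
    qed
    then show "((\<lambda>y. f x y) has_derivative blinfun_apply (fy x y)) (at y within Y)"
      unfolding has_vector_derivative_def fy_def blinfun_scaleR_left.rep_eq
      by (rule has_derivative_at_withinI)
  next
    have "continuous_on (A \<times> Y) (\<lambda>p. P ((\<lambda>(x, y). Complex x y) p))"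
      by (rule continuous_on_compose2[OF cont continuous_on_subset[OF cC]]) (use inE in auto)
    then have "continuous_on (A \<times> Y) (\<lambda>p. blinfun_scaleR_left (\<i> * P ((\<lambda>(x, y). Complex x y) p)))"
      by (intro bounded_linear.continuous_on[OF bounded_linear_blinfun_scaleR_left] continuous_intros)
    then have "continuous_on (A \<times> Y) (\<lambda>(x, y). fy x y)"
      by (simp add: fy_def split_beta)
    then show "continuous (at (Re w0, Im w0) within A \<times> Y) (\<lambda>(x, y). fy x y)"
      using AB(3) e(1) by (simp add: continuous_on_eq_continuous_within Y_def)
  qed (use e in \<open>auto simp: Y_def\<close>)
  moreover have "at (Re w0, Im w0) within A \<times> Y = at (Re w0, Im w0)"
    by (rule at_within_open) (use AB e in \<open>auto simp: Y_def intro: open_Times\<close>)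
  ultimately have der: "((\<lambda>(x, y). f x y) has_derivative (\<lambda>(tx, ty). tx *\<^sub>R P w0 + ty *\<^sub>R (\<i> * P w0)))
      (at (Re w0, Im w0))"
    by (simp add: fy_def)
  have pr: "((\<lambda>w. (Re w, Im w)) has_derivative (\<lambda>w. (Re w, Im w))) (at w0)"
    by (intro bounded_linear_imp_has_derivative bounded_linear_Pair bounded_linear_Re bounded_linear_Im)
  have "(((\<lambda>(x, y). f x y) \<circ> (\<lambda>w. (Re w, Im w))) has_derivative
      ((\<lambda>(tx, ty). tx *\<^sub>R P w0 + ty *\<^sub>R (\<i> * P w0)) \<circ> (\<lambda>w. (Re w, Im w)))) (at w0)"
    by (rule diff_chain_at[OF pr der])
  moreover have "(\<lambda>(x, y). f x y) \<circ> (\<lambda>w. (Re w, Im w)) = \<phi>"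
    by (simp add: fun_eq_iff f_def)
  moreover have "(\<lambda>(tx, ty). tx *\<^sub>R P w0 + ty *\<^sub>R (\<i> * P w0)) \<circ> (\<lambda>w. (Re w, Im w)) = (*) (P w0)"
    by (simp add: fun_eq_iff complex_eq_iff algebra_simps)
  ultimately show "\<exists>f'. (\<phi> has_field_derivative f') (at w0)"
    unfolding has_field_derivative_def by auto
qed

text \<open>
The vanishing of \<open>stem_dbar h F\<close> at the indices \<open>T\<close> and \<open>T \<union> {h}\<close> is the pair of
Cauchy-Riemann equations for \<open>F\<^sub>T\<close> and \<open>F\<^sub>T\<^sub>\<union>\<^sub>h\<close>.
\<close>

lemma holomorphic_stem_pairs:
  assumes inv: "invariant n D" and D: "open_domain n D" and F: "holomorphic_stem n D F"
  shows "holomorphic_pairs n D {} (\<lambda>z T. inner (F z T) b)"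
  unfolding holomorphic_pairs_def
proof (intro ballI allI impI)
  fix h T z assume "h \<in> {1..n} - {}" and "T \<subseteq> {1..n} - {}" and hT: "h \<notin> T" and z: "z \<in> D"
  then have h: "h \<in> {1..n}" and T: "T \<subseteq> {1..n}" "insert h T \<subseteq> {1..n}" by auto
  let ?u = "\<lambda>z T. inner (F z T) b"
  let ?E = "{w. z(h := w) \<in> D}"
  have oE: "open ?E" by (rule open_slice[OF D domain_extensional[OF D z] h])
  have C1: "C1_stem n D F" and dbar: "\<And>z K. z \<in> D \<Longrightarrow> K \<subseteq> {1..n} \<Longrightarrow> stem_dbar h F z K = 0"
    using F h by (auto simp: holomorphic_stem_def)
  have der: "((\<lambda>t::real. F (z(h := z h + t *\<^sub>R w)) K) has_vector_derivative stem_partial h w F z K) (at 0)"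
    if "z \<in> D" "K \<subseteq> {1..n}" "w \<in> {1, \<i>}" for z K w
    using C1 h that unfolding C1_stem_def stem_partial_def vector_derivative_works[symmetric] by blast
  have pc: "continuous_on D (\<lambda>z. stem_partial h 1 F z K)" if "K \<subseteq> {1..n}" for K
    using C1 h that unfolding C1_stem_def by blast
  have CR1: "stem_partial h \<i> F z (insert h T) = stem_partial h 1 F z T" if "z \<in> D" for z
    using dbar[OF that T(1)] hT by (simp add: stem_dbar_def Jop_def)
  have CR2: "stem_partial h \<i> F z T = - stem_partial h 1 F z (insert h T)" if "z \<in> D" for z
  proof -
    have sd: "sym_diff (insert h T) {h} = T" using hT by auto
    have "T \<inter> {h} = {}" using hT by auto
    then show ?thesis using dbar[OF that T(2)] unfolding stem_dbar_def Jop_def sd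
      by (simp add: eq_neg_iff_add_eq_0 add.commute)
  qed
  define P where "P w = Complex (inner (stem_partial h 1 F (z(h := w)) T) b)
      (inner (stem_partial h 1 F (z(h := w)) (insert h T)) b)" for w
  show "(\<lambda>w. pair_fun h T ?u (z(h := w))) holomorphic_on ?E"
  proof (rule holomorphic_from_partials[OF oE])
    have c: "continuous_on ?E (\<lambda>w. stem_partial h 1 F (z(h := w)) K)" if "K \<subseteq> {1..n}" for K
      by (rule continuous_on_compose2[OF pc[OF that] continuous_on_fun_upd]) auto
    show "continuous_on ?E P" unfolding P_def
      by (intro continuous_on_Complex continuous_intros c T)
  next
    fix w assume w: "w \<in> ?E"
    let ?z = "z(h := w)"
    have "((\<lambda>t. inner (F (?z(h := ?z h + t *\<^sub>R 1)) K) b) has_vector_derivative inner (stem_partial h 1 F ?z K) b) (at 0)"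
      if "K \<subseteq> {1..n}" for K
      by (rule bounded_linear.has_vector_derivative[OF bounded_linear_inner_left der]) (use w that in auto)
    then have dK: "((\<lambda>t. inner (F (z(h := w + of_real t)) K) b) has_vector_derivative inner (stem_partial h 1 F ?z K) b) (at 0)"
      if "K \<subseteq> {1..n}" for K using that by (simp add: scaleR_conv_of_real)
    show "((\<lambda>t. pair_fun h T ?u (z(h := w + of_real t))) has_vector_derivative P w) (at 0)"
      unfolding pair_fun_def P_def has_vector_derivative_complex_iff
      using dK[OF T(1)] dK[OF T(2)]
      by (simp add: has_real_derivative_iff_has_vector_derivative)
    have "((\<lambda>t. inner (F (?z(h := ?z h + t *\<^sub>R \<i>)) K) b) has_vector_derivative inner (stem_partial h \<i> F ?z K) b) (at 0)"
      if "K \<subseteq> {1..n}" for K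
      by (rule bounded_linear.has_vector_derivative[OF bounded_linear_inner_left der]) (use w that in auto)
    then have dK: "((\<lambda>t. inner (F (z(h := w + \<i> * of_real t)) K) b) has_vector_derivative inner (stem_partial h \<i> F ?z K) b) (at 0)"
      if "K \<subseteq> {1..n}" for K using that by (simp add: scaleR_conv_of_real mult.commute)
    show "((\<lambda>t. pair_fun h T ?u (z(h := w + \<i> * of_real t))) has_vector_derivative \<i> * P w) (at 0)"
      unfolding pair_fun_def P_def has_vector_derivative_complex_iff
      using dK[OF T(1)] dK[OF T(2)] w
      by (simp add: has_real_derivative_iff_has_vector_derivative CR1 CR2)
  qed
qed

section \<open>Second derivatives along lines\<close>

lemma has_second_derivative_cong:
  assumes "has_second_derivative \<phi> d t" "\<forall>\<^sub>F s in nhds t. \<phi> s = \<psi> s"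
  shows "has_second_derivative \<psi> d t"
proof -
  obtain \<phi>' where p: "\<forall>\<^sub>F s in nhds t. (\<phi> has_vector_derivative \<phi>' s) (at s)"
    "(\<phi>' has_vector_derivative d) (at t)"
    using assms(1) unfolding has_second_derivative_def by blast
  have "\<forall>\<^sub>F s in nhds t. \<forall>\<^sub>F r in nhds s. \<phi> r = \<psi> r"
    using assms(2) by (simp add: eventually_eventually)
  with p(1) have "\<forall>\<^sub>F s in nhds t. (\<psi> has_vector_derivative \<phi>' s) (at s)"
  proof eventually_elim
    case (elim s)
    have "\<phi> s = \<psi> s" using eventually_nhds_x_imp_x[OF elim(2)] .
    then show ?case
      using has_vector_derivative_cong_ev[where f=\<phi> and g=\<psi> and x=s and S=UNIV] elim by simp
  qed
  with p(2) show ?thesis unfolding has_second_derivative_def by blast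
qed

lemma has_second_derivative_linear:
  assumes "bounded_linear L" "has_second_derivative \<phi> d t"
  shows "has_second_derivative (\<lambda>s. L (\<phi> s)) (L d) t"
proof -
  obtain \<phi>' where p: "\<forall>\<^sub>F s in nhds t. (\<phi> has_vector_derivative \<phi>' s) (at s)"
    "(\<phi>' has_vector_derivative d) (at t)"
    using assms(2) unfolding has_second_derivative_def by blast
  have "\<forall>\<^sub>F s in nhds t. ((\<lambda>s. L (\<phi> s)) has_vector_derivative L (\<phi>' s)) (at s)"
    using p(1) by eventually_elim (rule bounded_linear.has_vector_derivative[OF assms(1)])
  moreover have "((\<lambda>s. L (\<phi>' s)) has_vector_derivative L d) (at t)"
    by (rule bounded_linear.has_vector_derivative[OF assms(1) p(2)])
  ultimately show ?thesis unfolding has_second_derivative_def by (intro exI conjI)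
qed

lemma has_second_derivative_sum:
  assumes "\<And>i. i \<in> I \<Longrightarrow> has_second_derivative (\<phi> i) (d i) t" "finite I"
  shows "has_second_derivative (\<lambda>s. \<Sum>i\<in>I. \<phi> i s) (\<Sum>i\<in>I. d i) t"
proof -
  have "\<forall>i\<in>I. \<exists>\<phi>'. (\<forall>\<^sub>F s in nhds t. (\<phi> i has_vector_derivative \<phi>' s) (at s)) \<and> (\<phi>' has_vector_derivative d i) (at t)"
    using assms(1) unfolding has_second_derivative_def by blast
  then obtain \<phi>' where p: "\<And>i. i \<in> I \<Longrightarrow> \<forall>\<^sub>F s in nhds t. (\<phi> i has_vector_derivative \<phi>' i s) (at s)"
    "\<And>i. i \<in> I \<Longrightarrow> (\<phi>' i has_vector_derivative d i) (at t)"
    by metis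
  have "\<forall>\<^sub>F s in nhds t. \<forall>i\<in>I. (\<phi> i has_vector_derivative \<phi>' i s) (at s)"
    using p(1) assms(2) by (simp add: eventually_ball_finite)
  then have "\<forall>\<^sub>F s in nhds t. ((\<lambda>s. \<Sum>i\<in>I. \<phi> i s) has_vector_derivative (\<Sum>i\<in>I. \<phi>' i s)) (at s)"
    by eventually_elim (intro has_vector_derivative_sum, simp)
  moreover have "((\<lambda>s. \<Sum>i\<in>I. \<phi>' i s) has_vector_derivative (\<Sum>i\<in>I. d i)) (at t)"
    by (intro has_vector_derivative_sum p(2))
  ultimately show ?thesis unfolding has_second_derivative_def by (intro exI conjI)
qed

lemma has_second_derivative_holomorphic_line:
  assumes E: "open E" and hol: "\<phi> holomorphic_on E" and w0: "w0 \<in> E"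
  shows "has_second_derivative (\<lambda>t. \<phi> (w0 + of_real t * c)) (c\<^sup>2 * deriv (deriv \<phi>) w0) 0"
  unfolding has_second_derivative_def
proof (intro exI conjI)
  have cl: "continuous_on UNIV (\<lambda>t::real. w0 + of_real t * c)" by (intro continuous_intros)
  have line: "((\<lambda>t::real. w0 + of_real t * c) has_vector_derivative c) (at s)" for s
    by (auto intro!: derivative_eq_intros)
  have ch: "((\<lambda>t. g (w0 + of_real t * c)) has_vector_derivative c * deriv g (w0 + of_real s * c)) (at s)"
    if "g holomorphic_on E" "w0 + of_real s * c \<in> E" for g s
    using field_vector_diff_chain_at[OF line[of s], of g] holomorphic_derivI[OF that(1) E that(2)]
    by (simp add: o_def)
  have "open ((\<lambda>t::real. w0 + of_real t * c) -` E)" by (rule open_vimage[OF E cl])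
  then have "\<forall>\<^sub>F s in nhds 0. s \<in> (\<lambda>t::real. w0 + of_real t * c) -` E"
    by (rule eventually_nhds_in_open) (use w0 in simp)
  then show "\<forall>\<^sub>F s in nhds 0. ((\<lambda>t. \<phi> (w0 + of_real t * c)) has_vector_derivative c * deriv \<phi> (w0 + of_real s * c)) (at s)"
    by eventually_elim (simp add: ch[OF hol])
  have "((\<lambda>t. deriv \<phi> (w0 + of_real t * c)) has_vector_derivative c * deriv (deriv \<phi>) (w0 + of_real 0 * c)) (at 0)"
    by (rule ch[OF holomorphic_deriv[OF hol E]]) (use w0 in simp)
  then have "((\<lambda>t. c * deriv \<phi> (w0 + of_real t * c)) has_vector_derivative c * (c * deriv (deriv \<phi>) w0)) (at 0)"
    by (intro has_vector_derivative_mult_right) simp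
  then show "((\<lambda>t. c * deriv \<phi> (w0 + of_real t * c)) has_vector_derivative c\<^sup>2 * deriv (deriv \<phi>) w0) (at 0)"
    by (simp add: power2_eq_square mult.assoc)
qed

lemma has_second_derivative_compose:
  fixes \<psi> :: "real \<Rightarrow> real" and \<rho> :: "real \<Rightarrow> real"
  assumes \<psi>: "\<forall>\<^sub>F s in nhds (\<rho> t). (\<psi> has_real_derivative \<psi>1 s) (at s)"
    "(\<psi>1 has_real_derivative d\<psi>) (at (\<rho> t))"
    and \<rho>: "\<forall>\<^sub>F s in nhds t. (\<rho> has_real_derivative \<rho>1 s) (at s)"
    "(\<rho>1 has_real_derivative d\<rho>) (at t)"
  shows "has_second_derivative (\<lambda>s. \<psi> (\<rho> s)) (d\<psi> * (\<rho>1 t)\<^sup>2 + \<psi>1 (\<rho> t) * d\<rho>) t"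
  unfolding has_second_derivative_def has_real_derivative_iff_has_vector_derivative[symmetric]
proof (intro exI conjI)
  have r0: "(\<rho> has_real_derivative \<rho>1 t) (at t)" by (rule eventually_nhds_x_imp_x[OF \<rho>(1)])
  then have "isCont \<rho> t" by (rule DERIV_isCont)
  then have "filterlim \<rho> (nhds (\<rho> t)) (nhds t)" by (simp add: isCont_def tendsto_at_iff_tendsto_nhds)
  with \<psi>(1) have "\<forall>\<^sub>F s in nhds t. (\<psi> has_real_derivative \<psi>1 (\<rho> s)) (at (\<rho> s))"
    by (rule eventually_compose_filterlim)
  with \<rho>(1) show "\<forall>\<^sub>F s in nhds t. ((\<lambda>s. \<psi> (\<rho> s)) has_real_derivative \<psi>1 (\<rho> s) * \<rho>1 s) (at s)"
    by eventually_elim (rule DERIV_chain2)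
  have "((\<lambda>s. \<psi>1 (\<rho> s) * \<rho>1 s) has_real_derivative (d\<psi> * \<rho>1 t) * \<rho>1 t + d\<rho> * \<psi>1 (\<rho> t)) (at t)"
    by (rule DERIV_mult[OF DERIV_chain2[OF \<psi>(2) r0] \<rho>(2)])
  then show "((\<lambda>s. \<psi>1 (\<rho> s) * \<rho>1 s) has_real_derivative d\<psi> * (\<rho>1 t)\<^sup>2 + \<psi>1 (\<rho> t) * d\<rho>) (at t)"
    by (simp add: power2_eq_square algebra_simps)
qed


section \<open>Harmonic functions of one quaternionic variable\<close>

text \<open>
The analogue of \<open>has_laplacian\<close> with value zero for functions of a single quaternion.
\<close>

definition harmonic_at :: "(quat \<Rightarrow> 'a::real_normed_vector) \<Rightarrow> quat \<Rightarrow> bool" where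
  "harmonic_at N q \<longleftrightarrow> (\<exists>d. (\<forall>b\<in>Basis. has_second_derivative (\<lambda>t. N (q + t *\<^sub>R b)) (d b) 0) \<and>
     (\<Sum>b\<in>Basis. d b) = 0)"

lemma quat_basis_distinct:
  "1 \<noteq> quat_i" "1 \<noteq> quat_j" "1 \<noteq> quat_k" "quat_i \<noteq> quat_j" "quat_i \<noteq> quat_k" "quat_j \<noteq> quat_k"
  by (simp_all add: quat_eq_iff)

lemma sum_Basis_quat: "(\<Sum>b\<in>Basis. d b) = d 1 + d quat_i + d quat_j + d quat_k"
  for d :: "quat \<Rightarrow> 'a::comm_monoid_add"
  using quat_basis_distinct by (simp add: Basis_quat_def add.assoc)

lemma has_second_derivative_Re_line:
  assumes E: "open E" and hol: "\<phi> holomorphic_on E" and w0: "w0 \<in> E"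
    and eq: "\<And>t::real. w0 + of_real t * c \<in> E \<Longrightarrow> \<psi> t = Re (\<phi> (w0 + of_real t * c))"
  shows "has_second_derivative \<psi> (Re (c\<^sup>2 * deriv (deriv \<phi>) w0)) 0"
proof (rule has_second_derivative_cong)
  show "has_second_derivative (\<lambda>t. Re (\<phi> (w0 + of_real t * c))) (Re (c\<^sup>2 * deriv (deriv \<phi>) w0)) 0"
    by (rule has_second_derivative_linear[OF bounded_linear_Re
          has_second_derivative_holomorphic_line[OF E hol w0]])
  have "open ((\<lambda>t::real. w0 + of_real t * c) -` E)"
    by (rule open_vimage[OF E]) (intro continuous_intros)
  then have "\<forall>\<^sub>F s in nhds 0. s \<in> (\<lambda>t::real. w0 + of_real t * c) -` E"
    by (rule eventually_nhds_in_open) (use w0 in simp)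
  then show "\<forall>\<^sub>F t in nhds 0. Re (\<phi> (w0 + of_real t * c)) = \<psi> t"
    by eventually_elim (simp add: eq)
qed

text \<open>
Differentiating \<open>\<Phi> w = \<Phi> a + (w - a) Q w\<close> three times at \<open>a\<close> leaves one term of Leibniz'
rule.
\<close>

lemma third_derivative_quotient:
  assumes E: "open E" and \<Phi>: "\<Phi> holomorphic_on E" and a: "a \<in> E"
  defines "Q \<equiv> (\<lambda>w. if w = a then deriv \<Phi> a else (\<Phi> w - \<Phi> a) / (w - a))"
  shows "Q holomorphic_on E" "deriv (deriv (deriv \<Phi>)) a = 3 * deriv (deriv Q) a"
proof -
  show Q: "Q holomorphic_on E" unfolding Q_def by (rule pole_lemma_open[OF \<Phi> E])
  have "(deriv ^^ 3) \<Phi> a = (deriv ^^ 3) (\<lambda>w. \<Phi> a + (w - a) * Q w) a"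
  proof (rule higher_deriv_transform_within_open[OF \<Phi> _ E a])
    show "(\<lambda>w. \<Phi> a + (w - a) * Q w) holomorphic_on E" by (intro holomorphic_intros Q)
  qed (simp add: Q_def)
  also have "\<dots> = (deriv ^^ 3) (\<lambda>w. \<Phi> a) a + (deriv ^^ 3) (\<lambda>w. (w - a) * Q w) a"
    by (rule higher_deriv_add[OF _ _ E a]) (intro holomorphic_intros Q)+
  also have "(deriv ^^ 3) (\<lambda>w. (w - a) * Q w) a = (\<Sum>i=0..3. of_nat (3 choose i) *
      (deriv ^^ i) (\<lambda>w. w - a) a * (deriv ^^ (3 - i)) Q a)"
    by (rule higher_deriv_mult[OF _ Q E a]) (intro holomorphic_intros)
  also have "\<dots> = 3 * (deriv ^^ 2) Q a"
  proof -
    have "(deriv ^^ i) (\<lambda>w. w - a) a = (if i = 1 then 1 else 0)" for i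
      by (simp add: higher_deriv_diff[where S=UNIV])
    then have "(\<Sum>i=0..3. of_nat (3 choose i) * (deriv ^^ i) (\<lambda>w. w - a) a * (deriv ^^ (3 - i)) Q a)
      = (\<Sum>i=0..3. if i = 1 then of_nat (3 choose i) * (deriv ^^ (3 - i)) Q a else 0)"
      by (intro sum.cong) auto
    then show ?thesis by (simp add: numeral_2_eq_2)
  qed
  finally show "deriv (deriv (deriv \<Phi>)) a = 3 * deriv (deriv Q) a"
    by (simp add: eval_nat_numeral)
qed

text \<open>
Along the real direction the function is the real part of \<open>deriv \<Phi>\<close>. Along each of the three
imaginary directions it is \<open>Re (Q (a + \<i> t))\<close>, where \<open>Q\<close> is the difference quotient of \<open>\<Phi>\<close> at
\<open>a\<close>; its second derivative is the negative of the real part of the second derivative of \<open>Q\<close>. The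
four terms cancel by \<open>third_derivative_quotient\<close>.
\<close>

lemma harmonic_at_real_point:
  assumes E: "open E" and \<Phi>: "\<Phi> holomorphic_on E"
    and sym: "\<And>w. w \<in> E \<Longrightarrow> cnj w \<in> E" "\<And>w. w \<in> E \<Longrightarrow> \<Phi> (cnj w) = cnj (\<Phi> w)"
    and N1: "\<And>w. w \<in> E \<Longrightarrow> Im w \<noteq> 0 \<Longrightarrow> N w = Im (\<Phi> w) / Im w"
    and N2: "\<And>w. w \<in> E \<Longrightarrow> Im w = 0 \<Longrightarrow> N w = Re (deriv \<Phi> w)"
    and q: "profile q \<in> E" "im_norm q = 0"
  shows "harmonic_at (\<lambda>q. N (profile q)) q"
proof -
  define a where "a = complex_of_real (qRe q)"
  have qc: "qIm1 q = 0" "qIm2 q = 0" "qIm3 q = 0" using q(2) by (simp_all add: im_norm_0_iff)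
  have aq: "profile q = a" using q(2) by (simp add: profile_def a_def complex_eq_iff)
  then have aE: "a \<in> E" using q(1) by simp
  have ca: "cnj a = a" by (simp add: a_def)
  have \<Phi>a: "Im (\<Phi> a) = 0" using sym(2)[OF aE] by (simp add: ca complex_eq_iff)
  define Q where "Q = (\<lambda>w. if w = a then deriv \<Phi> a else (\<Phi> w - \<Phi> a) / (w - a))"
  have Q: "Q holomorphic_on E" and Q3: "deriv (deriv (deriv \<Phi>)) a = 3 * deriv (deriv Q) a"
    unfolding Q_def using third_derivative_quotient[OF E \<Phi> aE] by auto
  have re: "has_second_derivative (\<lambda>t. N (profile (q + t *\<^sub>R 1))) (Re (1\<^sup>2 * deriv (deriv (deriv \<Phi>)) a)) 0"
  proof (rule has_second_derivative_Re_line[OF E holomorphic_deriv[OF \<Phi> E] aE])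
    fix t :: real assume t: "a + of_real t * 1 \<in> E"
    have "profile (q + t *\<^sub>R 1) = a + of_real t * 1"
      by (simp add: profile_def a_def complex_eq_iff im_norm_def qc)
    then show "N (profile (q + t *\<^sub>R 1)) = Re (deriv \<Phi> (a + of_real t * 1))"
      using N2[OF t] by (simp add: a_def)
  qed
  have im: "has_second_derivative (\<lambda>t. N (profile (q + t *\<^sub>R b))) (Re (\<i>\<^sup>2 * deriv (deriv Q) a)) 0"
    if b: "b \<in> {quat_i, quat_j, quat_k}" for b
  proof (rule has_second_derivative_Re_line[OF E Q aE])
    fix t :: real assume t: "a + of_real t * \<i> \<in> E"
    have p: "profile (q + t *\<^sub>R b) = Complex (qRe q) \<bar>t\<bar>"
      using b qc by (auto simp: profile_def im_norm_def)
    show "N (profile (q + t *\<^sub>R b)) = Re (Q (a + of_real t * \<i>))"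
    proof (cases "t = 0")
      case True
      have "Complex (qRe q) 0 = a" by (simp add: a_def complex_eq_iff)
      with True show ?thesis using N2[OF aE] p by (simp add: Q_def a_def)
    next
      case False
      let ?w = "a + of_real t * \<i>"
      have w: "Complex (qRe q) \<bar>t\<bar> = (if t > 0 then ?w else cnj ?w)"
        by (simp add: a_def complex_eq_iff)
      then have "Complex (qRe q) \<bar>t\<bar> \<in> E" using t sym(1)[OF t] by simp
      then have "N (Complex (qRe q) \<bar>t\<bar>) = Im (\<Phi> (Complex (qRe q) \<bar>t\<bar>)) / \<bar>t\<bar>"
        using N1 False by simp
      also have "\<dots> = Im (\<Phi> ?w) / t" unfolding w using sym(2)[OF t] False by simp
      also have "\<dots> = Re ((\<Phi> ?w - \<Phi> a) / (of_real t * \<i>))"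
      proof -
        have "(\<Phi> ?w - \<Phi> a) / (of_real t * \<i>) = (- \<i> * (\<Phi> ?w - \<Phi> a)) / of_real t"
          using False by (simp add: field_simps)
        then show ?thesis using \<Phi>a by (simp only: Re_divide_of_real) simp
      qed
      also have "\<dots> = Re (Q ?w)" using False by (simp add: Q_def)
      finally show ?thesis using p by simp
    qed
  qed
  show ?thesis unfolding harmonic_at_def
  proof (intro exI[of _ "\<lambda>b. if b = 1 then Re (deriv (deriv (deriv \<Phi>)) a) else - Re (deriv (deriv Q) a)"] conjI ballI)
    fix b :: quat assume "b \<in> Basis"
    then have "b = 1 \<or> b \<noteq> 1 \<and> b \<in> {quat_i, quat_j, quat_k}"
      using quat_basis_distinct by (auto simp: Basis_quat_def)
    then show "has_second_derivative (\<lambda>t. N (profile (q + t *\<^sub>R b)))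
      (if b = 1 then Re (deriv (deriv (deriv \<Phi>)) a) else - Re (deriv (deriv Q) a)) 0"
      using re im[of b] by auto
  qed (use quat_basis_distinct in \<open>simp add: sum_Basis_quat Q3\<close>)
qed

text \<open>
With \<open>\<psi> s = Im \<Phi>(\<alpha> + \<i> s) / s\<close>, the function along an imaginary direction is \<open>\<psi> (\<rho> t)\<close>,
\<open>\<rho> t\<close> being the norm of the imaginary part. The chain rule gives
\<open>\<psi>'' (p / \<beta>)\<^sup>2 + \<psi>' (1 / \<beta> - p\<^sup>2 / \<beta> ^ 3)\<close>, where \<open>p\<close> is the coordinate of the point in that
direction. As the squares of the three \<open>p\<close> sum to \<open>\<beta>\<^sup>2\<close>, the imaginary directions contribute
\<open>\<psi>'' + 2 \<psi>' / \<beta> = - Im \<Phi>'' / \<beta>\<close>, which cancels the contribution of the real direction.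
\<close>

lemma harmonic_at_nonreal_point:
  assumes E: "open E" and \<Phi>: "\<Phi> holomorphic_on E"
    and N1: "\<And>w. w \<in> E \<Longrightarrow> Im w \<noteq> 0 \<Longrightarrow> N w = Im (\<Phi> w) / Im w"
    and q: "profile q \<in> E" "im_norm q \<noteq> 0"
  shows "harmonic_at (\<lambda>q. N (profile q)) q"
proof -
  define \<alpha> where "\<alpha> = qRe q"
  define \<beta> where "\<beta> = im_norm q"
  have \<beta>: "\<beta> > 0" using q(2) im_norm_nonneg[of q] by (simp add: \<beta>_def)
  define w0 where "w0 = Complex \<alpha> \<beta>"
  have w0: "w0 \<in> E" using q(1) by (simp add: w0_def profile_def \<alpha>_def \<beta>_def)
  have re: "has_second_derivative (\<lambda>t. N (profile (q + t *\<^sub>R 1))) (Im (deriv (deriv \<Phi>) w0) / \<beta>) 0"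
  proof -
    \<comment> \<open>\<open>Im c / \<beta>\<close> is the real part of \<open>(- \<i> / \<beta>) c\<close>\<close>
    let ?g = "\<lambda>w. - \<i> / of_real \<beta> * \<Phi> w"
    have h: "?g holomorphic_on E" by (intro holomorphic_intros \<Phi>) (use \<beta> in auto)
    have d1: "deriv ?g w = - \<i> / of_real \<beta> * deriv \<Phi> w" if "w \<in> E" for w
      by (rule deriv_cmult[OF holomorphic_on_imp_differentiable_at[OF \<Phi> E that]])
    have "deriv (deriv ?g) w0 = deriv (\<lambda>w. - \<i> / of_real \<beta> * deriv \<Phi> w) w0"
      by (rule complex_derivative_transform_within_open[OF holomorphic_deriv[OF h E] _ E w0 d1])
         (intro holomorphic_intros holomorphic_deriv[OF \<Phi> E] E, use \<beta> in auto)
    also have "\<dots> = - \<i> / of_real \<beta> * deriv (deriv \<Phi>) w0"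
      by (rule deriv_cmult[OF holomorphic_on_imp_differentiable_at[OF holomorphic_deriv[OF \<Phi> E] E w0]])
    finally have d2: "deriv (deriv ?g) w0 = - \<i> / of_real \<beta> * deriv (deriv \<Phi>) w0" .
    have im: "Re (- \<i> / of_real \<beta> * c) = Im c / \<beta>" for c
    proof -
      have "- \<i> / of_real \<beta> * c = (- \<i> * c) / of_real \<beta>" by simp
      then show ?thesis by (simp only: Re_divide_of_real) simp
    qed
    have "has_second_derivative (\<lambda>t. N (profile (q + t *\<^sub>R 1)))
       (Re (1\<^sup>2 * deriv (deriv ?g) w0)) 0"
    proof (rule has_second_derivative_Re_line[OF E h w0])
      fix t :: real assume t: "w0 + of_real t * 1 \<in> E"
      have "profile (q + t *\<^sub>R 1) = w0 + of_real t * 1"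
        by (simp add: profile_def w0_def \<alpha>_def \<beta>_def complex_eq_iff im_norm_def)
      then show "N (profile (q + t *\<^sub>R 1)) = Re (- \<i> / of_real \<beta> * \<Phi> (w0 + of_real t * 1))"
        using N1[OF t] \<beta> unfolding im by (simp add: w0_def)
    qed
    then show ?thesis unfolding d2 by (simp only: power_one mult_1_left im)
  qed
  define \<psi> where "\<psi> s = Im (\<Phi> (Complex \<alpha> s)) / s" for s
  define \<psi>1 where "\<psi>1 s = (s * Re (deriv \<Phi> (Complex \<alpha> s)) - Im (\<Phi> (Complex \<alpha> s))) / s\<^sup>2" for s
  \<comment> \<open>the derivative of \<open>\<psi>1\<close> at \<open>\<beta>\<close>, written so that \<open>\<psi>2 + 2 * \<psi>1 \<beta> / \<beta>\<close> is visible\<close>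
  define \<psi>2 where "\<psi>2 = - Im (deriv (deriv \<Phi>) w0) / \<beta> - 2 * \<psi>1 \<beta> / \<beta>"
  have line: "((\<lambda>s. Complex \<alpha> s) has_vector_derivative \<i>) (at s)" for s
    unfolding Complex_eq by (auto intro!: derivative_eq_intros)
  have ch: "((\<lambda>s. g (Complex \<alpha> s)) has_vector_derivative \<i> * deriv g (Complex \<alpha> s)) (at s)"
    if "g holomorphic_on E" "Complex \<alpha> s \<in> E" for g s
    using field_vector_diff_chain_at[OF line[of s], of g] holomorphic_derivI[OF that(1) E that(2)]
    by (simp add: o_def)
  have chRI: "((\<lambda>s. Re (g (Complex \<alpha> s))) has_real_derivative - Im (deriv g (Complex \<alpha> s))) (at s)"
     "((\<lambda>s. Im (g (Complex \<alpha> s))) has_real_derivative Re (deriv g (Complex \<alpha> s))) (at s)"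
    if "g holomorphic_on E" "Complex \<alpha> s \<in> E" for g s
    using ch[OF that] unfolding has_vector_derivative_complex_iff by simp_all
  have \<psi>1: "(\<psi> has_real_derivative \<psi>1 s) (at s)" if "Complex \<alpha> s \<in> E" "s > 0" for s
  proof -
    have "((\<lambda>s. Im (\<Phi> (Complex \<alpha> s)) / s) has_real_derivative
      (Re (deriv \<Phi> (Complex \<alpha> s)) * s - Im (\<Phi> (Complex \<alpha> s)) * 1) / (s * s)) (at s)"
      using that by (intro DERIV_divide chRI[OF \<Phi>] DERIV_ident) auto
    then show ?thesis unfolding \<psi>_def[abs_def] \<psi>1_def by (simp add: power2_eq_square mult.commute)
  qed
  have \<psi>2: "(\<psi>1 has_real_derivative \<psi>2) (at \<beta>)"
  proof -
    have w: "Complex \<alpha> \<beta> \<in> E" using w0 by (simp add: w0_def)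
    let ?r = "Re (deriv \<Phi> (Complex \<alpha> \<beta>))" and ?i = "Im (deriv (deriv \<Phi>) (Complex \<alpha> \<beta>))"
    let ?q = "(((1 * ?r + (- ?i) * \<beta>) - ?r) * \<beta>\<^sup>2
        - (\<beta> * ?r - Im (\<Phi> (Complex \<alpha> \<beta>))) * (2 * \<beta>)) / (\<beta>\<^sup>2 * \<beta>\<^sup>2)"
    have "((\<lambda>s. s * Re (deriv \<Phi> (Complex \<alpha> s)) - Im (\<Phi> (Complex \<alpha> s))) has_real_derivative
      (1 * ?r + (- ?i) * \<beta>) - ?r) (at \<beta>)"
      by (intro DERIV_diff DERIV_mult DERIV_ident chRI[OF \<Phi> w] chRI[OF holomorphic_deriv[OF \<Phi> E] w])
    moreover have "((\<lambda>s::real. s\<^sup>2) has_real_derivative 2 * \<beta>) (at \<beta>)"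
      by (auto intro!: derivative_eq_intros)
    ultimately have "(\<psi>1 has_real_derivative
      ?q) (at \<beta>)"
      unfolding \<psi>1_def[abs_def] using \<beta> by (intro DERIV_divide) auto
    moreover have "?q = \<psi>2"
      using \<beta> by (simp add: \<psi>2_def \<psi>1_def w0_def power2_eq_square divide_simps) (simp add: algebra_simps)
    ultimately show ?thesis by simp
  qed
  have evE: "\<forall>\<^sub>F s in nhds \<beta>. Complex \<alpha> s \<in> E \<and> s > 0"
  proof -
    have "open ((\<lambda>s. Complex \<alpha> s) -` E \<inter> {0<..})"
      by (intro open_Int open_vimage[OF E] continuous_on_Complex continuous_intros)
    then have "\<forall>\<^sub>F s in nhds \<beta>. s \<in> (\<lambda>s. Complex \<alpha> s) -` E \<inter> {0<..}"
      by (rule eventually_nhds_in_open) (use w0 \<beta> in \<open>auto simp: w0_def\<close>)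
    then show ?thesis by eventually_elim auto
  qed
  define D where "D p = \<psi>2 * (p / \<beta>)\<^sup>2 + \<psi>1 \<beta> * (1 / \<beta> - p\<^sup>2 / \<beta> ^ 3)" for p
  have im: "has_second_derivative (\<lambda>t. N (profile (q + t *\<^sub>R b))) (D p) 0"
    if b: "\<And>t. qRe (q + t *\<^sub>R b) = \<alpha>" "\<And>t. (im_norm (q + t *\<^sub>R b))\<^sup>2 = \<beta>\<^sup>2 + 2 * p * t + t\<^sup>2" for b p
  proof -
    define R where "R t = \<beta>\<^sup>2 + 2 * p * t + t\<^sup>2" for t
    define \<rho> where "\<rho> t = im_norm (q + t *\<^sub>R b)" for t
    define \<rho>1 where "\<rho>1 t = (p + t) / \<rho> t" for t
    have \<rho>s: "\<rho> t = sqrt (R t)" for t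
      using b(2)[of t] im_norm_nonneg[of "q + t *\<^sub>R b"] by (simp add: \<rho>_def R_def flip: b(2))
    have \<rho>0: "\<rho> 0 = \<beta>" by (simp add: \<rho>_def \<beta>_def)
    have \<rho>1: "(\<rho> has_real_derivative \<rho>1 t) (at t)" if "R t > 0" for t
    proof -
      have "(R has_real_derivative 2 * p + 2 * t) (at t)"
        unfolding R_def[abs_def] by (auto intro!: derivative_eq_intros)
      then have "((\<lambda>t. sqrt (R t)) has_real_derivative inverse (sqrt (R t)) / 2 * (2 * p + 2 * t)) (at t)"
        using that by (intro DERIV_chain2[OF DERIV_real_sqrt]) auto
      moreover have "inverse (sqrt (R t)) / 2 * (2 * p + 2 * t) = \<rho>1 t"
        unfolding \<rho>1_def \<rho>s by (simp add: divide_simps)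
      moreover have "\<rho> = (\<lambda>t. sqrt (R t))" by (rule ext) (rule \<rho>s)
      ultimately show ?thesis by (simp only:)
    qed
    have R0: "R 0 > 0" using \<beta> by (simp add: R_def)
    have \<rho>2: "(\<rho>1 has_real_derivative (1 / \<beta> - p\<^sup>2 / \<beta> ^ 3)) (at 0)"
      unfolding \<rho>1_def[abs_def] using \<beta>
      by (auto intro!: derivative_eq_intros \<rho>1 R0 simp: \<rho>0 \<rho>1_def)
         (simp add: power2_eq_square power3_eq_cube field_simps)
    have evR: "\<forall>\<^sub>F t in nhds 0. R t > 0"
    proof -
      have "open {t. R t > 0}" unfolding R_def by (intro open_Collect_less continuous_intros)
      then have "\<forall>\<^sub>F t in nhds 0. t \<in> {t. R t > 0}" by (rule eventually_nhds_in_open) (use R0 in simp)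
      then show ?thesis by simp
    qed
    have "has_second_derivative (\<lambda>s. \<psi> (\<rho> s)) (\<psi>2 * (\<rho>1 0)\<^sup>2 + \<psi>1 (\<rho> 0) * (1 / \<beta> - p\<^sup>2 / \<beta> ^ 3)) 0"
    proof (rule has_second_derivative_compose)
      show "\<forall>\<^sub>F s in nhds (\<rho> 0). (\<psi> has_real_derivative \<psi>1 s) (at s)"
        unfolding \<rho>0 using evE by eventually_elim (simp add: \<psi>1)
      show "\<forall>\<^sub>F s in nhds 0. (\<rho> has_real_derivative \<rho>1 s) (at s)"
        using evR by eventually_elim (rule \<rho>1)
    qed (use \<psi>2 \<rho>2 \<rho>0 in auto)
    then have "has_second_derivative (\<lambda>s. \<psi> (\<rho> s)) (D p) 0" by (simp add: D_def \<rho>0 \<rho>1_def)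
    moreover have "\<forall>\<^sub>F s in nhds 0. \<psi> (\<rho> s) = N (profile (q + s *\<^sub>R b))"
    proof -
      have "isCont \<rho> 0" using \<rho>1[OF R0] by (rule DERIV_isCont)
      then have "filterlim \<rho> (nhds (\<rho> 0)) (nhds 0)"
        unfolding isCont_def tendsto_at_iff_tendsto_nhds .
      then have "filterlim \<rho> (nhds \<beta>) (nhds 0)" by (simp only: \<rho>0)
      with evE have "\<forall>\<^sub>F t in nhds 0. Complex \<alpha> (\<rho> t) \<in> E \<and> \<rho> t > 0"
        by (rule eventually_compose_filterlim)
      then show ?thesis
      proof eventually_elim
        case (elim t)
        have "profile (q + t *\<^sub>R b) = Complex \<alpha> (\<rho> t)"
          unfolding profile_def by (simp only: b(1) \<rho>_def)
        then show ?case using N1[of "Complex \<alpha> (\<rho> t)"] elim by (simp add: \<psi>_def)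
      qed
    qed
    ultimately show ?thesis by (rule has_second_derivative_cong)
  qed
  let ?d = "\<lambda>b. if b = 1 then Im (deriv (deriv \<Phi>) w0) / \<beta> else if b = quat_i then D (qIm1 q)
     else if b = quat_j then D (qIm2 q) else D (qIm3 q)"
  have b2: "\<beta>\<^sup>2 = (qIm1 q)\<^sup>2 + (qIm2 q)\<^sup>2 + (qIm3 q)\<^sup>2" by (simp add: \<beta>_def im_norm_sq)
  have i: "has_second_derivative (\<lambda>t. N (profile (q + t *\<^sub>R quat_i))) (D (qIm1 q)) 0"
    by (rule im) (simp_all add: \<alpha>_def im_norm_sq b2, simp add: power2_eq_square algebra_simps)
  have j: "has_second_derivative (\<lambda>t. N (profile (q + t *\<^sub>R quat_j))) (D (qIm2 q)) 0"
    by (rule im) (simp_all add: \<alpha>_def im_norm_sq b2, simp add: power2_eq_square algebra_simps)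
  have k: "has_second_derivative (\<lambda>t. N (profile (q + t *\<^sub>R quat_k))) (D (qIm3 q)) 0"
    by (rule im) (simp_all add: \<alpha>_def im_norm_sq b2, simp add: power2_eq_square algebra_simps)
  have "D (qIm1 q) + D (qIm2 q) + D (qIm3 q)
    = \<psi>2 * (((qIm1 q)\<^sup>2 + (qIm2 q)\<^sup>2 + (qIm3 q)\<^sup>2) / \<beta>\<^sup>2)
      + \<psi>1 \<beta> * (3 / \<beta> - ((qIm1 q)\<^sup>2 + (qIm2 q)\<^sup>2 + (qIm3 q)\<^sup>2) / \<beta> ^ 3)"
    by (simp add: D_def power_divide add_divide_distrib algebra_simps)
  also have "\<dots> = \<psi>2 + 2 * \<psi>1 \<beta> / \<beta>"
    unfolding b2[symmetric] using \<beta> by (simp add: power2_eq_square power3_eq_cube field_simps)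
  finally have sumD: "D (qIm1 q) + D (qIm2 q) + D (qIm3 q) = - Im (deriv (deriv \<Phi>) w0) / \<beta>"
    by (simp add: \<psi>2_def)
  show ?thesis unfolding harmonic_at_def
  proof (intro exI[of _ ?d] conjI ballI)
    fix b :: quat assume "b \<in> Basis"
    then show "has_second_derivative (\<lambda>t. N (profile (q + t *\<^sub>R b))) (?d b) 0"
      using re i j k quat_basis_distinct by (auto simp: Basis_quat_def)
  next
    show "(\<Sum>b\<in>Basis. ?d b) = 0"
      using quat_basis_distinct sumD by (simp add: sum_Basis_quat)
  qed
qed

section \<open>Continuity of slice functions and density of nonreal points\<close>

lemma continuous_on_quat_parts:
  assumes "continuous_on S g"
  shows "continuous_on S (\<lambda>x. qRe (g x))" "continuous_on S (\<lambda>x. qIm1 (g x))"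
    "continuous_on S (\<lambda>x. qIm2 (g x))" "continuous_on S (\<lambda>x. qIm3 (g x))"
proof -
  have "qRe q = inner q 1" "qIm1 q = inner q quat_i" "qIm2 q = inner q quat_j" "qIm3 q = inner q quat_k" for q
    by (simp_all add: inner_quat_def)
  then show "continuous_on S (\<lambda>x. qRe (g x))" "continuous_on S (\<lambda>x. qIm1 (g x))"
    "continuous_on S (\<lambda>x. qIm2 (g x))" "continuous_on S (\<lambda>x. qIm3 (g x))"
    by (simp_all add: continuous_on_inner assms)
qed

lemma continuous_on_im_norm: "continuous_on S g \<Longrightarrow> continuous_on S (\<lambda>x. im_norm (g x))"
  unfolding im_norm_def by (intro continuous_intros continuous_on_quat_parts)

lemma continuous_on_profile: "continuous_on S g \<Longrightarrow> continuous_on S (\<lambda>x. profile (g x))"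
  unfolding profile_def by (intro continuous_on_Complex continuous_on_im_norm continuous_on_quat_parts)

lemma continuous_on_profiles: "continuous_on S (profiles n)"
proof (rule continuous_on_coordinatewise_then_product)
  fix i
  have c: "continuous_on S (\<lambda>x::nat \<Rightarrow> quat. x i)"
    by (rule continuous_on_coordinate[OF continuous_on_id])
  show "continuous_on S (\<lambda>x. profiles n x i)"
    unfolding profiles_def
    by (cases "i \<in> {1..n}")
       (simp_all only: restrict_apply if_True if_False continuous_on_profile[OF c] continuous_on_const)
qed

lemma continuous_on_oprod:
  assumes "finite K" "\<And>k. k \<in> K \<Longrightarrow> continuous_on S (\<lambda>x. q x k)"
  shows "continuous_on S (\<lambda>x. oprod (q x) K)"
  using assms
proof (induction K rule: finite_linorder_min_induct)
  case (insert b K)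
  then show ?case by (simp add: oprod_insert_less continuous_on_mult)
qed simp

lemma continuous_on_im_unit:
  assumes "continuous_on S g" "\<And>x. x \<in> S \<Longrightarrow> im_norm (g x) \<noteq> 0"
  shows "continuous_on S (\<lambda>x. im_unit (g x))"
proof -
  have "continuous_on S (\<lambda>x. (g x - of_real (qRe (g x))) /\<^sub>R im_norm (g x))"
    by (intro continuous_intros continuous_on_im_norm continuous_on_quat_parts assms) (use assms(2) in auto)
  then show ?thesis by (rule continuous_on_eq) (use assms(2) in \<open>simp add: im_unit_def\<close>)
qed

text \<open>
Imaginary units cannot be chosen continuously at real quaternions. But if \<open>x\<^sub>h\<close> is real for some
\<open>h \<in> K\<close>, the component \<open>F\<^sub>K\<close> vanishes there, and multiplication by a product of units preserves
the norm, so the summand tends to zero.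
\<close>

lemma continuous_on_induced:
  assumes inv: "invariant n D" and G: "G \<in> stem_functions n D"
  shows "continuous_on (\<Omega> n D) (induced n D G)"
proof -
  let ?J = "\<lambda>x h. im_unit (x h)"
  have "continuous_on (\<Omega> n D) (\<lambda>x. oprod (?J x) K * G (profiles n x) K)" if K: "K \<subseteq> {1..n}" for K
    unfolding continuous_on_eq_continuous_within
  proof
    fix x0 assume x0: "x0 \<in> \<Omega> n D"
    have fK: "finite K" using K finite_subset by blast
    have pD: "profiles n ` \<Omega> n D \<subseteq> D" using circularization_iff[OF inv] by blast
    have cG: "continuous_on (\<Omega> n D) (\<lambda>x. G (profiles n x) K)"
      by (rule continuous_on_compose2[OF stem_continuous[OF G K] continuous_on_profiles pD])
    show "continuous (at x0 within \<Omega> n D) (\<lambda>x. oprod (?J x) K * G (profiles n x) K)"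
    proof (cases "\<exists>h\<in>K. im_norm (x0 h) = 0")
      case True
      then obtain h where h: "h \<in> K" "im_norm (x0 h) = 0" by blast
      have "profiles n x0 \<in> D" using pD x0 by blast
      then have z: "G (profiles n x0) K = 0"
        using h K by (intro stem_zero_of_real[OF G K _ h(1)]) (auto simp: profiles_def profile_def)
      have "((\<lambda>x. G (profiles n x) K) \<longlongrightarrow> 0) (at x0 within \<Omega> n D)"
        using cG[unfolded continuous_on_def, rule_format, OF x0] by (simp only: z)
      from tendsto_norm_zero[OF this]
      have lim: "((\<lambda>x. norm (G (profiles n x) K)) \<longlongrightarrow> 0) (at x0 within \<Omega> n D)" .
      have norm_eq: "norm (oprod (?J x) K * G (profiles n x) K) = norm (G (profiles n x) K)" for x
        by (simp only: norm_mult norm_oprod_units[OF fK im_unit_in] mult_1_left)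
      have "((\<lambda>x. oprod (?J x) K * G (profiles n x) K) \<longlongrightarrow> 0) (at x0 within \<Omega> n D)"
        by (rule tendsto_norm_zero_cancel) (simp only: norm_eq lim)
      then show ?thesis using z by (simp add: continuous_within)
    next
      case False
      define V where "V = (\<Inter>h\<in>K. {x::nat \<Rightarrow> quat. im_norm (x h) \<noteq> 0})"
      have cc: "continuous_on S (\<lambda>x::nat \<Rightarrow> quat. x h)" for S h
        by (rule continuous_on_coordinate[OF continuous_on_id])
      have "open V" unfolding V_def
        by (intro open_INT fK ballI open_Collect_neq continuous_on_const continuous_on_im_norm[OF cc])
      moreover have "x0 \<in> V" using False by (auto simp: V_def)
      moreover have "continuous_on (\<Omega> n D \<inter> V) (\<lambda>x. oprod (?J x) K * G (profiles n x) K)"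
      proof (rule continuous_on_mult)
        show "continuous_on (\<Omega> n D \<inter> V) (\<lambda>x. oprod (?J x) K)"
          by (rule continuous_on_oprod[OF fK], rule continuous_on_im_unit[OF cc]) (auto simp: V_def)
        show "continuous_on (\<Omega> n D \<inter> V) (\<lambda>x. G (profiles n x) K)"
          by (rule continuous_on_subset[OF cG]) auto
      qed
      ultimately show ?thesis using x0 by (intro continuous_within_nhd[of V])
    qed
  qed
  then have "continuous_on (\<Omega> n D) (\<lambda>x. slice_value n (?J x) (G (profiles n x)))"
    unfolding slice_value_def by (intro continuous_on_sum) auto
  then show ?thesis
    by (rule continuous_on_eq) (use induced_canonical[OF inv G] in simp)
qed

text \<open>
With the units kept fixed, the imaginary parts in \<open>M\<close>, which are nonnegative in the profile, are
raised by a small \<open>s > 0\<close> and become nonzero simultaneously.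
\<close>

lemma agree_from_nonreal_part:
  fixes f g :: "(nat \<Rightarrow> quat) \<Rightarrow> 'b::t2_space"
  assumes inv: "invariant n D" and D: "open_domain n D" and M: "M \<subseteq> {1..n}"
    and cont: "continuous_on (\<Omega> n D) f" "continuous_on (\<Omega> n D) g"
    and eq: "\<And>x. x \<in> \<Omega> n (nonreal_part D M) \<Longrightarrow> f x = g x" and x: "x \<in> \<Omega> n D"
  shows "f x = g x"
proof -
  define z where "z = profiles n x"
  let ?J = "\<lambda>h. im_unit (x h)"
  have zD: "z \<in> D" and xe: "x \<in> {1..n} \<rightarrow>\<^sub>E UNIV"
    using x circularization_iff[OF inv] by (auto simp: z_def)
  \<comment> \<open>a path that ends in \<open>z\<close> at \<open>s = 0\<close> and runs in the nonreal part for small \<open>s > 0\<close>\<close>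
  define zs where "zs s = (\<lambda>k. if k \<in> M then z k + \<i> * of_real s else z k)" for s :: real
  define p where "p s = slice_point n ?J (zs s)" for s
  have zs0: "zs 0 = z" by (simp add: zs_def fun_eq_iff)
  have p0: "p 0 = x" using slice_point_profiles[OF xe] by (simp add: p_def zs0 z_def)
  have czs: "continuous_on UNIV zs"
  proof (rule continuous_on_coordinatewise_then_product)
    fix i show "continuous_on UNIV (\<lambda>s. zs s i)"
      unfolding zs_def by (cases "i \<in> M"; simp; intro continuous_intros)
  qed
  have "open {s. zs s \<in> D}"
  proof (rule open_domain_vimage[OF D czs])
    fix s show "zs s \<in> {1..n} \<rightarrow>\<^sub>E UNIV"
      using domain_extensional[OF D zD] M by (auto simp: zs_def PiE_def extensional_def)
  qed
  then have "\<forall>\<^sub>F s in at_right 0. zs s \<in> D"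
    unfolding eventually_at_topological using zD zs0 by (intro exI[of _ "{s. zs s \<in> D}"]) auto
  moreover have "\<forall>\<^sub>F s in at_right (0::real). s > 0" by (simp add: eventually_at_right_less)
  ultimately have ev: "\<forall>\<^sub>F s in at_right 0. p s \<in> \<Omega> n (nonreal_part D M)"
  proof eventually_elim
    case (elim s)
    have "Im (zs s k) \<noteq> 0" if "k \<in> M" for k
    proof -
      have "Im (z k) \<ge> 0" using that M by (auto simp: z_def profiles_def Im_profile_nonneg)
      then show ?thesis using that elim(2) by (simp add: zs_def)
    qed
    then have "zs s \<in> nonreal_part D M" using elim(1) by (simp add: nonreal_part_def)
    then show ?case unfolding p_def circularization_def using im_unit_in by blast
  qed
  have evD: "\<forall>\<^sub>F s in at_right 0. p s \<in> \<Omega> n D"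
    using ev by eventually_elim (use circularization_mono[OF nonreal_part_subset] in blast)
  have "continuous_on UNIV p"
  proof (rule continuous_on_coordinatewise_then_product)
    fix i
    show "continuous_on UNIV (\<lambda>s. p s i)"
      unfolding p_def slice_point_def
      by (cases "i \<in> {1..n}"; simp only: restrict_apply if_True if_False;
          intro continuous_intros continuous_on_coordinate[OF czs])
  qed
  then have "(p \<longlongrightarrow> p 0) (at 0 within UNIV)" unfolding continuous_on_def by blast
  then have lim: "(p \<longlongrightarrow> x) (at_right 0)" unfolding p0 by (rule tendsto_within_subset[OF _ subset_UNIV])
  have lf: "((\<lambda>s. f (p s)) \<longlongrightarrow> f x) (at_right 0)" and lg: "((\<lambda>s. g (p s)) \<longlongrightarrow> g x) (at_right 0)"
    using continuous_on_tendsto_compose[OF cont(1) lim x evD]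
      continuous_on_tendsto_compose[OF cont(2) lim x evD] by auto
  have "\<forall>\<^sub>F s in at_right 0. f (p s) = g (p s)" using ev by eventually_elim (rule eq)
  then have "((\<lambda>s. g (p s)) \<longlongrightarrow> f x) (at_right 0)" using lf by (rule Lim_transform_eventually[rotated])
  then show ?thesis using lg tendsto_unique trivial_limit_at_right_real by blast
qed

section \<open>Harmonicity of the extended spherical components\<close>

lemma harmonic_at_linear:
  assumes "bounded_linear L" "harmonic_at N q"
  shows "harmonic_at (\<lambda>q. L (N q)) q"
proof -
  obtain d where d: "\<And>b. b \<in> Basis \<Longrightarrow> has_second_derivative (\<lambda>t. N (q + t *\<^sub>R b)) (d b) 0"
    "(\<Sum>b\<in>Basis. d b) = 0" using assms(2) unfolding harmonic_at_def by blast
  have "(\<Sum>b\<in>Basis. L (d b)) = 0"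
    using d(2) linear_sum[OF bounded_linear.linear[OF assms(1)], of d Basis]
      linear_0[OF bounded_linear.linear[OF assms(1)]] by simp
  moreover have "has_second_derivative (\<lambda>t. L (N (q + t *\<^sub>R b))) (L (d b)) 0" if "b \<in> Basis" for b
    by (rule has_second_derivative_linear[OF assms(1) d(1)[OF that]])
  ultimately show ?thesis unfolding harmonic_at_def by (intro exI[of _ "\<lambda>b. L (d b)"]) simp
qed

lemma harmonic_at_sum:
  assumes "finite I" "\<And>i. i \<in> I \<Longrightarrow> harmonic_at (N i) q"
  shows "harmonic_at (\<lambda>q. \<Sum>i\<in>I. N i q) q"
proof -
  obtain d where d: "\<And>i b. i \<in> I \<Longrightarrow> b \<in> Basis \<Longrightarrow> has_second_derivative (\<lambda>t. N i (q + t *\<^sub>R b)) (d i b) 0"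
    "\<And>i. i \<in> I \<Longrightarrow> (\<Sum>b\<in>Basis. d i b) = 0" using assms(2) unfolding harmonic_at_def by metis
  have "(\<Sum>b\<in>Basis. \<Sum>i\<in>I. d i b) = 0" by (subst sum.swap) (simp add: d(2))
  moreover have "has_second_derivative (\<lambda>t. \<Sum>i\<in>I. N i (q + t *\<^sub>R b)) (\<Sum>i\<in>I. d i b) 0" if "b \<in> Basis" for b
    by (rule has_second_derivative_sum[OF d(1)[OF _ that] assms(1)])
  ultimately show ?thesis unfolding harmonic_at_def by (intro exI[of _ "\<lambda>b. \<Sum>i\<in>I. d i b"]) simp
qed

lemma harmonic_at_profile:
  assumes E: "open E" and \<Phi>: "\<Phi> holomorphic_on E"
    and sym: "\<And>w. w \<in> E \<Longrightarrow> cnj w \<in> E" "\<And>w. w \<in> E \<Longrightarrow> \<Phi> (cnj w) = cnj (\<Phi> w)"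
    and N1: "\<And>w. w \<in> E \<Longrightarrow> Im w \<noteq> 0 \<Longrightarrow> N w = Im (\<Phi> w) / Im w"
    and N2: "\<And>w. w \<in> E \<Longrightarrow> Im w = 0 \<Longrightarrow> N w = Re (deriv \<Phi> w)"
    and q: "profile q \<in> E"
  shows "harmonic_at (\<lambda>q. N (profile q)) q"
  using harmonic_at_real_point[OF E \<Phi> sym N1 N2 q] harmonic_at_nonreal_point[OF E \<Phi> N1 q] by blast

text \<open>
As a function of the variable \<open>h\<close> alone, the spherical quotient depends on the profile only, and
\<open>harmonic_at_profile\<close> applies to the pair in that variable: its conjugation symmetry is parity.
\<close>

lemma harmonic_spherical_quotient:
  assumes inv: "invariant n D" and D: "open_domain n D" and u: "regular_family n D H u"
    and h: "h \<in> {1..n} - H" and T: "T \<subseteq> {1..n} - H" "h \<notin> T" and z: "z \<in> D" "z h = profile q"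
  shows "harmonic_at (\<lambda>q. spherical_quotient h u (z(h := profile q)) T) q"
proof (rule harmonic_at_profile[where E="{w. z(h := w) \<in> D}" and \<Phi>="\<lambda>w. pair_fun h T u (z(h := w))"
      and N="\<lambda>w. spherical_quotient h u (z(h := w)) T"])
  have hn: "h \<in> {1..n}" using h by simp
  show "open {w. z(h := w) \<in> D}" by (rule open_slice[OF D domain_extensional[OF D z(1)] hn])
  show "(\<lambda>w. pair_fun h T u (z(h := w))) holomorphic_on {w. z(h := w) \<in> D}"
    by (rule regular_family_holomorphic[OF u h T z(1)])
  fix w assume w: "w \<in> {w. z(h := w) \<in> D}"
  show "cnj w \<in> {w. z(h := w) \<in> D}" using invariant_conj[OF inv _ hn, of "z(h := w)"] w by simp
  have "u (z(h := cnj w)) T = u (z(h := w)) T" "u (z(h := cnj w)) (insert h T) = - u (z(h := w)) (insert h T)"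
    using regular_family_parity[OF u T(1) _ hn, of "z(h := w)"]
      regular_family_parity[OF u _ _ hn, of "insert h T" "z(h := w)"] w T h by auto
  then show "pair_fun h T u (z(h := cnj w)) = cnj (pair_fun h T u (z(h := w)))"
    by (simp add: pair_fun_def complex_eq_iff)
  show "Im w \<noteq> 0 \<Longrightarrow> spherical_quotient h u (z(h := w)) T = Im (pair_fun h T u (z(h := w))) / Im w"
    by (simp add: spherical_quotient_def pair_fun_def)
  show "Im w = 0 \<Longrightarrow> spherical_quotient h u (z(h := w)) T = Re (deriv (\<lambda>w. pair_fun h T u (z(h := w))) w)"
    by (simp add: spherical_quotient_def)
next
  have "z(h := profile q) = z" using z(2) by (metis fun_upd_triv)
  then show "profile q \<in> {w. z(h := w) \<in> D}" using z(1) by simp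
qed

lemma holomorphic_pairs_monomial_mult:
  assumes inv: "invariant n D" and D: "open_domain n D" and F: "holomorphic_stem n D F"
    and K: "finite K" "K \<subseteq> {1..n}"
  shows "holomorphic_pairs n D {} (\<lambda>z T. inner (monomial_mult K F z T) b)"
  using K
proof (induction K)
  case empty
  then show ?case using holomorphic_stem_pairs[OF inv D F] by simp
next
  case (insert k K)
  have "(\<lambda>z T. inner (monomial_mult (insert k K) F z T) b)
    = real_var_mult k (\<lambda>z T. inner (monomial_mult K F z T) b)"
    by (intro ext) (simp add: monomial_mult_insert[OF insert.hyps] var_mult_def real_var_mult_def inner_add_left)
  then show ?case using real_var_mult_holomorphic_pairs[OF insert.IH] insert.prems by simp
qed

lemma regular_family_of_stem:
  assumes P: "P \<in> stem_functions n D" and hol: "holomorphic_pairs n D {} (\<lambda>z T. inner (P z T) b)"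
  shows "regular_family n D {} (\<lambda>z T. inner (P z T) b)"
  unfolding regular_family_def
proof (intro conjI allI impI ballI hol)
  fix T assume "T \<subseteq> {1..n} - {}"
  then have T: "T \<subseteq> {1..n}" by simp
  show "continuous_on D (\<lambda>z. inner (P z T) b)"
    by (intro continuous_intros stem_continuous[OF P T])
  fix z h assume "z \<in> D" "h \<in> {1..n}"
  then have "P (z(h := cnj (z h))) T = (-1) ^ card (T \<inter> {h}) * P z T"
    by (rule stem_parity[OF P T])
  then show "inner (P (z(h := cnj (z h))) T) b = (-1) ^ card (T \<inter> {h}) * inner (P z T) b"
    by (cases "even (card (T \<inter> {h}))") simp_all
qed

text \<open>
The variables in \<open>M - {h}\<close> are divided out first and \<open>h\<close> last, separately for each of the four
real coordinates. On the nonreal part the result is the spherical stem function. The extended function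
of the variable \<open>h\<close> alone is a sum of spherical quotients with constant left factors, since
no index of its components lies in \<open>M\<close>.
\<close>

lemma harmonic_extension:
  assumes inv: "invariant n D" and D: "open_domain n D" and P: "P \<in> stem_functions n D"
    and hol: "\<And>b. holomorphic_pairs n D {} (\<lambda>z T. inner (P z T) b)"
    and M: "M \<subseteq> {1..n}" and h: "h \<in> M"
  obtains G where "G \<in> stem_functions n D"
    "\<And>x. x \<in> \<Omega> n (nonreal_part D M) \<Longrightarrow> induced n D G x = induced n (nonreal_part D M) (spherical_stem M P) x"
    "\<And>x. x \<in> \<Omega> n D \<Longrightarrow> \<exists>N. harmonic_at N (x h) \<and>
       (\<forall>q. x(h := q) \<in> \<Omega> n D \<longrightarrow> induced n D G (x(h := q)) = N q)"
proof -
  let ?H = "M - {h}"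
  have fM: "finite M" using M finite_subset by blast
  have hM: "insert h ?H = M" using h by auto
  have hn: "h \<in> {1..n} - ?H" using h M by auto
  define u where "u b = (\<lambda>z T. inner (P z T) b)" for b
  have "\<exists>v. regular_family n D ?H v \<and> (\<forall>z\<in>nonreal_part D ?H. \<forall>T. T \<subseteq> {1..n} - ?H \<longrightarrow>
     v z T = u b z (T \<union> ?H) / (\<Prod>k\<in>?H. Im (z k)))" for b
  proof -
    have "regular_family n D {} (u b)" unfolding u_def by (rule regular_family_of_stem[OF P hol])
    moreover have "finite ?H" "?H \<subseteq> {1..n}" using fM M by auto
    ultimately obtain v where v: "regular_family n D ?H v"
      "\<And>z T. z \<in> nonreal_part D ?H \<Longrightarrow> T \<subseteq> {1..n} - ?H \<Longrightarrow> v z T = u b z (T \<union> ?H) / (\<Prod>k\<in>?H. Im (z k))"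
      by (rule iterated_spherical_quotient[OF inv D]) (rule that)
    then show ?thesis by (intro exI[of _ v]) auto
  qed
  then obtain v where v: "\<And>b. regular_family n D ?H (v b)"
    "\<And>b z T. z \<in> nonreal_part D ?H \<Longrightarrow> T \<subseteq> {1..n} - ?H \<Longrightarrow>
      v b z T = u b z (T \<union> ?H) / (\<Prod>k\<in>?H. Im (z k))" by metis
  define w where "w b = spherical_quotient h (v b)" for b
  have w: "regular_family n D M (w b)" for b
    unfolding w_def using spherical_quotient_regular[OF inv D v(1) hn] hM by metis
  have wval: "w b z T = inverse (\<Prod>k\<in>M. Im (z k)) * inner (P z (T \<union> M)) b"
    if z: "z \<in> nonreal_part D M" and T: "T \<subseteq> {1..n} - M" for b z T
  proof -
    have "z \<in> nonreal_part D ?H" "Im (z h) \<noteq> 0" using z h by (auto simp: nonreal_part_def)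
    moreover have "insert h T \<subseteq> {1..n} - ?H" using T hn by auto
    moreover have "insert h T \<union> ?H = T \<union> M" using h by auto
    moreover have "(\<Prod>k\<in>M. Im (z k)) = Im (z h) * (\<Prod>k\<in>?H. Im (z k))" by (rule prod.remove[OF fM h])
    ultimately show ?thesis using v(2)[of z "insert h T" b]
      by (simp add: w_def spherical_quotient_def u_def divide_inverse mult_ac)
  qed
  define G where "G z T = (if T \<inter> M = {} then \<Sum>b\<in>Basis. w b z T *\<^sub>R b else 0)" for z T
  have G: "G \<in> stem_functions n D"
    unfolding stem_functions_def
  proof (intro CollectI ballI conjI)
    fix T assume "T \<in> Pow {1..n}"
    then have T: "T \<inter> M = {} \<Longrightarrow> T \<subseteq> {1..n} - M" by auto
    show "continuous_on D (\<lambda>z. G z T)"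
    proof (cases "T \<inter> M = {}")
      case True
      have "continuous_on D (\<lambda>z. \<Sum>b\<in>Basis. w b z T *\<^sub>R (b::quat))"
        by (intro continuous_intros regular_family_continuous[OF w T[OF True]])
      then show ?thesis using True by (simp add: G_def)
    qed (simp add: G_def)
    fix z k assume zk: "z \<in> D" "k \<in> {1..n}"
    show "G (z(k := cnj (z k))) T = (-1) ^ card (T \<inter> {k}) * G z T"
    proof (cases "T \<inter> M = {}")
      case True
      have "(\<Sum>b\<in>Basis. w b (z(k := cnj (z k))) T *\<^sub>R b) = (-1) ^ card (T \<inter> {k}) * (\<Sum>b\<in>Basis. w b z T *\<^sub>R (b::quat))"
        unfolding regular_family_parity[OF w T[OF True] zk]
        by (cases "even (card (T \<inter> {k}))") (simp_all add: sum_negf)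
      then show ?thesis using True by (simp add: G_def)
    qed (simp add: G_def)
  qed
  have GS: "G z T = spherical_stem M P z T" if z: "z \<in> nonreal_part D M" and T: "T \<subseteq> {1..n}" for z T
  proof (cases "T \<inter> M = {}")
    case True
    then have "T \<subseteq> {1..n} - M" using T by auto
    then have "G z T = (\<Sum>b\<in>Basis. (inverse (\<Prod>k\<in>M. Im (z k)) * inner (P z (T \<union> M)) b) *\<^sub>R b)"
      using True wval[OF z] by (simp add: G_def)
    also have "\<dots> = inverse (\<Prod>k\<in>M. Im (z k)) *\<^sub>R (\<Sum>b\<in>Basis. inner (P z (T \<union> M)) b *\<^sub>R b)"
      by (simp add: scaleR_sum_right)
    also have "\<dots> = spherical_stem M P z T"
      unfolding euclidean_representation using True by (simp add: spherical_stem_def)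
    finally show ?thesis .
  qed (simp add: G_def spherical_stem_def)
  show ?thesis
  proof (rule that[OF G])
    fix x assume x: "x \<in> \<Omega> n (nonreal_part D M)"
    have xD: "x \<in> \<Omega> n D" using x circularization_mono[OF nonreal_part_subset] by blast
    have z: "profiles n x \<in> nonreal_part D M"
      using x circularization_iff[OF nonreal_part_invariant[OF inv]] by blast
    show "induced n D G x = induced n (nonreal_part D M) (spherical_stem M P) x"
      unfolding induced_canonical[OF inv G xD]
        induced_canonical[OF nonreal_part_invariant[OF inv] spherical_stem_stem[OF P M] x] slice_value_def
      by (rule sum.cong) (use GS[OF z] in auto)
  next
    fix x assume x: "x \<in> \<Omega> n D"
    define z where "z = profiles n x"
    let ?J = "\<lambda>k. im_unit (x k)"
    have zD: "z \<in> D" using x circularization_iff[OF inv] by (auto simp: z_def)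
    have h1: "h \<in> {1..n}" using h M by auto
    have zh: "z h = profile (x h)" using h1 by (simp add: z_def profiles_def)
    define N where "N q = (\<Sum>T\<in>Pow ({1..n} - M). \<Sum>b\<in>Basis. oprod ?J T * (w b (z(h := profile q)) T *\<^sub>R b))" for q
    have "harmonic_at N (x h)"
      unfolding N_def
    proof (intro harmonic_at_sum)
      fix T and b :: quat assume "T \<in> Pow ({1..n} - M)" "b \<in> Basis"
      then have T: "T \<subseteq> {1..n} - ?H" "h \<notin> T" using h by auto
      have harm: "harmonic_at (\<lambda>q. w b (z(h := profile q)) T) (x h)"
        unfolding w_def by (rule harmonic_spherical_quotient[OF inv D v(1) hn T zD zh])
      have lin: "bounded_linear (\<lambda>r. oprod ?J T * (r *\<^sub>R b))"
        by (rule bounded_linear_compose[OF bounded_linear_mult_right bounded_linear_scaleR_left])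
      show "harmonic_at (\<lambda>q. oprod ?J T * (w b (z(h := profile q)) T *\<^sub>R b)) (x h)"
        by (rule harmonic_at_linear[OF lin harm])
    qed auto
    moreover have "induced n D G (x(h := q)) = N q" if q: "x(h := q) \<in> \<Omega> n D" for q
    proof -
      let ?J' = "\<lambda>k. im_unit ((x(h := q)) k)"
      have "induced n D G (x(h := q)) = (\<Sum>T\<in>Pow {1..n}. oprod ?J' T * G (z(h := profile q)) T)"
        using induced_canonical[OF inv G q] by (simp add: slice_value_def profiles_upd[OF h1] z_def)
      also have "\<dots> = (\<Sum>T\<in>Pow ({1..n} - M). oprod ?J' T * G (z(h := profile q)) T)"
        by (rule sum.mono_neutral_right) (auto simp: G_def)
      also have "\<dots> = N q"
        unfolding N_def
      proof (rule sum.cong)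
        fix T assume T: "T \<in> Pow ({1..n} - M)"
        then have "T \<inter> M = {}" "finite T" "h \<notin> T" using h finite_subset[of T "{1..n} - M"] by auto
        moreover from this have "oprod ?J' T = oprod ?J T" by (intro oprod_cong) auto
        ultimately show "oprod ?J' T * G (z(h := profile q)) T
          = (\<Sum>b\<in>Basis. oprod ?J T * (w b (z(h := profile q)) T *\<^sub>R b))"
          by (simp only: G_def if_True sum_distrib_left simp_thms)
      qed simp
      finally show ?thesis .
    qed
    ultimately show "\<exists>N. harmonic_at N (x h) \<and>
       (\<forall>q. x(h := q) \<in> \<Omega> n D \<longrightarrow> induced n D G (x(h := q)) = N q)" by blast
  qed
qed

lemma has_laplacian_zero:
  assumes inv: "invariant n D" and D: "open_domain n D" and h: "h \<in> {1..n}" and x: "x \<in> \<Omega> n D"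
    and N: "harmonic_at N (x h)" and eq: "\<And>q. x(h := q) \<in> \<Omega> n D \<Longrightarrow> g (x(h := q)) = N q"
  shows "has_laplacian h g 0 x"
proof -
  obtain d where d: "\<And>b. b \<in> Basis \<Longrightarrow> has_second_derivative (\<lambda>t. N (x h + t *\<^sub>R b)) (d b) 0"
    "(\<Sum>b\<in>Basis. d b) = 0" using N unfolding harmonic_at_def by blast
  define z where "z = profiles n x"
  have zD: "z \<in> D" and xe: "x \<in> {1..n} \<rightarrow>\<^sub>E UNIV"
    using x circularization_iff[OF inv] by (auto simp: z_def)
  have inO: "x(h := q) \<in> \<Omega> n D" if "z(h := profile q) \<in> D" for q
  proof -
    have "x(h := q) \<in> {1..n} \<rightarrow>\<^sub>E UNIV" using xe h by (auto simp: PiE_def extensional_def)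
    then show ?thesis using that circularization_iff[OF inv] by (simp add: profiles_upd[OF h] z_def)
  qed
  have "has_second_derivative (\<lambda>t. g (x(h := x h + t *\<^sub>R b))) (d b) 0" if b: "b \<in> Basis" for b
  proof (rule has_second_derivative_cong[OF d(1)[OF b]])
    have "open ((\<lambda>t. profile (x h + t *\<^sub>R b)) -` {w. z(h := w) \<in> D})"
      by (rule open_vimage[OF open_slice[OF D domain_extensional[OF D zD] h]])
         (intro continuous_on_profile continuous_intros)
    then have "\<forall>\<^sub>F t in nhds 0. t \<in> (\<lambda>t. profile (x h + t *\<^sub>R b)) -` {w. z(h := w) \<in> D}"
    proof (rule eventually_nhds_in_open)
      have "z h = profile (x h)" using h by (simp add: z_def profiles_def)
      then have "z(h := profile (x h)) = z" by (metis fun_upd_triv)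
      then show "0 \<in> (\<lambda>t. profile (x h + t *\<^sub>R b)) -` {w. z(h := w) \<in> D}" using zD by simp
    qed
    then show "\<forall>\<^sub>F t in nhds 0. N (x h + t *\<^sub>R b) = g (x(h := x h + t *\<^sub>R b))"
      by eventually_elim (simp add: eq inO)
  qed
  then show ?thesis using d(2) unfolding has_laplacian_def by (intro exI[of _ d]) simp
qed

text \<open>
The extension produced by \<open>harmonic_extension\<close> may depend on \<open>h\<close>, but all continuous extensions
coincide by density, so each of them is harmonic in every variable.
\<close>

lemma spherical_component_harmonic:
  assumes inv: "invariant n D" and D: "open_domain n D" and f: "f \<in> slice_regular n D"
    and m: "m \<in> {1..n}" and K: "K \<subseteq> {1..m}"
  shows "\<exists>g. continuous_extension (\<Omega> n (nonreal_part D {1..m})) (\<Omega> n D) (spherical_component n D m K f) g"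
    and "continuous_extension (\<Omega> n (nonreal_part D {1..m})) (\<Omega> n D) (spherical_component n D m K f) g \<Longrightarrow>
      h \<in> {1..m} \<Longrightarrow> x \<in> \<Omega> n D \<Longrightarrow> has_laplacian h g 0 x"
proof -
  let ?ext = "continuous_extension (\<Omega> n (nonreal_part D {1..m})) (\<Omega> n D) (spherical_component n D m K f)"
  obtain F where F: "holomorphic_stem n D F" "\<And>x. x \<in> \<Omega> n D \<Longrightarrow> f x = induced n D F x"
    using f unfolding slice_regular_def by blast
  have FS: "F \<in> stem_functions n D" using F(1) by (simp add: holomorphic_stem_def)
  have K': "finite K" "K \<subseteq> {1..n}" using K m finite_subset by auto
  have M: "{1..m} \<subseteq> {1..n}" "m \<le> n" using m by auto
  let ?P = "monomial_mult K F"
  have P: "?P \<in> stem_functions n D" by (rule monomial_mult_stem[OF FS K'(2)])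
  have hol: "\<And>b. holomorphic_pairs n D {} (\<lambda>z T. inner (?P z T) b)"
    by (rule holomorphic_pairs_monomial_mult[OF inv D F(1) K'])
  have sc: "spherical_component n D m K f
      = induced n (nonreal_part D {1..m}) (spherical_stem {1..m} ?P)"
    by (rule spherical_component_induced[OF inv FS F(2) K'(2) M(2)])
  have ext: "\<exists>G. G \<in> stem_functions n D \<and>
      ?ext (induced n D G) \<and>
      (\<forall>x\<in>\<Omega> n D. \<exists>N. harmonic_at N (x h) \<and> (\<forall>q. x(h := q) \<in> \<Omega> n D \<longrightarrow> induced n D G (x(h := q)) = N q))"
    if h: "h \<in> {1..m}" for h
  proof -
    obtain G where G: "G \<in> stem_functions n D"
      "\<And>x. x \<in> \<Omega> n (nonreal_part D {1..m}) \<Longrightarrow> induced n D G x = induced n (nonreal_part D {1..m}) (spherical_stem {1..m} ?P) x"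
      "\<And>x. x \<in> \<Omega> n D \<Longrightarrow> \<exists>N. harmonic_at N (x h) \<and>
       (\<forall>q. x(h := q) \<in> \<Omega> n D \<longrightarrow> induced n D G (x(h := q)) = N q)"
      using harmonic_extension[OF inv D P hol M(1) h] by metis
    then show ?thesis
      unfolding continuous_extension_def sc using continuous_on_induced[OF inv G(1)] by blast
  qed
  have "m \<in> {1..m}" using m by simp
  from ext[OF this]
  show "\<exists>g. ?ext g"
    by blast
  assume g: "?ext g"
    and h: "h \<in> {1..m}" and x: "x \<in> \<Omega> n D"
  obtain G where G: "?ext (induced n D G)"
    "\<And>x. x \<in> \<Omega> n D \<Longrightarrow> \<exists>N. harmonic_at N (x h) \<and> (\<forall>q. x(h := q) \<in> \<Omega> n D \<longrightarrow> induced n D G (x(h := q)) = N q)"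
    using ext[OF h] by blast
  have gG: "g y = induced n D G y" if "y \<in> \<Omega> n D" for y
    by (rule agree_from_nonreal_part[OF inv D M(1) _ _ _ that])
       (use g G(1) in \<open>auto simp: continuous_extension_def\<close>)
  from G(2)[OF x] obtain N where N: "harmonic_at N (x h)"
    "\<And>q. x(h := q) \<in> \<Omega> n D \<Longrightarrow> induced n D G (x(h := q)) = N q" by blast
  have "h \<in> {1..n}" using h M by auto
  then show "has_laplacian h g 0 x"
    by (rule has_laplacian_zero[OF inv D _ x N(1)]) (simp add: gG N(2))
qed

section \<open>The representation theorem\<close>

lemma spherical_component_circular:
  assumes inv: "invariant n D" and f: "f \<in> slice_functions n D" and m: "m \<in> {1..n}" and K: "K \<subseteq> {1..m}"
  shows "spherical_component n D m K f \<in> circular_wrt_set n (nonreal_part D {1..m}) {1..m}"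
    and "m < n \<Longrightarrow> spherical_component n D m K f \<in> slice_wrt n (nonreal_part D {1..m}) (m + 1)"
proof -
  let ?F = "stem_of n D f" and ?D = "nonreal_part D {1..m}"
  note F = stem_of_spec[OF f]
  have K': "K \<subseteq> {1..n}" and M: "{1..m} \<subseteq> {1..n}" "m \<le> n" using K m by auto
  have P: "monomial_mult K ?F \<in> stem_functions n D" by (rule monomial_mult_stem[OF F(1) K'])
  let ?G = "spherical_stem {1..m} (monomial_mult K ?F)"
  have G: "?G \<in> stem_functions n ?D" by (rule spherical_stem_stem[OF P M(1)])
  have sc: "spherical_component n D m K f = induced n ?D ?G"
    by (rule spherical_component_induced[OF inv F K' M(2)])
  have zero: "?G z T = 0" if "k \<in> T" "k \<in> {1..m}" for z T k
    using that by (auto simp: spherical_stem_def)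
  have "induced n ?D ?G \<in> circular_wrt n ?D h" if "h \<in> {1..m}" for h
    by (rule induced_circular_wrt[OF nonreal_part_invariant[OF inv] G]) (use that M zero in auto)
  then show "spherical_component n D m K f \<in> circular_wrt_set n ?D {1..m}"
    unfolding sc circular_wrt_set_def using induced_in_slice_functions[OF G] by blast
  assume mn: "m < n"
  show "spherical_component n D m K f \<in> slice_wrt n ?D (m + 1)"
    unfolding sc
  proof (rule induced_slice_wrt[OF nonreal_part_invariant[OF inv] G])
    fix z T k assume "T \<subseteq> {1..n}" "k \<in> T" "k < m + 1"
    then show "?G z T = 0" by (intro zero[of k]) auto
  qed (use mn in simp)
qed

theorem corollary3p3:
  fixes n m :: nat and D :: "(nat \<Rightarrow> complex) set" and f :: "(nat \<Rightarrow> quat) \<Rightarrow> quat"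
  assumes "openin (top_of_set ({1..n} \<rightarrow>\<^sub>E UNIV)) D"
    and "invariant n D"
    and "f \<in> slice_functions n D"
    and "m \<in> {1..n}"
  shows "(\<forall>x \<in> \<Omega> n (nonreal_part D {1..m}).
            f x = (\<Sum>K\<in>Pow {1..m}. (-1) ^ card ({1..m} - K)
                     * oprod (\<lambda>k. qcnj (x k)) ({1..m} - K) * spherical_component n D m K f x))
    \<and> (m < n \<longrightarrow> (\<forall>K\<in>Pow {1..m}. spherical_component n D m K f
            \<in> circular_wrt_set n (nonreal_part D {1..m}) {1..m}
              \<inter> slice_wrt n (nonreal_part D {1..m}) (m + 1)))
    \<and> (\<forall>K\<in>Pow {1..n}. spherical_component n D n K f
            \<in> circular_wrt_set n (nonreal_part D {1..n}) {1..n})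
    \<and> (f \<in> slice_regular n D \<longrightarrow> (\<forall>K\<in>Pow {1..m}.
          (\<exists>g. continuous_extension (\<Omega> n (nonreal_part D {1..m})) (\<Omega> n D)
                 (spherical_component n D m K f) g)
        \<and> (\<forall>g. continuous_extension (\<Omega> n (nonreal_part D {1..m})) (\<Omega> n D)
                 (spherical_component n D m K f) g
               \<longrightarrow> (\<forall>h\<in>{1..m}. \<forall>x\<in>\<Omega> n D. has_laplacian h g 0 x))))"
proof -
  note f = stem_of_spec[OF assms(3)]
  have D: "open_domain n D" using assms(1) by (simp add: open_domain_def)
  have m: "m \<le> n" "n \<in> {1..n}" using assms(4) by auto
  show ?thesis
  proof (intro conjI ballI impI allI IntI)
    fix x assume x: "x \<in> \<Omega> n (nonreal_part D {1..m})"
    show "f x = (\<Sum>K\<in>Pow {1..m}. (-1) ^ card ({1..m} - K)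
        * oprod (\<lambda>k. qcnj (x k)) ({1..m} - K) * spherical_component n D m K f x)"
      by (rule representation_formula[OF assms(2) f(1) _ m(1) x]) (rule f(2))
  next
    fix K assume "K \<in> Pow {1..m}"
    then show "spherical_component n D m K f \<in> circular_wrt_set n (nonreal_part D {1..m}) {1..m}"
      by (intro spherical_component_circular(1)[OF assms(2,3,4)]) simp
  next
    fix K assume "m < n" "K \<in> Pow {1..m}"
    then show "spherical_component n D m K f \<in> slice_wrt n (nonreal_part D {1..m}) (m + 1)"
      by (intro spherical_component_circular(2)[OF assms(2,3,4)]) simp
  next
    fix K assume "K \<in> Pow {1..n}"
    then show "spherical_component n D n K f \<in> circular_wrt_set n (nonreal_part D {1..n}) {1..n}"
      by (intro spherical_component_circular(1)[OF assms(2,3) m(2)]) simp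
  next
    fix K assume "f \<in> slice_regular n D" "K \<in> Pow {1..m}"
    then show "\<exists>g. continuous_extension (\<Omega> n (nonreal_part D {1..m})) (\<Omega> n D) (spherical_component n D m K f) g"
      by (intro spherical_component_harmonic(1)[OF assms(2) D _ assms(4)]) simp_all
  next
    fix K g h x
    assume "f \<in> slice_regular n D" "K \<in> Pow {1..m}" "h \<in> {1..m}" "x \<in> \<Omega> n D"
      "continuous_extension (\<Omega> n (nonreal_part D {1..m})) (\<Omega> n D) (spherical_component n D m K f) g"
    then show "has_laplacian h g 0 x"
      by (intro spherical_component_harmonic(2)[OF assms(2) D _ assms(4)]) auto
  qed
qed

end
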